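(* Let $X$ be an irreducible thick right-angled building of non-spherical type $(W,I)$, with $I$ finite. If $\mathrm{Aut}(X)^+$ is transitive on the chambers of $X$, then $\mathrm{Aut}(X)^+$ is strongly transitive on $X$ and abstractly simple.
   Context: A Coxeter system $(W,I)$ with Coxeter matrix $(m_{i,j})$ is right-angled if $m_{i,j}\in\{2,\infty\}$ for all $i\neq j$; a building is right-angled, irreducible, or of non-spherical type if its type $(W,I)$ is respectively right-angled, irreducible ($I$ is non-empty and is not the union of two disjoint non-empty subsets commuting elementwise), or non-spherical ($W$ infinite). A building $X$ of type $(W,I)$ is viewed as a set of chambers $\mathrm{Ch}(X)$ with a Weyl distance $\delta:\mathrm{Ch}(X)\times\mathrm{Ch}(X)\to W$. It is thick if every panel contains at least three chambers. $\mathrm{Aut}(X)^+$ is the group of type-preserving automorphisms, i.e. of permutations of $\mathrm{Ch}(X)$ preserving $\delta$. Apartments are taken in the complete apartment system: the images of $W$, with Weyl distance $(v,w)\mapsto v^{-1}w$, under $\delta$-preserving maps into $\mathrm{Ch}(X)$. A group acts strongly transitively if it is transitive on the pairs $(c,A)$ with $c$ a chamber and $A$ an apartment containing $c$. Abstractly simple means simple as an abstract group. *)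

theory Defs
  imports "HOL-Algebra.Algebra" "HOL-Library.Extended_Nat"
begin

section \<open>Coxeter systems\<close>

text \<open>The index set \<open>I\<close> of a Coxeter system \<open>(W, I)\<close> is taken to be the set of generators itself.\<close>

definition word_val :: "('w, 'b) monoid_scheme \<Rightarrow> 'w list \<Rightarrow> 'w" where
  "word_val W us = foldr (\<otimes>\<^bsub>W\<^esub>) us \<one>\<^bsub>W\<^esub>"

text \<open>The entry at \<open>(s, t)\<close> of the Coxeter matrix is the order of \<open>st\<close>.
  The library's \<^const>\<open>group.ord\<close> is \<open>0\<close> on elements of infinite order.\<close>

definition coxeter_matrix :: "('w, 'b) monoid_scheme \<Rightarrow> 'w \<Rightarrow> 'w \<Rightarrow> enat" where
  "coxeter_matrix W s t =
     (let k = group.ord W (s \<otimes>\<^bsub>W\<^esub> t) in if k = 0 then \<infinity> else enat k)"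

inductive coxeter_relation ::
  "('w, 'b) monoid_scheme \<Rightarrow> 'w set \<Rightarrow> 'w list \<Rightarrow> 'w list \<Rightarrow> bool"
  for W :: "('w, 'b) monoid_scheme" and I :: "'w set" where
  "\<lbrakk>u \<in> lists I; v \<in> lists I; s \<in> I; t \<in> I; coxeter_matrix W s t = enat k\<rbrakk>
    \<Longrightarrow> coxeter_relation W I (u @ concat (replicate k [s, t]) @ v) (u @ v)"

text \<open>Coxeter systems in the sense of Bourbaki: \<open>I\<close> generates \<open>W\<close>, consists of elements of
  order 2, and \<open>W\<close> has the presentation with generators \<open>I\<close> and relators \<open>(st)\<^sup>k\<close>, where
  \<open>k\<close> is the order of \<open>st\<close>, one for each pair \<open>(s, t)\<close> with \<open>k\<close> finite.
  The relators with \<open>s = t\<close> are \<open>ss\<close>, so the presentation can be expressed with words in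
  \<open>I\<close> only, without formal inverses.\<close>

locale coxeter_system = group W for W (structure) +
  fixes I
  assumes gens_closed: "I \<subseteq> carrier W"
    and gens_order: "s \<in> I \<Longrightarrow> ord s = 2"
    and gens_generate: "generate W I = carrier W"
    and presentation: "\<lbrakk>u \<in> lists I; v \<in> lists I\<rbrakk>
      \<Longrightarrow> word_val W u = word_val W v \<longleftrightarrow> equivclp (coxeter_relation W I) u v"

definition word_length :: "('w, 'b) monoid_scheme \<Rightarrow> 'w set \<Rightarrow> 'w \<Rightarrow> nat" where
  "word_length W I w = (LEAST n. \<exists>us \<in> lists I. length us = n \<and> word_val W us = w)"

definition right_angled :: "('w, 'b) monoid_scheme \<Rightarrow> 'w set \<Rightarrow> bool" where
  "right_angled W I \<longleftrightarrow> (\<forall>s\<in>I. \<forall>t\<in>I. s \<noteq> t \<longrightarrow> coxeter_matrix W s t \<in> {2, \<infinity>})"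

definition irreducible_type :: "('w, 'b) monoid_scheme \<Rightarrow> 'w set \<Rightarrow> bool" where
  "irreducible_type W I \<longleftrightarrow> I \<noteq> {} \<and>
     \<not> (\<exists>J K. J \<noteq> {} \<and> K \<noteq> {} \<and> J \<inter> K = {} \<and> J \<union> K = I \<and>
          (\<forall>s\<in>J. \<forall>t\<in>K. s \<otimes>\<^bsub>W\<^esub> t = t \<otimes>\<^bsub>W\<^esub> s))"

definition spherical_type :: "('w, 'b) monoid_scheme \<Rightarrow> bool" where
  "spherical_type W \<longleftrightarrow> finite (carrier W)"


section \<open>Buildings\<close>

text \<open>Buildings as chamber sets with a Weyl distance, with the axioms (WD1)--(WD3) of
  Abramenko and Brown.\<close>

locale building = coxeter_system W I for W (structure) and I +
  fixes Ch :: "'c set" and \<delta> :: "'c \<Rightarrow> 'c \<Rightarrow> 'a"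
  assumes chambers_nonempty: "Ch \<noteq> {}"
    and dist_closed: "\<lbrakk>c \<in> Ch; d \<in> Ch\<rbrakk> \<Longrightarrow> \<delta> c d \<in> carrier W"
    and WD1: "\<lbrakk>c \<in> Ch; d \<in> Ch\<rbrakk> \<Longrightarrow> \<delta> c d = \<one> \<longleftrightarrow> c = d"
    and WD2: "\<lbrakk>c \<in> Ch; d \<in> Ch; c' \<in> Ch; s \<in> I; \<delta> c' c = s\<rbrakk>
      \<Longrightarrow> \<delta> c' d \<in> {s \<otimes> \<delta> c d, \<delta> c d}"
    and WD2_length: "\<lbrakk>c \<in> Ch; d \<in> Ch; c' \<in> Ch; s \<in> I; \<delta> c' c = s;
        word_length W I (s \<otimes> \<delta> c d) = word_length W I (\<delta> c d) + 1\<rbrakk>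
      \<Longrightarrow> \<delta> c' d = s \<otimes> \<delta> c d"
    and WD3: "\<lbrakk>c \<in> Ch; d \<in> Ch; s \<in> I\<rbrakk>
      \<Longrightarrow> \<exists>c'\<in>Ch. \<delta> c' c = s \<and> \<delta> c' d = s \<otimes> \<delta> c d"

definition panel ::
  "('w, 'b) monoid_scheme \<Rightarrow> 'c set \<Rightarrow> ('c \<Rightarrow> 'c \<Rightarrow> 'w) \<Rightarrow> 'w \<Rightarrow> 'c \<Rightarrow> 'c set" where
  "panel W Ch \<delta> s c = {d \<in> Ch. \<delta> c d \<in> {\<one>\<^bsub>W\<^esub>, s}}"

text \<open>Panels may be infinite, hence the subset of cardinality 3.\<close>

definition thick ::
  "('w, 'b) monoid_scheme \<Rightarrow> 'w set \<Rightarrow> 'c set \<Rightarrow> ('c \<Rightarrow> 'c \<Rightarrow> 'w) \<Rightarrow> bool" where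
  "thick W I Ch \<delta> \<longleftrightarrow> (\<forall>s\<in>I. \<forall>c\<in>Ch. \<exists>T \<subseteq> panel W Ch \<delta> s c. card T = 3)"

definition Aut_plus :: "'c set \<Rightarrow> ('c \<Rightarrow> 'c \<Rightarrow> 'w) \<Rightarrow> ('c \<Rightarrow> 'c) monoid" where
  "Aut_plus Ch \<delta> =
     (BijGroup Ch)\<lparr>carrier := {g \<in> Bij Ch. \<forall>c\<in>Ch. \<forall>d\<in>Ch. \<delta> (g c) (g d) = \<delta> c d}\<rparr>"

definition apartments ::
  "('w, 'b) monoid_scheme \<Rightarrow> 'c set \<Rightarrow> ('c \<Rightarrow> 'c \<Rightarrow> 'w) \<Rightarrow> 'c set set" where
  "apartments W Ch \<delta> = {\<alpha> ` carrier W | \<alpha>. \<alpha> \<in> carrier W \<rightarrow> Ch \<and>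
     (\<forall>v\<in>carrier W. \<forall>w\<in>carrier W. \<delta> (\<alpha> v) (\<alpha> w) = inv\<^bsub>W\<^esub> v \<otimes>\<^bsub>W\<^esub> w)}"

definition pointed_apartments ::
  "('w, 'b) monoid_scheme \<Rightarrow> 'c set \<Rightarrow> ('c \<Rightarrow> 'c \<Rightarrow> 'w) \<Rightarrow> ('c \<times> 'c set) set" where
  "pointed_apartments W Ch \<delta> = {(c, A). c \<in> A \<and> A \<in> apartments W Ch \<delta>}"

definition strongly_transitive ::
  "('w, 'b) monoid_scheme \<Rightarrow> 'c set \<Rightarrow> ('c \<Rightarrow> 'c \<Rightarrow> 'w)
    \<Rightarrow> ('g, 'd) monoid_scheme \<Rightarrow> ('g \<Rightarrow> 'c \<Rightarrow> 'c) \<Rightarrow> bool" where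
  "strongly_transitive W Ch \<delta> G \<phi> \<longleftrightarrow>
     transitive_action G (pointed_apartments W Ch \<delta>)
       (\<lambda>g. \<lambda>(c, A) \<in> pointed_apartments W Ch \<delta>. (\<phi> g c, \<phi> g ` A))"


section \<open>Simple groups\<close>

text \<open>The library's \<^locale>\<open>simple_group\<close> requires \<open>order G > 1\<close>; as \<^const>\<open>order\<close> is \<open>0\<close> on
  infinite groups, it excludes these.\<close>

definition abstractly_simple :: "('g, 'd) monoid_scheme \<Rightarrow> bool" where
  "abstractly_simple G \<longleftrightarrow> group G \<and> carrier G \<noteq> {\<one>\<^bsub>G\<^esub>} \<and>
     (\<forall>N. N \<lhd> G \<longrightarrow> N = {\<one>\<^bsub>G\<^esub>} \<or> N = carrier G)"

end

theory Submission
  imports Defs "HOL-Combinatorics.Transposition"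
begin

text \<open>
  Both assertions rest on one way of producing automorphisms. By chamber transitivity all panels
  of a type \<open>s\<close> have the same size, so for each \<open>s\<close> there is a set of colours of that size, on which
  a group structure is chosen. A colouring gives each chamber one colour for each type \<open>s\<close>,
  bijectively on \<open>s\<close>-panels and constantly along \<open>t\<close>-adjacency whenever \<open>t \<noteq> s\<close> commutes with \<open>s\<close>.
  A gallery is then described by the types of its steps and the quotients of the
  colours before and after each step. This description can be followed from any other chamber,
  with respect to any other colouring. Where the copy ends depends only on where the gallery ends:
  in a right-angled Coxeter group a word that is not reduced can be shortened by exchanging commuting
  neighbours and merging two equal neighbours, and both operations are compatible with colour
  quotients. So for any two colourings and any two chambers there is an automorphism that takes one
  chamber to the other and the quotients of one colouring to those of the other
  (\<open>tracking_map_exists\<close>, \<open>tracks_isometry\<close>). What remains is to choose colourings well.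

  Strong transitivity: two apartments with base chambers are two copies of \<open>W\<close>. A wall of \<open>W\<close> of type
  \<open>s\<close> corresponds to a residue of type \<open>s\<close> together with its commuting generators, and a colouring may
  be permuted on each such residue separately. A suitable choice makes the colours along the second
  apartment those along the first, and the automorphism maps one to the other
  (\<open>chart_extension\<close>).

  Simplicity: let \<open>N\<close> be a nontrivial normal subgroup. The wing of a chamber \<open>c\<close> with respect to \<open>r\<close>
  consists of the chambers whose projection to the \<open>r\<close>-panel of \<open>c\<close> is \<open>c\<close>. Recolouring outside a
  wing shows that the pointwise fixator of the wing permutes the other chambers of the panel
  arbitrarily. Hence stabilizers of chambers are transitive on spheres, and an argument
  of Tits makes \<open>N\<close> transitive on chambers (\<open>normal_chamber_transitive\<close>). Let \<open>u\<close> fix a wing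
  pointwise. By transitivity \<open>N\<close> has an element \<open>h\<close> whose powers move the support of \<open>u\<close> to disjoint
  places, and \<open>u\<close> is the commutator of \<open>h\<close> with the infinite product of the conjugates
  \<open>h\<^sup>k u h\<^sup>-\<^sup>k\<close>, \<open>k \<ge> 0\<close>; so \<open>u \<in> N\<close> (\<open>translated_support_in_normal\<close>, \<open>wing_fixators_in_normal\<close>).
  Finally every automorphism fixing a chamber \<open>c\<close> is a finite product of fixators of wings: residue by
  residue around \<open>c\<close>, what it does outside and inside a wing can be extended separately to the
  whole building (\<open>stabilizer_on_residue\<close>). So \<open>N\<close> is transitive on chambers and contains a chamber
  stabilizer, hence is everything.
\<close>

section \<open>Right-angled Coxeter groups\<close>

locale right_angled_coxeter_system = coxeter_system +
  assumes right_angled: "right_angled W I"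
begin

abbreviation val :: "'a list \<Rightarrow> 'a" where "val \<equiv> word_val W"
abbreviation len :: "'a \<Rightarrow> nat" where "len \<equiv> word_length W I"

lemma gen_closed [simp]: "s \<in> I \<Longrightarrow> s \<in> carrier W"
  using gens_closed by blast

lemma gen_sq [simp]: "s \<in> I \<Longrightarrow> s \<otimes> s = \<one>"
  using pow_ord_eq_1[of s] gens_order[of s] gen_closed[of s] by (simp add: numeral_2_eq_2)

lemma gen_sq_left [simp]: "\<lbrakk>s \<in> I; x \<in> carrier W\<rbrakk> \<Longrightarrow> s \<otimes> (s \<otimes> x) = x"
  by (simp add: m_assoc[symmetric])

lemma inv_gen [simp]: "s \<in> I \<Longrightarrow> inv s = s"
  by (simp add: inv_equality)

lemma gen_neq_one [simp]: "s \<in> I \<Longrightarrow> s \<noteq> \<one>"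
  using gens_order[of s] ord_eq_1[of s] by fastforce

lemma inv_cancel_left [simp]:
  "\<lbrakk>x \<in> carrier W; y \<in> carrier W\<rbrakk> \<Longrightarrow> inv x \<otimes> (x \<otimes> y) = y"
  "\<lbrakk>x \<in> carrier W; y \<in> carrier W\<rbrakk> \<Longrightarrow> x \<otimes> (inv x \<otimes> y) = y"
  by (simp_all add: m_assoc[symmetric])

lemma val_Nil [simp]: "val [] = \<one>"
  by (simp add: word_val_def)

lemma val_Cons [simp]: "val (s # u) = s \<otimes> val u"
  by (simp add: word_val_def)

lemma val_closed [simp]: "u \<in> lists I \<Longrightarrow> val u \<in> carrier W"
  by (induction u) auto

lemma rev_lists [simp]: "rev u \<in> lists J \<longleftrightarrow> u \<in> lists J"
  by (simp add: in_lists_conv_set)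

declare in_lists_conv_set [simp del]

lemma val_append [simp]: "\<lbrakk>u \<in> lists I; v \<in> lists I\<rbrakk> \<Longrightarrow> val (u @ v) = val u \<otimes> val v"
  by (induction u) (auto simp: m_assoc)

lemma val_rev [simp]: "u \<in> lists I \<Longrightarrow> val (rev u) = inv (val u)"
  by (induction u) (auto simp: inv_mult_group)

lemma commute_iff_finite_order:
  assumes "s \<in> I" "t \<in> I" "s \<noteq> t"
  shows "s \<otimes> t = t \<otimes> s \<longleftrightarrow> ord (s \<otimes> t) \<noteq> 0"
proof
  assume "ord (s \<otimes> t) \<noteq> 0"
  then have "coxeter_matrix W s t = enat (ord (s \<otimes> t))"
    by (simp add: coxeter_matrix_def Let_def)
  with right_angled assms have "enat (ord (s \<otimes> t)) \<in> {2, \<infinity>}"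
    unfolding right_angled_def by metis
  then have "ord (s \<otimes> t) = 2"
    by (simp add: numeral_eq_enat)
  then have "(s \<otimes> t) \<otimes> (s \<otimes> t) = \<one>"
    using pow_ord_eq_1[of "s \<otimes> t"] assms by (simp add: numeral_2_eq_2)
  then have "inv (s \<otimes> t) = s \<otimes> t"
    using assms by (simp add: inv_equality)
  then show "s \<otimes> t = t \<otimes> s"
    using assms by (simp add: inv_mult_group)
next
  assume c: "s \<otimes> t = t \<otimes> s"
  have "(s \<otimes> t) \<otimes> (s \<otimes> t) = (s \<otimes> t) \<otimes> (t \<otimes> s)" using c by simp
  also have "\<dots> = \<one>" using assms by (simp add: m_assoc)
  finally have "(s \<otimes> t) [^] (2::nat) = \<one>"
    using assms by (simp add: numeral_2_eq_2)
  then have "ord (s \<otimes> t) dvd 2"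
    using assms pow_eq_id[of "s \<otimes> t" 2] by simp
  then show "ord (s \<otimes> t) \<noteq> 0" by (metis dvd_0_left zero_neq_numeral)
qed

text \<open>Whether the reflection \<open>x\<close> occurs an odd number of times among the reflections
  \<open>s\<^sub>1 \<dots> s\<^sub>i \<dots> s\<^sub>1\<close> of a word \<open>s\<^sub>1 \<dots> s\<^sub>n\<close>. The parity turns out to depend on the value of the word
  only, and this makes the presentation yield the exchange condition.\<close>

primrec inverts :: "'a list \<Rightarrow> 'a \<Rightarrow> bool" where
  "inverts [] x \<longleftrightarrow> False"
| "inverts (s # u) x \<longleftrightarrow> (x = s) \<noteq> inverts u (s \<otimes> x \<otimes> s)"

lemma conj_gen_eq_iff:
  "\<lbrakk>s \<in> I; x \<in> carrier W; y \<in> carrier W\<rbrakk> \<Longrightarrow> s \<otimes> x \<otimes> s = y \<longleftrightarrow> x = s \<otimes> y \<otimes> s"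
  by (auto simp: m_assoc)

lemma inverts_append:
  "\<lbrakk>u \<in> lists I; v \<in> lists I; x \<in> carrier W\<rbrakk> \<Longrightarrow>
    inverts (u @ v) x \<longleftrightarrow> inverts u x \<noteq> inverts v (inv (val u) \<otimes> x \<otimes> val u)"
  by (induction u arbitrary: x) (auto simp: inv_mult_group m_assoc)

text \<open>In a right-angled system the relators are \<open>ss\<close> and \<open>stst\<close> with \<open>st = ts\<close>; the reflections of the
  former are \<open>s, s\<close>, those of the latter \<open>s, t, s, t\<close>, so each occurs twice.\<close>

lemma relator_inverts_nothing:
  assumes "s \<in> I" "t \<in> I" "coxeter_matrix W s t = enat k" "x \<in> carrier W"
  shows "\<not> inverts (concat (replicate k [s, t])) x \<and> val (concat (replicate k [s, t])) = \<one>"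
proof (cases "s = t")
  case True
  then have "coxeter_matrix W s t = enat 1"
    using assms by (simp add: coxeter_matrix_def)
  then have "k = 1" using assms by simp
  with True show ?thesis
    using assms conj_gen_eq_iff[of t x t] by (auto simp: m_assoc)
next
  case False
  with right_angled assms have "coxeter_matrix W s t \<in> {2, \<infinity>}"
    unfolding right_angled_def by blast
  then have k: "k = 2" using assms by (simp add: numeral_eq_enat)
  have "ord (s \<otimes> t) \<noteq> 0"
    using assms(3) by (simp add: coxeter_matrix_def Let_def split: if_splits)
  then have c: "s \<otimes> t = t \<otimes> s" using commute_iff_finite_order assms False by blast
  have c': "s \<otimes> (t \<otimes> y) = t \<otimes> (s \<otimes> y)" if "y \<in> carrier W" for y
    using c assms that by (simp add: m_assoc[symmetric])
  have "s \<otimes> (t \<otimes> (s \<otimes> t)) = \<one>"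
    using c' assms by simp
  moreover have "\<not> inverts [s, t, s, t] x"
  proof -
    have conj: "t \<otimes> s \<otimes> t = s" "s \<otimes> t \<otimes> s = t" "s \<otimes> s \<otimes> s = s" "t \<otimes> t \<otimes> t = t"
      using assms c by (simp_all add: m_assoc)
    have "t \<otimes> (s \<otimes> x \<otimes> s) \<otimes> t = s \<longleftrightarrow> x = s"
      using assms conj conj_gen_eq_iff[of t "s \<otimes> x \<otimes> s" s] conj_gen_eq_iff[of s x s] by simp
    moreover have "s \<otimes> (t \<otimes> (s \<otimes> x \<otimes> s) \<otimes> t) \<otimes> s = t \<longleftrightarrow> s \<otimes> x \<otimes> s = t"
      using assms conj conj_gen_eq_iff[of s "t \<otimes> (s \<otimes> x \<otimes> s) \<otimes> t" t]
        conj_gen_eq_iff[of t "s \<otimes> x \<otimes> s" t] by simp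
    ultimately show ?thesis by auto
  qed
  ultimately show ?thesis using k assms by (simp add: numeral_2_eq_2)
qed

lemma concat_replicate_lists: "\<lbrakk>s \<in> I; t \<in> I\<rbrakk> \<Longrightarrow> concat (replicate k [s, t]) \<in> lists I"
  by (induction k) auto

lemma inverts_relation:
  assumes "coxeter_relation W I u v" "x \<in> carrier W"
  shows "inverts u x \<longleftrightarrow> inverts v x"
  using assms
proof (cases rule: coxeter_relation.cases)
  case (1 u' v' s t k)
  let ?c = "concat (replicate k [s, t])"
  have c: "?c \<in> lists I" using 1 concat_replicate_lists by blast
  show ?thesis
    using 1 c assms(2) relator_inverts_nothing[of s t k]
    by (simp add: inverts_append)
qed

lemma inverts_cong:
  assumes "u \<in> lists I" "v \<in> lists I" "val u = val v" "x \<in> carrier W"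
  shows "inverts u x \<longleftrightarrow> inverts v x"
proof -
  have "equivclp (coxeter_relation W I) u v" using assms presentation by blast
  then show ?thesis
    by (induction rule: equivclp_induct) (use inverts_relation assms(4) in blast)+
qed

text \<open>Some prefix \<open>s\<^sub>1 \<dots> s\<^sub>i\<close> has \<open>x\<close> as its reflection, and multiplying by \<open>x\<close> deletes the letter \<open>s\<^sub>i\<close>.\<close>

lemma strong_exchange:
  "\<lbrakk>u \<in> lists I; x \<in> carrier W; inverts u x\<rbrakk> \<Longrightarrow>
    \<exists>v \<in> lists I. length u = Suc (length v) \<and> x \<otimes> val u = val v"
proof (induction u arbitrary: x)
  case (Cons s u)
  have s: "s \<in> I" and u: "u \<in> lists I" using Cons.prems by auto
  show ?case
  proof (cases "x = s")
    case True
    then show ?thesis using s u by (intro bexI[of _ u]) auto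
  next
    case False
    then have "inverts u (s \<otimes> x \<otimes> s)" using Cons.prems by simp
    then obtain v where v: "v \<in> lists I" "length u = Suc (length v)" "s \<otimes> x \<otimes> s \<otimes> val u = val v"
      using Cons.IH[OF u, of "s \<otimes> x \<otimes> s"] s Cons.prems by auto
    have "x \<otimes> val (s # u) = s \<otimes> val v"
      using v(3)[symmetric] s u Cons.prems by (simp add: m_assoc)
    then show ?thesis using v s by (intro bexI[of _ "s # v"]) auto
  qed
qed simp

lemma word_exists: "w \<in> carrier W \<Longrightarrow> \<exists>u \<in> lists I. val u = w"
proof -
  assume "w \<in> carrier W"
  then have "w \<in> generate W I" using gens_generate by simp
  then show ?thesis
  proof (induction rule: generate.induct)
    case one
    show ?case by (intro bexI[of _ "[]"]) auto
  next
    case (incl h)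
    then show ?case by (intro bexI[of _ "[h]"]) auto
  next
    case (inv h)
    then show ?case by (intro bexI[of _ "[h]"]) auto
  next
    case (eng h1 h2)
    then obtain u v where "u \<in> lists I" "val u = h1" "v \<in> lists I" "val v = h2" by blast
    then show ?case by (intro bexI[of _ "u @ v"]) auto
  qed
qed

lemma len_le: "u \<in> lists I \<Longrightarrow> len (val u) \<le> length u"
  unfolding word_length_def by (rule Least_le) blast

definition reduced :: "'a list \<Rightarrow> bool" where
  "reduced u \<longleftrightarrow> u \<in> lists I \<and> length u = len (val u)"

lemma reducedD: "reduced u \<Longrightarrow> u \<in> lists I"
  by (simp add: reduced_def)

lemma reduced_exists:
  assumes "w \<in> carrier W"
  shows "\<exists>u. reduced u \<and> val u = w"
proof -
  have "\<exists>n. \<exists>us \<in> lists I. length us = n \<and> val us = w"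
    using word_exists[OF assms] by blast
  then have "\<exists>us \<in> lists I. length us = len w \<and> val us = w"
    unfolding word_length_def by (rule LeastI_ex)
  then show ?thesis by (auto simp: reduced_def)
qed

definition descent :: "'a \<Rightarrow> 'a \<Rightarrow> bool" where
  "descent r w \<longleftrightarrow> len (r \<otimes> w) < len w"

lemma len_mult_gen_le: "\<lbrakk>r \<in> I; w \<in> carrier W\<rbrakk> \<Longrightarrow> len (r \<otimes> w) \<le> Suc (len w)"
  using reduced_exists[of w] len_le[of "r # _"] unfolding reduced_def by fastforce

lemma len_inverted_less:
  assumes "u \<in> lists I" "x \<in> carrier W" "inverts u x"
  shows "len (x \<otimes> val u) < len (val u)"
proof -
  obtain u' where u': "reduced u'" "val u' = val u"
    using reduced_exists assms val_closed by metis
  then have "inverts u' x"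
    using assms inverts_cong reducedD by metis
  then obtain v where "v \<in> lists I" "length u' = Suc (length v)" "x \<otimes> val u' = val v"
    using strong_exchange reducedD u' assms by meson
  then show ?thesis using u' len_le[of v] by (simp add: reduced_def)
qed

text \<open>Prefixing the letter \<open>r\<close> to a word toggles whether \<open>r\<close> is inverted, and inverted elements shorten the
  value by the exchange condition.\<close>

lemma inverts_iff_descent:
  assumes "u \<in> lists I" "r \<in> I"
  shows "inverts u r \<longleftrightarrow> descent r (val u)"
proof
  show "inverts u r \<Longrightarrow> descent r (val u)"
    unfolding descent_def using len_inverted_less assms by simp
  assume d: "descent r (val u)"
  show "inverts u r"
  proof (rule ccontr)
    assume "\<not> inverts u r"
    then have "inverts (r # u) r" using assms by (simp add: m_assoc)
    then have "len (r \<otimes> val (r # u)) < len (val (r # u))"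
      by (intro len_inverted_less) (use assms in auto)
    then show False using d assms by (simp add: descent_def)
  qed
qed

lemma descent_mult_self:
  "\<lbrakk>r \<in> I; w \<in> carrier W\<rbrakk> \<Longrightarrow> descent r (r \<otimes> w) \<longleftrightarrow> \<not> descent r w"
proof -
  assume a: "r \<in> I" "w \<in> carrier W"
  obtain u where u: "u \<in> lists I" "val u = w" using a word_exists by blast
  have "inverts (r # u) r \<longleftrightarrow> \<not> inverts u r" using a by (simp add: m_assoc)
  then show ?thesis
    using inverts_iff_descent[of u r] inverts_iff_descent[of "r # u" r] u a by simp
qed

lemma len_mult_nondescent:
  assumes "r \<in> I" "w \<in> carrier W" "\<not> descent r w"
  shows "len (r \<otimes> w) = Suc (len w)"
proof -
  have "descent r (r \<otimes> w)" using descent_mult_self assms by blast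
  then have "len w < len (r \<otimes> w)" unfolding descent_def using assms by simp
  then show ?thesis using len_mult_gen_le[of r w] assms by simp
qed

lemma reduced_Cons:
  "reduced (s # u) \<longleftrightarrow> s \<in> I \<and> reduced u \<and> \<not> descent s (val u)"
proof (cases "s \<in> I \<and> u \<in> lists I")
  case True
  then have *: "len (val u) \<le> length u" "len (s \<otimes> val u) \<le> Suc (len (val u))"
    using len_le len_mult_gen_le by auto
  show ?thesis
  proof (cases "descent s (val u)")
    case True
    then show ?thesis using * by (auto simp: reduced_def descent_def)
  next
    case False
    then show ?thesis using * True len_mult_nondescent[of s "val u"]
      by (auto simp: reduced_def)
  qed
qed (auto simp: reduced_def)

lemma reduced_Nil [simp]: "reduced []"
  using len_le[of "[]"] by (simp add: reduced_def)

lemma descent_one [simp]: "r \<in> I \<Longrightarrow> \<not> descent r \<one>"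
  using inverts_iff_descent[of "[]" r] by simp

lemma reduced_sing [simp]: "s \<in> I \<Longrightarrow> reduced [s]"
  by (simp add: reduced_Cons)

lemma reduced_appendD: "reduced (u @ v) \<Longrightarrow> reduced v"
  by (induction u) (auto simp: reduced_Cons)

lemma reduced_length_one:
  assumes "reduced u" "val u = s" "s \<in> I"
  shows "u = [s]"
proof -
  have "length u = 1" using assms reduced_sing[of s] by (simp add: reduced_def)
  then obtain b where "u = [b]" by (auto simp: length_Suc_conv)
  then show ?thesis using assms by (auto simp: reduced_def)
qed

lemma reduced_val_one: "\<lbrakk>reduced u; val u = \<one>\<rbrakk> \<Longrightarrow> u = []"
  using len_le[of "[]"] by (simp add: reduced_def)

lemma alternating_word_exists:
  "u \<in> lists {a, r} \<Longrightarrow> {a, r} \<subseteq> I \<Longrightarrow> \<exists>v \<in> lists {a, r}. distinct_adj v \<and> val v = val u"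
proof (induction u)
  case (Cons s u)
  then obtain v where v: "v \<in> lists {a, r}" "distinct_adj v" "val v = val u" by auto
  have s: "s \<in> I" using Cons.prems by auto
  have vI: "v \<in> lists I" using v Cons.prems lists_mono[of "{a, r}" I] by blast
  show ?case
  proof (cases "v \<noteq> [] \<and> hd v = s")
    case True
    then obtain v' where v': "v = s # v'" by (metis list.collapse)
    have "val v' = s \<otimes> val v" using v' s vI by simp
    then show ?thesis
      using v v' by (intro bexI[of _ v']) (auto simp: distinct_adj_Cons)
  next
    case False
    then have "distinct_adj (s # v)" using v by (cases v) auto
    then show ?thesis using v Cons.prems by (intro bexI[of _ "s # v"]) auto
  qed
qed (auto intro: bexI[of _ "[]"])

text \<open>The reflections of the word \<open>a r a r \<dots>\<close> are \<open>a\<close>, \<open>a r a\<close>, \<open>a r a r a\<close>, and so on.\<close>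

lemma alternating_inverts:
  "\<lbrakk>distinct_adj u; u \<in> lists {a, r}; {a, r} \<subseteq> I; u \<noteq> []; hd u = a; inverts u x;
    x \<in> carrier W\<rbrakk> \<Longrightarrow> \<exists>k::nat. x = (a \<otimes> r) [^] k \<otimes> a"
proof (induction u arbitrary: a r x)
  case (Cons s u)
  have sa: "s = a" using Cons.prems by simp
  have I: "a \<in> I" "r \<in> I" using Cons.prems by auto
  show ?case
  proof (cases "x = a")
    case True
    then show ?thesis using I by (intro exI[of _ 0]) auto
  next
    case False
    then have *: "inverts u (a \<otimes> x \<otimes> a)" using Cons.prems sa by simp
    then have "u \<noteq> []" by auto
    moreover from this have "hd u = r"
      using Cons.prems sa by (cases u) auto
    ultimately obtain k where k: "a \<otimes> x \<otimes> a = (r \<otimes> a) [^] (k::nat) \<otimes> r"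
      using Cons.IH[of r a "a \<otimes> x \<otimes> a"] Cons.prems * I
      by (auto simp: distinct_adj_Cons insert_commute)
    have sw: "a \<otimes> (r \<otimes> a) [^] (k::nat) = (a \<otimes> r) [^] k \<otimes> a" for k
    proof (induction k)
      case (Suc k)
      have "a \<otimes> (r \<otimes> a) [^] Suc k = (a \<otimes> (r \<otimes> a) [^] k) \<otimes> (r \<otimes> a)"
        using I by (simp add: m_assoc)
      also have "\<dots> = (a \<otimes> r) [^] Suc k \<otimes> a" unfolding Suc using I by (simp add: m_assoc)
      finally show ?case .
    qed (use I in simp)
    have "x = a \<otimes> ((r \<otimes> a) [^] k \<otimes> r) \<otimes> a"
      using k I Cons.prems conj_gen_eq_iff[of a x "(r \<otimes> a) [^] k \<otimes> r"] by simp
    also have "\<dots> = (a \<otimes> (r \<otimes> a) [^] k) \<otimes> (r \<otimes> a)" using I by (simp add: m_assoc)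
    also have "\<dots> = (a \<otimes> r) [^] Suc k \<otimes> a"
      unfolding sw using I by (simp add: m_assoc)
    finally show ?thesis by blast
  qed
qed simp

text \<open>The fact about right-angled systems on which everything depends. Split \<open>w\<close> as a word \<open>p\<close>
  in \<open>a, r\<close> times an element of minimal length in its coset of \<open>\<langle>a, r\<rangle>\<close>. By minimality the second
  factor inverts no reflection of \<open>\<langle>a, r\<rangle>\<close>, so \<open>p\<close> must invert both \<open>a\<close> and \<open>r\<close>. As \<open>p\<close> may be
  taken alternating, this expresses one generator as \<open>(y z)\<^sup>k y\<close>, so \<open>a r\<close> has finite order.\<close>

lemma descents_commute:
  assumes w: "w \<in> carrier W" and I: "a \<in> I" "r \<in> I" "a \<noteq> r"
    and d: "descent a w" "descent r w"
  shows "a \<otimes> r = r \<otimes> a"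
proof -
  define P where "P n \<longleftrightarrow>
    (\<exists>p \<in> lists {a, r}. \<exists>u \<in> lists I. val (p @ u) = w \<and> len (val u) = n)" for n
  have sub: "lists {a, r} \<subseteq> lists I" using I by (intro lists_mono) auto
  obtain u0 where "u0 \<in> lists I" "val u0 = w" using w word_exists by blast
  then have "P (len (val u0))" unfolding P_def by (intro bexI[of _ "[]"] bexI[of _ u0]) auto
  then have "P (LEAST n. P n)" by (rule LeastI)
  then obtain p0 u where p0: "p0 \<in> lists {a, r}" and u: "u \<in> lists I" and
    pu0: "val (p0 @ u) = w" and mn: "len (val u) = (LEAST n. P n)"
    unfolding P_def by blast
  have min: "len (val u) \<le> n" if "P n" for n using that mn by (simp add: Least_le)
  obtain p where p: "p \<in> lists {a, r}" "distinct_adj p" "val p = val p0"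
    using alternating_word_exists[OF p0] I by auto
  have pI: "p \<in> lists I" "p0 \<in> lists I" using p p0 sub by auto
  have pu: "val (p @ u) = w" using pu0 p pI u by simp
  \<comment> \<open>an inverted reflection would give a shorter representative of the coset\<close>
  have none: "\<not> inverts u (val q)" if q: "q \<in> lists {a, r}" for q
  proof
    have qI: "q \<in> lists I" using q sub by blast
    assume "inverts u (val q)"
    then have less: "len (val q \<otimes> val u) < len (val u)"
      by (intro len_inverted_less) (use qI u in auto)
    have "val ((p @ rev q) @ (q @ u)) = w"
      using pu pI qI u by (simp add: m_assoc)
    then have "P (len (val q \<otimes> val u))"
      unfolding P_def using p q qI u
      by (intro bexI[of _ "p @ rev q"] bexI[of _ "q @ u"]) auto
    then show False using min less by fastforce
  qed
  have inv_p: "inverts p x" if x: "x \<in> {a, r}" for x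
  proof -
    have xI: "x \<in> I" using x I by auto
    have "inverts (p @ u) x"
      using d x inverts_iff_descent[of "p @ u" x] pI u xI pu by auto
    moreover have "inv (val p) \<otimes> x \<otimes> val p = val (rev p @ [x] @ p)"
      using pI xI by (simp add: m_assoc)
    moreover have "\<not> inverts u (val (rev p @ [x] @ p))"
      using p x by (intro none) simp
    ultimately show ?thesis
      using pI u xI by (simp add: inverts_append)
  qed
  have fin: "y \<otimes> z = z \<otimes> y" if yz: "{y, z} = {a, r}" and h: "hd p = y" for y z
  proof -
    have z: "z \<in> {a, r}" using yz by blast
    have "p \<noteq> []" using inv_p[of a] by auto
    moreover have "p \<in> lists {y, z}" "{y, z} \<subseteq> I" using p I yz by auto
    moreover have "inverts p z" "z \<in> carrier W" using z inv_p I by auto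
    ultimately obtain k where k: "z = (y \<otimes> z) [^] (k::nat) \<otimes> y"
      using alternating_inverts[of p y z z] p(2) h by blast
    have yzI: "y \<in> I" "z \<in> I" "y \<noteq> z" using yz I by (auto simp: doubleton_eq_iff)
    have "z \<otimes> y = ((y \<otimes> z) [^] k \<otimes> y) \<otimes> y" using k by simp
    then have "z \<otimes> y = (y \<otimes> z) [^] k" using yzI by (simp add: m_assoc)
    then have "(y \<otimes> z) [^] Suc k = (z \<otimes> y) \<otimes> (y \<otimes> z)" by simp
    also have "\<dots> = \<one>" using yzI by (simp add: m_assoc)
    finally have "ord (y \<otimes> z) dvd Suc k" using pow_eq_id[of "y \<otimes> z" "Suc k"] yzI by simp
    then have "ord (y \<otimes> z) \<noteq> 0" by (metis dvd_0_left nat.distinct(1))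
    then show ?thesis using commute_iff_finite_order yzI by blast
  qed
  have "p \<noteq> []" using inv_p[of a] by auto
  then have "hd p \<in> {a, r}" using p by (cases p) auto
  then show ?thesis using fin[of a r] fin[of r a] by (auto simp: insert_commute)
qed

lemma descent_mult_commuting:
  assumes "w \<in> carrier W" "a \<in> I" "r \<in> I" "a \<noteq> r" "a \<otimes> r = r \<otimes> a"
  shows "descent r (a \<otimes> w) \<longleftrightarrow> descent r w"
proof -
  obtain u where u: "u \<in> lists I" "val u = w" using assms word_exists by blast
  have "a \<otimes> r \<otimes> a = r" using assms by (simp add: m_assoc)
  then have "inverts (a # u) r \<longleftrightarrow> inverts u r" using assms by simp
  then show ?thesis
    using inverts_iff_descent[of u r] inverts_iff_descent[of "a # u" r] u assms by simp
qed

text \<open>The reflection contributed by the last letter of \<open>w t\<close> is \<open>w t w\<^sup>-\<^sup>1\<close>; if appending \<open>t\<close> changes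
  whether \<open>r\<close> is inverted, this reflection must be \<open>r\<close>.\<close>

lemma folding:
  assumes "w \<in> carrier W" "r \<in> I" "t \<in> I" "descent r (w \<otimes> t) \<noteq> descent r w"
  shows "r \<otimes> w = w \<otimes> t"
proof -
  obtain u where u: "u \<in> lists I" "val u = w" using assms word_exists by blast
  have "inverts (u @ [t]) r \<noteq> inverts u r"
    using inverts_iff_descent[of u r] inverts_iff_descent[of "u @ [t]" r] u assms by simp
  then have "inv w \<otimes> r \<otimes> w = t"
    using u assms by (cases "inverts u r") (simp_all add: inverts_append)
  then have "w \<otimes> (inv w \<otimes> (r \<otimes> w)) = w \<otimes> t" using assms by (simp add: m_assoc)
  then show ?thesis using assms by (simp add: m_assoc[symmetric])
qed

definition perp :: "'a \<Rightarrow> 'a set" where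
  "perp s = {t \<in> I. t \<noteq> s \<and> s \<otimes> t = t \<otimes> s}"

text \<open>The first letter \<open>b\<close> of \<open>u\<close> and \<open>r\<close> are both descents of \<open>r w = w t\<close>, where \<open>w\<close> is the value of
  \<open>u\<close>. Hence they commute, \<open>b\<close> can be cancelled, and the argument repeats.\<close>

lemma centralized_by_perp:
  "\<lbrakk>reduced u; r \<in> I; t \<in> I; r \<otimes> val u = val u \<otimes> t; \<not> descent r (val u)\<rbrakk>
    \<Longrightarrow> t = r \<and> u \<in> lists (perp r)"
proof (induction u)
  case (Cons b u)
  let ?w = "val (b # u)"
  have b: "b \<in> I" "reduced u" "\<not> descent b (val u)" and u: "u \<in> lists I"
    using Cons.prems by (auto simp: reduced_Cons reducedD)
  have db: "descent b ?w" using b u descent_mult_self by simp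
  then have neq: "b \<noteq> r" using Cons.prems by auto
  have w: "?w \<in> carrier W" using b u by simp
  have 1: "descent r (r \<otimes> ?w)" using descent_mult_self Cons.prems w by blast
  have lw: "len (r \<otimes> ?w) = Suc (len ?w)"
    using len_mult_nondescent Cons.prems w by blast
  have lu: "Suc (length u) = len ?w" using Cons.prems(1) by (simp add: reduced_def)
  have "b \<otimes> (r \<otimes> ?w) = val (u @ [t])"
    using Cons.prems b u by (simp add: m_assoc)
  then have "len (b \<otimes> (r \<otimes> ?w)) \<le> Suc (length u)"
    using len_le[of "u @ [t]"] u Cons.prems by simp
  then have "descent b (r \<otimes> ?w)" unfolding descent_def using lw lu by simp
  then have c: "b \<otimes> r = r \<otimes> b"
    using descents_commute[of "r \<otimes> ?w" b r] 1 neq b Cons.prems w by simp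
  have "b \<otimes> (r \<otimes> val u) = (r \<otimes> b) \<otimes> val u"
    using c b u Cons.prems(2) by (simp add: m_assoc[symmetric])
  also have "\<dots> = b \<otimes> (val u \<otimes> t)"
    using Cons.prems b u by (simp add: m_assoc)
  finally have "r \<otimes> val u = val u \<otimes> t"
    using b u Cons.prems by simp
  moreover have "\<not> descent r (val u)"
    using descent_mult_commuting[of "val u" b r] Cons.prems b u neq c by simp
  ultimately have "t = r \<and> u \<in> lists (perp r)" using Cons.IH b Cons.prems by blast
  then show ?case using b neq c by (simp add: perp_def)
qed simp

lemma len_inv: "w \<in> carrier W \<Longrightarrow> len (inv w) = len w"
proof -
  have "len (inv w) \<le> len w" if w: "w \<in> carrier W" for w
    using reduced_exists[OF w] len_le[of "rev _"] unfolding reduced_def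
    by (metis length_rev rev_lists val_rev)
  from this[of w] this[of "inv w"] show "w \<in> carrier W \<Longrightarrow> len (inv w) = len w"
    by (simp add: le_antisym)
qed

lemma reduced_rev: "reduced u \<Longrightarrow> reduced (rev u)"
  using len_inv by (simp add: reduced_def)

lemma reduced_append_left: "reduced (u @ v) \<Longrightarrow> reduced u"
  using reduced_rev[of "u @ v"] reduced_appendD[of "rev v" "rev u"] reduced_rev[of "rev u"] by simp

lemma descent_prefix:
  assumes "reduced (u @ v)" "r \<in> I" "descent r (val u)"
  shows "descent r (val (u @ v))"
  using assms
proof (induction v rule: rev_induct)
  case (snoc t v)
  have uv: "reduced (u @ v)" using reduced_append_left[of "u @ v" "[t]"] snoc by simp
  then have d: "descent r (val (u @ v))" using snoc by simp
  have I: "u @ v \<in> lists I" "t \<in> I" using snoc.prems(1) by (auto dest!: reducedD)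
  show ?case
  proof (rule ccontr)
    assume "\<not> descent r (val (u @ v @ [t]))"
    then have "\<not> descent r (val (u @ v) \<otimes> t)" using I by (simp add: m_assoc)
    then have "r \<otimes> val (u @ v) = val (u @ v) \<otimes> t"
      using folding[of "val (u @ v)" r t] d I snoc.prems(2) val_closed by blast
    then have "len (val (u @ v @ [t])) < len (val (u @ v))"
      using d I by (simp add: descent_def m_assoc)
    also have "\<dots> \<le> length (u @ v)" using I len_le by blast
    finally show False using snoc.prems(1) by (simp add: reduced_def)
  qed
qed simp

lemma reduced_pair: "\<lbrakk>s \<in> I; t \<in> I; s \<noteq> t\<rbrakk> \<Longrightarrow> reduced [s, t]"
proof -
  assume I: "s \<in> I" "t \<in> I" "s \<noteq> t"
  have "\<not> descent s t"
  proof
    assume d: "descent s t"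
    have "descent t t" using I descent_mult_self[of t \<one>] by simp
    then have "t \<otimes> s = s \<otimes> t" using descents_commute[of t t s] d I by simp
    then show False
      using d descent_mult_commuting[of \<one> t s] I by simp
  qed
  then show ?thesis using I by (simp add: reduced_Cons)
qed

text \<open>Used to see that a panel of a type not commuting with \<open>s\<close> is moved whenever a
  chamber is moved along its \<open>s\<close>-panel.\<close>

lemma reduced_triple:
  assumes "s \<in> I" "t \<in> I" "s \<otimes> t \<noteq> t \<otimes> s"
  shows "reduced [t, s, t]"
proof -
  have "s \<noteq> t" using assms by auto
  then have st: "reduced [s, t]" using reduced_pair assms by blast
  have "descent s (val [s, t])"
    using descent_prefix[of "[s]" "[t]" s] st assms descent_mult_self[of s \<one>] by simp
  then have "\<not> descent t (val [s, t])"
    using descents_commute[OF val_closed[OF reducedD[OF st]] assms(1,2) \<open>s \<noteq> t\<close>] assms(3) by blast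
  then show ?thesis using st assms reduced_Cons by blast
qed

end

section \<open>Shortening paths by commutations\<close>

inductive path :: "('i \<Rightarrow> 'p \<Rightarrow> 'p \<Rightarrow> bool) \<Rightarrow> 'i list \<Rightarrow> 'p \<Rightarrow> 'p \<Rightarrow> bool"
  for E where
  path_Nil: "path E [] x x"
| path_Cons: "\<lbrakk>E s x y; path E u y z\<rbrakk> \<Longrightarrow> path E (s # u) x z"

inductive_simps path_Nil_iff [simp]: "path E [] x y"
inductive_simps path_Cons_iff: "path E (s # u) x y"

lemma path_append_iff: "path E (u @ v) x z \<longleftrightarrow> (\<exists>y. path E u x y \<and> path E v y z)"
  by (induction u arbitrary: x) (auto simp: path_Cons_iff)

lemma path_rev:
  "\<lbrakk>path E u x y; \<And>s x y. \<lbrakk>s \<in> set u; E s x y\<rbrakk> \<Longrightarrow> E s y x\<rbrakk> \<Longrightarrow> path E (rev u) y x"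
  by (induction rule: path.induct) (auto simp: path_append_iff path_Cons_iff)

context right_angled_coxeter_system
begin

text \<open>Here \<open>E s\<close> is thought of as a step of type \<open>s\<close> between states. The states are chambers
  in one application and pairs of chambers, moved together, in the other.\<close>

definition swappable :: "('a \<Rightarrow> 'p \<Rightarrow> 'p \<Rightarrow> bool) \<Rightarrow> bool" where
  "swappable E \<longleftrightarrow>
     (\<forall>s\<in>I. \<forall>t\<in>I. \<forall>x y z. s \<noteq> t \<and> s \<otimes> t = t \<otimes> s \<and> E s x y \<and> E t y z
        \<longrightarrow> (\<exists>y'. E t x y' \<and> E s y' z))"

lemma move_descent_to_front:
  assumes E: "swappable E"
  shows "\<lbrakk>reduced u; a \<in> I; descent a (val u); path E u x y\<rbrakk> \<Longrightarrow>
    \<exists>v. path E (a # v) x y \<and> val (a # v) = val u \<and> length u = Suc (length v) \<and>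
      set v \<subseteq> set u \<and> a \<in> set u"
proof (induction u arbitrary: x)
  case (Cons b u)
  have b: "b \<in> I" "reduced u" "u \<in> lists I" "\<not> descent b (val u)"
    using Cons.prems reducedD by (auto simp: reduced_Cons)
  show ?case
  proof (cases "b = a")
    case True
    then show ?thesis using Cons.prems by (intro exI[of _ u]) auto
  next
    case False
    have db: "descent b (val (b # u))" using b descent_mult_self by simp
    then have c: "b \<otimes> a = a \<otimes> b"
      using descents_commute[of "val (b # u)" b a] Cons.prems b False by simp
    then have da: "descent a (val u)"
      using descent_mult_commuting[of "val u" b a] Cons.prems b False by simp
    obtain x1 where x1: "E b x x1" "path E u x1 y"
      using Cons.prems by (auto simp: path_Cons_iff)
    obtain v where v: "path E (a # v) x1 y" "val (a # v) = val u" "length u = Suc (length v)" "set v \<subseteq> set u" "a \<in> set u"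
      using Cons.IH[OF b(2) Cons.prems(2) da x1(2)] by blast
    then obtain x2 where x2: "E a x1 x2" "path E v x2 y"
      by (auto simp: path_Cons_iff)
    then obtain x1' where "E a x x1'" "E b x1' x2"
      using E x1 c b Cons.prems False unfolding swappable_def by blast
    then have "path E (a # b # v) x y" using x2 by (auto simp: path_Cons_iff)
    moreover have "val (a # b # v) = val (b # u)"
    proof -
      have "v \<in> lists I" using v(4) b(3) by (auto simp: in_lists_conv_set)
      then have "val (a # b # v) = b \<otimes> val (a # v)"
        using c b(1) Cons.prems(2) by (simp add: m_assoc[symmetric])
      then show ?thesis using v(2) by simp
    qed
    ultimately show ?thesis using v by (intro exI[of _ "b # v"]) auto
  qed
qed simp

text \<open>The solution of the word problem of a right-angled Coxeter group, lifted from words to paths: in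
  a word that is not reduced some letter can be moved by commutations next to an equal one, and the two
  steps merge by transitivity.\<close>

lemma shorten_path:
  assumes E: "swappable E" "\<And>s. s \<in> I \<Longrightarrow> transp (E s)" and J: "J \<subseteq> I"
  shows "\<lbrakk>path E u x y; u \<in> lists J; \<not> reduced u\<rbrakk> \<Longrightarrow>
    \<exists>v \<in> lists J. length v < length u \<and> path E v x y"
proof (induction u arbitrary: x)
  case (Cons s u)
  obtain x1 where x1: "E s x x1" "path E u x1 y"
    using Cons.prems by (auto simp: path_Cons_iff)
  have s: "s \<in> J" "u \<in> lists J" using Cons.prems by auto
  show ?case
  proof (cases "reduced u")
    case False
    then obtain v where "v \<in> lists J" "length v < length u" "path E v x1 y"
      using Cons.IH[OF x1(2)] s by blast
    then show ?thesis using x1 s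
      by (intro bexI[of _ "s # v"]) (auto simp: path_Cons_iff)
  next
    case True
    then have "descent s (val u)"
      using Cons.prems s J by (auto simp: reduced_Cons)
    then obtain v where v: "path E (s # v) x1 y" "length u = Suc (length v)" "set v \<subseteq> set u"
      using move_descent_to_front[OF E(1) True _ _ x1(2)] s J by blast
    then obtain x2 where x2: "E s x1 x2" "path E v x2 y"
      by (auto simp: path_Cons_iff)
    moreover have "E s x x2"
      using E(2)[of s] x1 x2 s J unfolding transp_def by blast
    ultimately have "path E (s # v) x y" by (auto simp: path_Cons_iff)
    moreover have "s # v \<in> lists J" using s v(3) by (auto simp: in_lists_conv_set)
    ultimately show ?thesis using v by (intro bexI[of _ "s # v"]) auto
  qed
qed simp

lemma drop_stutters:
  "path E u x y \<Longrightarrow> path (\<lambda>s x y. E s x y \<and> x \<noteq> y) u x y \<or>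
    (\<exists>v. set v \<subseteq> set u \<and> length v < length u \<and> path E v x y)"
proof (induction rule: path.induct)
  case (path_Cons s x y u z)
  show ?case
  proof (cases "x = y")
    case True
    then show ?thesis using path_Cons by (intro disjI2 exI[of _ u]) auto
  next
    case False
    from path_Cons.IH show ?thesis
    proof
      assume "path (\<lambda>s x y. E s x y \<and> x \<noteq> y) u y z"
      then show ?thesis using False path_Cons by (auto simp: path_Cons_iff)
    next
      assume "\<exists>v. set v \<subseteq> set u \<and> length v < length u \<and> path E v y z"
      then obtain v where "set v \<subseteq> set u" "length v < length u" "path E v y z" by blast
      then show ?thesis using path_Cons
        by (intro disjI2 exI[of _ "s # v"]) (auto simp: path_Cons_iff)
    qed
  qed
qed (auto simp: path_Nil)

lemma shortest_path:
  assumes E: "swappable E" "\<And>s. s \<in> I \<Longrightarrow> transp (E s)" and J: "J \<subseteq> I" and p: "path E u x y" "u \<in> lists J"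
  obtains v where "v \<in> lists J" "reduced v" "path (\<lambda>s x y. E s x y \<and> x \<noteq> y) v x y"
proof -
  define P where "P n \<longleftrightarrow> (\<exists>v \<in> lists J. length v = n \<and> path E v x y)" for n
  have "P (length u)" using p by (auto simp: P_def)
  then have "P (LEAST n. P n)" by (rule LeastI)
  then obtain v where v: "v \<in> lists J" "length v = (LEAST n. P n)" "path E v x y"
    by (auto simp: P_def)
  have min: False if "v' \<in> lists J" "length v' < length v" "path E v' x y" for v'
  proof -
    have "P (length v')" using that unfolding P_def by blast
    then show False using not_less_Least that(2) v(2) by metis
  qed
  have "reduced v" using shorten_path[OF E J v(3,1)] min by blast
  moreover have "path (\<lambda>s x y. E s x y \<and> x \<noteq> y) v x y"
    using drop_stutters[OF v(3)] min v(1) by (auto simp: in_lists_conv_set)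
  ultimately show ?thesis using that v by blast
qed

end

section \<open>Galleries and residues\<close>

locale right_angled_building =
  building W I Ch \<delta> + right_angled_coxeter_system W I
  for W (structure) and I Ch \<delta>
begin

text \<open>Includes equality, so that \<open>s\<close>-adjacency is an equivalence relation with the \<open>s\<close>-panels as classes.\<close>

definition adj :: "'a \<Rightarrow> 'c \<Rightarrow> 'c \<Rightarrow> bool" where
  "adj s x y \<longleftrightarrow> x \<in> Ch \<and> y \<in> Ch \<and> (x = y \<or> \<delta> x y = s)"

abbreviation pan :: "'a \<Rightarrow> 'c \<Rightarrow> 'c set" where "pan s x \<equiv> {y. adj s x y}"

lemma adjD [dest]: "adj s x y \<Longrightarrow> x \<in> Ch" "adj s x y \<Longrightarrow> y \<in> Ch"
  by (auto simp: adj_def)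

lemma adj_refl [simp]: "adj s x x \<longleftrightarrow> x \<in> Ch"
  by (auto simp: adj_def)

lemma dist_self [simp]: "x \<in> Ch \<Longrightarrow> \<delta> x x = \<one>"
  using WD1 by blast

lemma dist_gen_sym:
  assumes "x \<in> Ch" "y \<in> Ch" "s \<in> I" "\<delta> x y = s"
  shows "\<delta> y x = s"
proof -
  have "\<delta> x x \<in> {s \<otimes> \<delta> y x, \<delta> y x}" using WD2[of y x x s] assms by blast
  moreover have "\<delta> y x \<noteq> \<one>" using WD1[of y x] WD1[of x y] assms by auto
  ultimately have "s \<otimes> \<delta> y x = \<one>" using assms by auto
  then have "s \<otimes> (s \<otimes> \<delta> y x) = s" using assms by simp
  then show ?thesis using assms dist_closed by simp
qed

lemma adj_sym: "s \<in> I \<Longrightarrow> adj s x y \<Longrightarrow> adj s y x"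
  unfolding adj_def using dist_gen_sym by metis

lemma adj_trans: "\<lbrakk>s \<in> I; adj s x y; adj s y z\<rbrakk> \<Longrightarrow> adj s x z"
proof -
  assume a: "s \<in> I" "adj s x y" "adj s y z"
  show "adj s x z"
  proof (cases "x = y \<or> y = z")
    case False
    then have d: "\<delta> x y = s" "\<delta> y z = s" and C: "x \<in> Ch" "y \<in> Ch" "z \<in> Ch"
      using a(2,3) unfolding adj_def by blast+
    have "\<delta> x z \<in> {s \<otimes> \<delta> y z, \<delta> y z}" using WD2[of y z x s] a(1) C d(1) by blast
    then have "\<delta> x z = \<one> \<or> \<delta> x z = s" using d(2) a(1) by simp
    then show ?thesis using C WD1[of x z] unfolding adj_def by blast
  qed (use a in auto)
qed

lemma pan_eq: "s \<in> I \<Longrightarrow> adj s x y \<Longrightarrow> pan s x = pan s y"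
  using adj_trans adj_sym by blast

abbreviation gallery :: "'a list \<Rightarrow> 'c \<Rightarrow> 'c \<Rightarrow> bool" where
  "gallery \<equiv> path (\<lambda>s x y. adj s x y \<and> x \<noteq> y)"

lemma gallery_dist:
  "\<lbrakk>gallery u x y; reduced u; x \<in> Ch\<rbrakk> \<Longrightarrow> y \<in> Ch \<and> \<delta> x y = val u"
proof (induction rule: path.induct)
  case (path_Cons s x y u z)
  then have z: "y \<in> Ch" "z \<in> Ch" "\<delta> y z = val u" and s: "s \<in> I" "\<not> descent s (val u)"
    by (auto simp: reduced_Cons)
  have "u \<in> lists I" using path_Cons reducedD by (auto simp: reduced_Cons)
  then have "word_length W I (s \<otimes> \<delta> y z) = word_length W I (\<delta> y z) + 1"
    using len_mult_nondescent s z by simp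
  then have "\<delta> x z = s \<otimes> \<delta> y z"
    using WD2_length[of y z x s] path_Cons z s by (auto simp: adj_def)
  then show ?case using z by simp
qed simp

lemma gallery_exists:
  "\<lbrakk>u \<in> lists I; x \<in> Ch; y \<in> Ch; \<delta> x y = val u\<rbrakk> \<Longrightarrow> gallery u x y"
proof (induction u arbitrary: x)
  case Nil
  then show ?case using WD1 by (simp add: path_Nil)
next
  case (Cons s u)
  then have s: "s \<in> I" "u \<in> lists I" by auto
  obtain x' where x': "x' \<in> Ch" "\<delta> x' x = s" "\<delta> x' y = s \<otimes> \<delta> x y"
    using WD3[of x y s] Cons s by blast
  then have "gallery u x' y" using Cons s by (intro Cons.IH) auto
  moreover have "\<delta> x x' = s" using dist_gen_sym[of x' x s] x' Cons.prems s by blast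
  moreover have "x \<noteq> x'" using x' s gen_neq_one dist_self by metis
  moreover have "adj s x x'" using calculation x'(1) Cons.prems(2) unfolding adj_def by blast
  ultimately show ?case by (auto simp: path_Cons_iff)
qed

lemma gallery_reduced_exists:
  assumes "x \<in> Ch" "y \<in> Ch"
  obtains u where "reduced u" "gallery u x y" "val u = \<delta> x y"
proof -
  obtain u where u: "reduced u" "val u = \<delta> x y"
    using reduced_exists[OF dist_closed[OF assms]] by blast
  then have "gallery u x y" using assms by (intro gallery_exists reducedD) simp_all
  then show ?thesis using that u by blast
qed

lemma gallery_rev:
  assumes "gallery u x y" "u \<in> lists I"
  shows "gallery (rev u) y x"
proof (rule path_rev[OF assms(1)])
  fix s x y
  assume "s \<in> set u" "adj s x y \<and> x \<noteq> y"
  then show "adj s y x \<and> y \<noteq> x"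
    using assms(2) adj_sym[of s x y] by (auto simp: in_lists_conv_set)
qed

lemma dist_inv:
  assumes "x \<in> Ch" "y \<in> Ch"
  shows "\<delta> y x = inv (\<delta> x y)"
proof -
  obtain u where u: "reduced u" "gallery u x y" "val u = \<delta> x y"
    using gallery_reduced_exists assms by blast
  then have "\<delta> y x = val (rev u)"
    using gallery_dist[of "rev u" y x] gallery_rev reduced_rev assms reducedD by blast
  then show ?thesis using u reducedD by simp
qed

lemma strict_adj_swap:
  assumes I: "s \<in> I" "t \<in> I" "s \<noteq> t" "s \<otimes> t = t \<otimes> s"
    and a: "adj s x y" "adj t y z" "x \<noteq> y" "y \<noteq> z"
  shows "\<exists>y'. (adj t x y' \<and> x \<noteq> y') \<and> adj s y' z \<and> y' \<noteq> z"
proof -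
  have Ch: "x \<in> Ch" "y \<in> Ch" "z \<in> Ch" using a by auto
  have "reduced [s, t]" using reduced_pair I by blast
  then have "\<delta> x z = val [s, t]"
    using gallery_dist[of "[s, t]" x z] a Ch by (auto simp: path_Cons_iff)
  then have "gallery [t, s] x z" using I Ch by (intro gallery_exists) auto
  then show ?thesis by (auto simp: path_Cons_iff)
qed

lemma swappable_strict_adj: "swappable (\<lambda>s x y. adj s x y \<and> x \<noteq> y)"
  unfolding swappable_def using strict_adj_swap by blast

lemma adj_swap:
  assumes I: "s \<in> I" "t \<in> I" "s \<noteq> t" "s \<otimes> t = t \<otimes> s" and a: "adj s x y" "adj t y z"
  shows "\<exists>y'. adj t x y' \<and> adj s y' z"
proof (cases "x = y \<or> y = z")
  case True
  then show ?thesis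
  proof
    assume "x = y"
    then show ?thesis using a by (intro exI[of _ z]) auto
  next
    assume "y = z"
    then show ?thesis using a by (intro exI[of _ x]) auto
  qed
next
  case False
  then show ?thesis using strict_adj_swap[OF I a] by blast
qed

lemma swappable_adj: "swappable adj"
  unfolding swappable_def using adj_swap by blast

lemma transp_adj: "s \<in> I \<Longrightarrow> transp (adj s)"
  unfolding transp_def using adj_trans by blast

inductive reach :: "'a set \<Rightarrow> 'c \<Rightarrow> 'c \<Rightarrow> bool" for J x where
  reach_refl: "x \<in> Ch \<Longrightarrow> reach J x x"
| reach_step: "\<lbrakk>reach J x y; s \<in> J; adj s y z\<rbrakk> \<Longrightarrow> reach J x z"

lemma reachD: "reach J x y \<Longrightarrow> x \<in> Ch \<and> y \<in> Ch"
  by (induction rule: reach.induct) auto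

lemma reach_adj: "\<lbrakk>s \<in> J; adj s x y\<rbrakk> \<Longrightarrow> reach J x y"
  using reach_step[OF reach_refl] by blast

lemma reach_trans: "\<lbrakk>reach J x y; reach J y z\<rbrakk> \<Longrightarrow> reach J x z"
  by (rotate_tac, induction rule: reach.induct) (auto intro: reach_step)

lemma reach_sym: "\<lbrakk>reach J x y; J \<subseteq> I\<rbrakk> \<Longrightarrow> reach J y x"
proof (induction rule: reach.induct)
  case (reach_step y s z)
  then have "reach J z y" using adj_sym reach_adj by blast
  then show ?case using reach_trans reach_step by blast
qed (rule reach_refl)

lemma reach_mono: "\<lbrakk>reach J x y; J \<subseteq> K\<rbrakk> \<Longrightarrow> reach K x y"
  by (induction rule: reach.induct) (auto intro: reach_refl reach_step)

lemma reach_path: "reach J x y \<Longrightarrow> \<exists>u \<in> lists J. path adj u x y"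
proof (induction rule: reach.induct)
  case reach_refl
  show ?case by (intro bexI[of _ "[]"]) (auto simp: path_Nil)
next
  case (reach_step y s z)
  then obtain u where "u \<in> lists J" "path adj u x y" by blast
  then show ?case using reach_step
    by (intro bexI[of _ "u @ [s]"]) (auto simp: path_append_iff path_Cons_iff)
qed

lemma gallery_reach: "\<lbrakk>gallery u x y; u \<in> lists J; x \<in> Ch\<rbrakk> \<Longrightarrow> reach J x y"
proof (induction rule: path.induct)
  case (path_Cons s x y u z)
  then have "reach J x y" "reach J y z" using reach_adj by auto
  then show ?case by (rule reach_trans)
qed (rule reach_refl)

lemma reach_gallery:
  assumes "reach J x y" "J \<subseteq> I"
  obtains u where "u \<in> lists J" "reduced u" "gallery u x y" "\<delta> x y = val u"
proof -
  obtain u0 where "u0 \<in> lists J" "path adj u0 x y" using reach_path assms by blast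
  then obtain u where "u \<in> lists J" "reduced u" "gallery u x y"
    using shortest_path[OF swappable_adj transp_adj assms(2)] by blast
  then show ?thesis using that gallery_dist reachD[OF assms(1)] by blast
qed

lemma reach_by_dist:
  "\<lbrakk>x \<in> Ch; y \<in> Ch; u \<in> lists J; J \<subseteq> I; \<delta> x y = val u\<rbrakk> \<Longrightarrow> reach J x y"
  using gallery_exists[of u x y] gallery_reach lists_mono by blast

lemma reach_all: "\<lbrakk>x \<in> Ch; y \<in> Ch\<rbrakk> \<Longrightarrow> reach I x y"
  using gallery_reduced_exists[of x y] gallery_reach[of _ x y I] reducedD by blast

text \<open>The distance of \<open>x\<close> and \<open>y\<close> has a reduced word with letters in \<open>J\<close>, whereas the only reduced word
  for \<open>s\<close> is \<open>s\<close> itself.\<close>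

lemma adj_reach_eq:
  assumes "adj s x y" "reach J x y" "J \<subseteq> I" "s \<in> I" "s \<notin> J"
  shows "x = y"
proof (rule ccontr)
  assume "x \<noteq> y"
  then have "\<delta> x y = s" using assms(1) unfolding adj_def by blast
  moreover obtain u where "u \<in> lists J" "reduced u" "\<delta> x y = val u"
    using reach_gallery[OF assms(2,3)] by blast
  ultimately show False using reduced_length_one[of u s] assms by auto
qed

end

section \<open>Wings and isometries\<close>

context right_angled_building
begin

lemma perp_sub: "perp s \<subseteq> I"
  by (auto simp: perp_def)

lemma dist_adj_right:
  assumes "c \<in> Ch" "adj t x y" "t \<in> I"
  shows "\<delta> c y = \<delta> c x \<or> \<delta> c y = \<delta> c x \<otimes> t"
proof (cases "x = y")
  case False
  then have C: "x \<in> Ch" "y \<in> Ch" and "\<delta> y x = t"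
    using assms dist_gen_sym unfolding adj_def by blast+
  then have "\<delta> y c \<in> {t \<otimes> \<delta> x c, \<delta> x c}" using WD2[of x c y t] assms by blast
  moreover have "inv (t \<otimes> \<delta> x c) = \<delta> c x \<otimes> t"
    using dist_inv[of x c] C assms dist_closed by (simp add: inv_mult_group)
  ultimately show ?thesis using dist_inv[of y c] dist_inv[of x c] C assms by auto
qed simp

text \<open>The chambers whose projection to the \<open>r\<close>-panel of \<open>c\<close> is \<open>c\<close> itself: in a thin
  building, a half-space.\<close>

definition wing :: "'a \<Rightarrow> 'c \<Rightarrow> 'c set" where
  "wing r c = {x \<in> Ch. \<not> descent r (\<delta> c x)}"

lemma wing_sub: "wing r c \<subseteq> Ch"
  by (auto simp: wing_def)

lemma center_in_wing: "\<lbrakk>r \<in> I; c \<in> Ch\<rbrakk> \<Longrightarrow> c \<in> wing r c"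
  by (simp add: wing_def)

text \<open>Crossing out of a wing is a folding \<open>r w = w t\<close> with \<open>w\<close> the distance of the crossing from \<open>c\<close>,
  and then \<open>w\<close> is a product of generators commuting with \<open>r\<close>. So only the residue of \<open>c\<close> of type
  \<open>r\<close> with its commuting generators links a wing to its complement.\<close>

lemma wing_boundary:
  assumes "r \<in> I" "t \<in> I" "c \<in> Ch" "adj t x y" "x \<in> wing r c" "y \<in> Ch - wing r c"
  shows "t = r \<and> reach (perp r) c x"
proof -
  let ?w = "\<delta> c x"
  have C: "x \<in> Ch" "y \<in> Ch" using assms by auto
  have w: "?w \<in> carrier W" using C assms dist_closed by blast
  have nd: "\<not> descent r ?w" "descent r (\<delta> c y)"
    using assms by (auto simp: wing_def)
  then have "\<delta> c y = ?w \<otimes> t" using dist_adj_right[OF assms(3,4,2)] by auto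
  then have rw: "r \<otimes> ?w = ?w \<otimes> t" using folding[of ?w r t] nd assms w by auto
  obtain u where u: "reduced u" "val u = ?w" using reduced_exists w by blast
  then have "t = r \<and> u \<in> lists (perp r)"
    using centralized_by_perp[of u r t] rw nd assms by auto
  then show ?thesis
    using reach_by_dist[of c x u "perp r"] u C assms perp_sub by auto
qed

abbreviation path_within :: "'c set \<Rightarrow> 'a list \<Rightarrow> 'c \<Rightarrow> 'c \<Rightarrow> bool" where
  "path_within B \<equiv> path (\<lambda>s x y. adj s x y \<and> x \<in> B \<and> y \<in> B)"

lemma gallery_path_within:
  "\<lbrakk>gallery u c x; c \<in> Ch; \<And>p q z. \<lbrakk>u = p @ q; gallery p c z\<rbrakk> \<Longrightarrow> z \<in> B\<rbrakk>
    \<Longrightarrow> path_within B u c x"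
proof (induction u arbitrary: x rule: rev_induct)
  case (snoc t u)
  obtain z where z: "gallery u c z" "adj t z x"
    using snoc.prems(1) by (auto simp: path_append_iff path_Cons_iff)
  have "z \<in> B" using snoc.prems(3)[of u "[t]"] z by simp
  moreover have "x \<in> B" using snoc.prems(3)[of "u @ [t]" "[]"] snoc.prems(1) by simp
  moreover have "path_within B u c z"
  proof (rule snoc.IH[OF z(1) snoc.prems(2)])
    fix p q z' assume "u = p @ q" "gallery p c z'"
    then show "z' \<in> B" using snoc.prems(3)[of p "q @ [t]"] by simp
  qed
  ultimately show ?case using z by (auto simp: path_append_iff path_Cons_iff)
qed simp

text \<open>Prefixes of a word without descent \<open>r\<close> have no descent \<open>r\<close> either, so a minimal gallery from \<open>c\<close>
  stays in the wing.\<close>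

lemma wing_connected:
  assumes "r \<in> I" "J \<subseteq> I" "reach J c x" "x \<in> wing r c"
  shows "\<exists>u \<in> lists J. path_within (wing r c \<inter> Collect (reach J c)) u c x"
proof -
  let ?B = "wing r c \<inter> Collect (reach J c)"
  obtain u where u: "u \<in> lists J" "reduced u" "gallery u c x" "\<delta> c x = val u"
    using reach_gallery assms by blast
  have c: "c \<in> Ch" using assms reachD by blast
  have "path_within ?B u c x"
  proof (rule gallery_path_within[OF u(3) c])
    fix p q z assume pq: "u = p @ q" and z: "gallery p c z"
    have p: "reduced p" "p \<in> lists J" using u pq reduced_append_left by auto
    then have "\<delta> c z = val p" "z \<in> Ch" using gallery_dist z c by blast+
    moreover have "\<not> descent r (val p)"
      using descent_prefix[of p q r] u pq assms by (auto simp: wing_def)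
    moreover have "reach J c z" using gallery_reach z p c by blast
    ultimately show "z \<in> ?B" by (simp add: wing_def)
  qed
  then show ?thesis using u(1) by blast
qed

text \<open>A minimal gallery from \<open>c\<close> may be chosen to start with a step of type \<open>r\<close>, after which all its
  chambers lie outside the wing.\<close>

lemma wing_complement_connected:
  assumes "r \<in> I" "J \<subseteq> I" "reach J c x" "x \<notin> wing r c"
  shows "\<exists>u \<in> lists J. path_within (insert c (Ch - wing r c) \<inter> Collect (reach J c)) u c x"
proof -
  let ?B = "insert c (Ch - wing r c) \<inter> Collect (reach J c)"
  obtain u where u: "u \<in> lists J" "reduced u" "gallery u c x" "\<delta> c x = val u"
    using reach_gallery assms by blast
  have c: "c \<in> Ch" "x \<in> Ch" using assms reachD by blast+
  then have "descent r (val u)" using assms u by (auto simp: wing_def)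
  then obtain v where v: "gallery (r # v) c x" "val (r # v) = val u"
    "length u = Suc (length v)" "set v \<subseteq> set u" "r \<in> set u"
    using move_descent_to_front[OF swappable_strict_adj u(2) assms(1) _ u(3)] by blast
  have vJ: "r # v \<in> lists J" using v u(1) by (auto simp: in_lists_conv_set)
  then have "r # v \<in> lists I" using assms(2) lists_mono by blast
  then have rv: "reduced (r # v)" using v u(2) by (simp add: reduced_def)
  have "path_within ?B (r # v) c x"
  proof (rule gallery_path_within[OF v(1) c(1)])
    fix p q z assume pq: "r # v = p @ q" and z: "gallery p c z"
    show "z \<in> ?B"
    proof (cases p)
      case Nil
      then show ?thesis using z c reach_refl by simp
    next
      case (Cons r' p')
      have p: "reduced p" "p \<in> lists J" using rv vJ pq reduced_append_left by auto
      then have "\<delta> c z = val p" "z \<in> Ch" using gallery_dist z c by blast+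
      moreover have "descent r (val p)"
        using descent_prefix[of "[r]" p' r] p Cons pq descent_mult_self[of r \<one>] assms(1) by simp
      moreover have "reach J c z" using gallery_reach z p c by blast
      ultimately show ?thesis by (simp add: wing_def)
    qed
  qed
  then show ?thesis using vJ by blast
qed

text \<open>Two noncommuting generators are never both descents, so a minimal gallery that leaves the wing
  of \<open>d\<close> prolongs to a minimal gallery from \<open>c\<close> through \<open>d\<close>. The latter starts with \<open>t\<close>, so it ends in the wing of \<open>c\<close>.\<close>

lemma wing_complement_nested:
  assumes I: "s \<in> I" "t \<in> I" "s \<otimes> t \<noteq> t \<otimes> s" and C: "c \<in> Ch" "d \<in> Ch" "\<delta> c d = t"
  shows "Ch - wing s d \<subseteq> wing s c"
proof
  fix y assume y: "y \<in> Ch - wing s d"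
  then have yC: "y \<in> Ch" and ds: "descent s (\<delta> d y)" by (auto simp: wing_def)
  have w: "\<delta> d y \<in> carrier W" using yC C dist_closed by blast
  have "s \<noteq> t" using I by auto
  then have nt: "\<not> descent t (\<delta> d y)" using descents_commute[OF w, of s t] ds I by auto
  then have "\<delta> c y = t \<otimes> \<delta> d y"
    using WD2_length[of d y c t] len_mult_nondescent[OF I(2) w nt] C I yC by simp
  moreover have "descent t (t \<otimes> \<delta> d y)" using descent_mult_self[OF I(2) w] nt by simp
  ultimately have "\<not> descent s (\<delta> c y)"
    using descents_commute[of "\<delta> c y" s t] \<open>s \<noteq> t\<close> I w by auto
  then show "y \<in> wing s c" using yC by (simp add: wing_def)
qed

lemma wings_of_panel_disjoint:
  assumes I: "s \<in> I" and C: "d \<in> Ch" "e \<in> Ch" "\<delta> d e = s"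
  shows "wing s e \<subseteq> Ch - wing s d"
proof
  fix y assume y: "y \<in> wing s e"
  then have yC: "y \<in> Ch" and nd: "\<not> descent s (\<delta> e y)" by (auto simp: wing_def)
  have w: "\<delta> e y \<in> carrier W" using yC C dist_closed by blast
  have "\<delta> d y = s \<otimes> \<delta> e y"
    using WD2_length[of e y d s] len_mult_nondescent[OF I w nd] C I yC by simp
  then have "descent s (\<delta> d y)" using descent_mult_self[OF I w] nd by simp
  then show "y \<in> Ch - wing s d" using yC by (simp add: wing_def)
qed

text \<open>Without the extensionality that elements of the automorphism group are required to have.\<close>

definition isometry :: "('c \<Rightarrow> 'c) \<Rightarrow> bool" where
  "isometry g \<longleftrightarrow> bij_betw g Ch Ch \<and> (\<forall>x\<in>Ch. \<forall>y\<in>Ch. \<delta> (g x) (g y) = \<delta> x y)"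

lemma isometry_closed [simp]: "isometry g \<Longrightarrow> x \<in> Ch \<Longrightarrow> g x \<in> Ch"
  by (auto simp: isometry_def bij_betw_def)

lemma isometry_adj: "\<lbrakk>isometry g; x \<in> Ch; y \<in> Ch\<rbrakk> \<Longrightarrow> adj s (g x) (g y) \<longleftrightarrow> adj s x y"
  unfolding adj_def isometry_def using bij_betw_imp_inj_on inj_on_eq_iff bij_betwE
  by (metis (no_types, lifting))

lemma isometry_reach: "\<lbrakk>isometry g; reach J x y\<rbrakk> \<Longrightarrow> reach J (g x) (g y)"
  by (rotate_tac, induction rule: reach.induct)
    (use isometry_adj reachD adjD in \<open>blast intro: reach_refl reach_step isometry_closed\<close>)+

lemma isometry_wing:
  "\<lbrakk>isometry g; x \<in> Ch; c \<in> Ch\<rbrakk> \<Longrightarrow> g x \<in> wing r (g c) \<longleftrightarrow> x \<in> wing r c"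
  by (simp add: wing_def) (simp add: isometry_def)

lemma isometry_panel:
  assumes g: "isometry g" and x: "x \<in> Ch"
  shows "bij_betw g (pan s x) (pan s (g x))"
proof -
  have "g ` pan s x = pan s (g x)"
  proof (intro equalityI subsetI)
    fix y assume "y \<in> pan s (g x)"
    then have y: "adj s (g x) y" by simp
    then obtain y0 where "y0 \<in> Ch" "y = g y0"
      using g unfolding isometry_def bij_betw_def by blast
    then show "y \<in> g ` pan s x" using y isometry_adj[OF g x] by blast
  qed (use isometry_adj[OF g x] in auto)
  moreover have "inj_on g (pan s x)"
    using g unfolding isometry_def bij_betw_def by (auto intro: inj_on_subset)
  ultimately show ?thesis by (simp add: bij_betw_def)
qed

end

section \<open>Parallelism of colours\<close>

text \<open>\<open>par a b a' b'\<close> plays the role of \<open>a\<^sup>-\<^sup>1 b = a'\<^sup>-\<^sup>1 b'\<close> in a group with underlying set \<open>Y\<close>.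
  These consequences of a group law suffice for copying galleries.\<close>

definition parallelism :: "'d set \<Rightarrow> ('d \<Rightarrow> 'd \<Rightarrow> 'd \<Rightarrow> 'd \<Rightarrow> bool) \<Rightarrow> bool" where
  "parallelism Y par \<longleftrightarrow>
     (\<forall>a\<in>Y. \<forall>b\<in>Y. \<forall>a'\<in>Y. \<exists>!b'. b' \<in> Y \<and> par a b a' b') \<and>
     (\<forall>a b. par a b a b) \<and> (\<forall>a\<in>Y. \<forall>a'\<in>Y. par a a a' a') \<and>
     (\<forall>a\<in>Y. \<forall>b\<in>Y. \<forall>a'\<in>Y. \<forall>b'\<in>Y. par a b a' b' \<longrightarrow> par a' b' a b \<and> par b a b' a') \<and>
     (\<forall>a\<in>Y. \<forall>b\<in>Y. \<forall>d\<in>Y. \<forall>a'\<in>Y. \<forall>b'\<in>Y. \<forall>d'\<in>Y.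
        par a b a' b' \<longrightarrow> par b d b' d' \<longrightarrow> par a d a' d')"

lemma parallelism_of_group:
  assumes "group M" and b: "bij_betw \<beta> Y (carrier M)"
  shows "parallelism Y (\<lambda>a b a' b'.
    inv\<^bsub>M\<^esub> \<beta> a \<otimes>\<^bsub>M\<^esub> \<beta> b = inv\<^bsub>M\<^esub> \<beta> a' \<otimes>\<^bsub>M\<^esub> \<beta> b')"
proof -
  interpret M: group M by fact
  have cl [simp]: "a \<in> Y \<Longrightarrow> \<beta> a \<in> carrier M" for a using b by (auto simp: bij_betw_def)
  have cancel: "a \<in> carrier M \<Longrightarrow> b \<in> carrier M \<Longrightarrow> a \<otimes>\<^bsub>M\<^esub> (inv\<^bsub>M\<^esub> a \<otimes>\<^bsub>M\<^esub> b) = b"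
    "a \<in> carrier M \<Longrightarrow> b \<in> carrier M \<Longrightarrow> inv\<^bsub>M\<^esub> a \<otimes>\<^bsub>M\<^esub> (a \<otimes>\<^bsub>M\<^esub> b) = b" for a b
    by (simp_all add: M.m_assoc[symmetric])
  have ex: "\<exists>!b'. b' \<in> Y \<and> inv\<^bsub>M\<^esub> \<beta> a \<otimes>\<^bsub>M\<^esub> \<beta> b = inv\<^bsub>M\<^esub> \<beta> a' \<otimes>\<^bsub>M\<^esub> \<beta> b'"
    if "a \<in> Y" "b \<in> Y" "a' \<in> Y" for a b a'
  proof -
    let ?m = "\<beta> a' \<otimes>\<^bsub>M\<^esub> (inv\<^bsub>M\<^esub> \<beta> a \<otimes>\<^bsub>M\<^esub> \<beta> b)"
    have "?m \<in> carrier M" using that by simp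
    then have "?m \<in> \<beta> ` Y" using b by (simp add: bij_betw_def)
    then obtain b' where b': "b' \<in> Y" "\<beta> b' = ?m" by (metis imageE)
    show ?thesis
    proof (rule ex1I[of _ b'])
      show "b' \<in> Y \<and> inv\<^bsub>M\<^esub> \<beta> a \<otimes>\<^bsub>M\<^esub> \<beta> b = inv\<^bsub>M\<^esub> \<beta> a' \<otimes>\<^bsub>M\<^esub> \<beta> b'"
        using b' that cancel by simp
      fix b'' assume b'': "b'' \<in> Y \<and> inv\<^bsub>M\<^esub> \<beta> a \<otimes>\<^bsub>M\<^esub> \<beta> b = inv\<^bsub>M\<^esub> \<beta> a' \<otimes>\<^bsub>M\<^esub> \<beta> b''"
      then have "\<beta> b'' = \<beta> b'" using b'(2) that(3) cancel by simp
      then show "b'' = b'" using inj_onD[OF bij_betw_imp_inj_on[OF b]] b'(1) b'' by blast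
    qed
  qed
  have flip: "inv\<^bsub>M\<^esub> \<beta> b \<otimes>\<^bsub>M\<^esub> \<beta> a = inv\<^bsub>M\<^esub> \<beta> b' \<otimes>\<^bsub>M\<^esub> \<beta> a'"
    if "a \<in> Y" "b \<in> Y" "a' \<in> Y" "b' \<in> Y"
      "inv\<^bsub>M\<^esub> \<beta> a \<otimes>\<^bsub>M\<^esub> \<beta> b = inv\<^bsub>M\<^esub> \<beta> a' \<otimes>\<^bsub>M\<^esub> \<beta> b'" for a b a' b'
  proof -
    have "inv\<^bsub>M\<^esub> (inv\<^bsub>M\<^esub> \<beta> a \<otimes>\<^bsub>M\<^esub> \<beta> b) = inv\<^bsub>M\<^esub> (inv\<^bsub>M\<^esub> \<beta> a' \<otimes>\<^bsub>M\<^esub> \<beta> b')"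
      using that by simp
    then show ?thesis using that(1-4) by (simp add: M.inv_mult_group)
  qed
  have comp: "inv\<^bsub>M\<^esub> \<beta> a \<otimes>\<^bsub>M\<^esub> \<beta> d = inv\<^bsub>M\<^esub> \<beta> a' \<otimes>\<^bsub>M\<^esub> \<beta> d'"
    if "a \<in> Y" "b \<in> Y" "d \<in> Y" "a' \<in> Y" "b' \<in> Y" "d' \<in> Y"
      "inv\<^bsub>M\<^esub> \<beta> a \<otimes>\<^bsub>M\<^esub> \<beta> b = inv\<^bsub>M\<^esub> \<beta> a' \<otimes>\<^bsub>M\<^esub> \<beta> b'"
      "inv\<^bsub>M\<^esub> \<beta> b \<otimes>\<^bsub>M\<^esub> \<beta> d = inv\<^bsub>M\<^esub> \<beta> b' \<otimes>\<^bsub>M\<^esub> \<beta> d'" for a b d a' b' d'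
  proof -
    have "inv\<^bsub>M\<^esub> \<beta> a \<otimes>\<^bsub>M\<^esub> \<beta> d = (inv\<^bsub>M\<^esub> \<beta> a \<otimes>\<^bsub>M\<^esub> \<beta> b) \<otimes>\<^bsub>M\<^esub> (inv\<^bsub>M\<^esub> \<beta> b \<otimes>\<^bsub>M\<^esub> \<beta> d)"
      using that(1-6) by (simp add: M.m_assoc cancel)
    also have "\<dots> = (inv\<^bsub>M\<^esub> \<beta> a' \<otimes>\<^bsub>M\<^esub> \<beta> b') \<otimes>\<^bsub>M\<^esub> (inv\<^bsub>M\<^esub> \<beta> b' \<otimes>\<^bsub>M\<^esub> \<beta> d')"
      using that by simp
    also have "\<dots> = inv\<^bsub>M\<^esub> \<beta> a' \<otimes>\<^bsub>M\<^esub> \<beta> d'"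
      using that(1-6) by (simp add: M.m_assoc cancel)
    finally show ?thesis .
  qed
  show ?thesis
    unfolding parallelism_def
  proof (intro conjI ballI allI impI)
    fix a a' assume "a \<in> Y" "a' \<in> Y"
    then show "inv\<^bsub>M\<^esub> \<beta> a \<otimes>\<^bsub>M\<^esub> \<beta> a = inv\<^bsub>M\<^esub> \<beta> a' \<otimes>\<^bsub>M\<^esub> \<beta> a'" by simp
  qed (rule ex flip comp refl sym; assumption)+
qed

text \<open>Every nonempty set carries a group law: a finite one that of a cyclic group, and an infinite one
  that of the free abelian group on it, which has the same cardinality.\<close>

lemma parallelism_exists: "\<exists>par. parallelism Y par"
proof (cases "Y = {}")
  case True
  then show ?thesis by (intro exI[of _ "\<lambda>a b a' b'. a = a' \<and> b = b'"]) (simp add: parallelism_def)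
next
  case nonempty: False
  show ?thesis
  proof (cases "finite Y")
    case True
    have "finite (carrier (integer_mod_group (card Y)))"
      "card (carrier (integer_mod_group (card Y))) = card Y"
      using True nonempty by (auto simp: carrier_integer_mod_group)
    then obtain \<beta> where "bij_betw \<beta> Y (carrier (integer_mod_group (card Y)))"
      using finite_same_card_bij[OF True] by metis
    then show ?thesis
      using parallelism_of_group[OF group_integer_mod_group] by blast
  next
    case False
    then have "carrier (free_Abelian_group Y) \<approx> Y"
      using eqpoll_free_Abelian_group_infinite by blast
    then obtain \<beta> where "bij_betw \<beta> Y (carrier (free_Abelian_group Y))"
      using eqpoll_sym unfolding eqpoll_def by blast
    moreover have "group (free_Abelian_group Y)" by simp
    ultimately show ?thesis using parallelism_of_group by blast
  qed
qed

section \<open>Colourings and tracking maps\<close>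

locale coloured_building = right_angled_building W I Ch \<delta>
  for W (structure) and I and Ch :: "'c set" and \<delta> +
  fixes Y :: "'a \<Rightarrow> 'd set" and par :: "'a \<Rightarrow> 'd \<Rightarrow> 'd \<Rightarrow> 'd \<Rightarrow> 'd \<Rightarrow> bool"
  assumes parallelism: "parallelism (Y s) (par s)"
begin

lemma par_ex1: "\<lbrakk>a \<in> Y s; b \<in> Y s; a' \<in> Y s\<rbrakk> \<Longrightarrow> \<exists>!b'. b' \<in> Y s \<and> par s a b a' b'"
  using parallelism[of s, unfolded parallelism_def, THEN conjunct1] by simp

lemma par_refl: "par s a b a b"
  using parallelism[of s, unfolded parallelism_def, THEN conjunct2, THEN conjunct1] by simp

lemma par_const: "\<lbrakk>a \<in> Y s; a' \<in> Y s\<rbrakk> \<Longrightarrow> par s a a a' a'"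
  using parallelism[of s, unfolded parallelism_def, THEN conjunct2, THEN conjunct2, THEN conjunct1] by simp

lemma par_sym: "\<lbrakk>a \<in> Y s; b \<in> Y s; a' \<in> Y s; b' \<in> Y s; par s a b a' b'\<rbrakk> \<Longrightarrow> par s a' b' a b"
  using parallelism[of s, unfolded parallelism_def, THEN conjunct2, THEN conjunct2, THEN conjunct2, THEN conjunct1] by blast

lemma par_rev: "\<lbrakk>a \<in> Y s; b \<in> Y s; a' \<in> Y s; b' \<in> Y s; par s a b a' b'\<rbrakk> \<Longrightarrow> par s b a b' a'"
  using parallelism[of s, unfolded parallelism_def, THEN conjunct2, THEN conjunct2, THEN conjunct2, THEN conjunct1] by blast

lemma par_comp:
  "\<lbrakk>a \<in> Y s; b \<in> Y s; d \<in> Y s; a' \<in> Y s; b' \<in> Y s; d' \<in> Y s; par s a b a' b'; par s b d b' d'\<rbrakk>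
    \<Longrightarrow> par s a d a' d'"
  using parallelism[of s, unfolded parallelism_def, THEN conjunct2, THEN conjunct2, THEN conjunct2, THEN conjunct2] by blast

text \<open>The colour of type \<open>s\<close> labels the chambers of every \<open>s\<close>-panel and depends only on the position within
  the panel along parallel panels, that is, along the residue spanned by the generators commuting with
  \<open>s\<close>. Nothing relates the colours of panels that are not parallel, so a colouring may be changed on
  each class of parallel panels independently.\<close>

definition colouring :: "('a \<Rightarrow> 'c \<Rightarrow> 'd) \<Rightarrow> bool" where
  "colouring f \<longleftrightarrow> (\<forall>s\<in>I. (\<forall>x\<in>Ch. bij_betw (f s) (pan s x) (Y s)) \<and>
     (\<forall>t\<in>perp s. \<forall>x y. adj t x y \<longrightarrow> f s x = f s y))"

lemma colouring_in: "\<lbrakk>colouring f; s \<in> I; x \<in> Ch\<rbrakk> \<Longrightarrow> f s x \<in> Y s"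
proof -
  assume "colouring f" "s \<in> I" and x: "x \<in> Ch"
  then have "bij_betw (f s) (pan s x) (Y s)" unfolding colouring_def by blast
  then show ?thesis using bij_betwE x by fastforce
qed

lemma colouring_inj: "\<lbrakk>colouring f; s \<in> I; adj s x y; adj s x z; f s y = f s z\<rbrakk> \<Longrightarrow> y = z"
  unfolding colouring_def bij_betw_def inj_on_def using adjD(1)[of s x y] by blast

lemma colouring_surj:
  assumes "colouring f" "s \<in> I" "x \<in> Ch" "b \<in> Y s"
  obtains y where "adj s x y" "f s y = b"
proof -
  have "f s ` pan s x = Y s" using assms unfolding colouring_def bij_betw_def by blast
  then have "b \<in> f s ` pan s x" using assms(4) by simp
  then show ?thesis using that by auto
qed

lemma colouring_perp: "\<lbrakk>colouring f; s \<in> I; t \<in> perp s; adj t x y\<rbrakk> \<Longrightarrow> f s x = f s y"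
  unfolding colouring_def by blast

text \<open>For \<open>J = I\<close> and colourings \<open>f, f'\<close> this makes \<open>g\<close> an isometry; in general \<open>g\<close> forgets the steps with type outside \<open>J\<close>
  and thus folds the building onto a residue of type \<open>J\<close>.\<close>

definition tracks ::
  "'a set \<Rightarrow> ('a \<Rightarrow> 'c \<Rightarrow> 'd) \<Rightarrow> ('a \<Rightarrow> 'c \<Rightarrow> 'd) \<Rightarrow> ('c \<Rightarrow> 'c) \<Rightarrow> bool" where
  "tracks J f f' g \<longleftrightarrow> g \<in> Ch \<rightarrow> Ch \<and> (\<forall>s\<in>I. \<forall>x y. adj s x y \<longrightarrow>
     (if s \<in> J then adj s (g x) (g y) \<and> par s (f s x) (f s y) (f' s (g x)) (f' s (g y))
      else g x = g y))"

text \<open>A step in \<open>Ch \<times> Ch\<close> whose second component copies the first one by its colour quotient. The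
  graph of a tracking map is a connected component for these steps.\<close>

definition joint_adj ::
  "'a set \<Rightarrow> ('a \<Rightarrow> 'c \<Rightarrow> 'd) \<Rightarrow> ('a \<Rightarrow> 'c \<Rightarrow> 'd) \<Rightarrow> 'a \<Rightarrow> 'c \<times> 'c \<Rightarrow> 'c \<times> 'c \<Rightarrow> bool" where
  "joint_adj J f f' s = (\<lambda>(x, x') (y, y'). adj s x y \<and>
     (if s \<in> J then adj s x' y' \<and> par s (f s x) (f s y) (f' s x') (f' s y')
      else x' = y' \<and> x' \<in> Ch))"

context
  fixes J f f'
  assumes J: "J \<subseteq> I" and f: "colouring f" and f': "colouring f'"
begin

lemma joint_adj_trans: "s \<in> I \<Longrightarrow> transp (joint_adj J f f' s)"
proof (rule transpI)
  fix p q r assume s: "s \<in> I" and pq: "joint_adj J f f' s p q" and qr: "joint_adj J f f' s q r"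
  obtain x x' y y' z z' where eq: "p = (x, x')" "q = (y, y')" "r = (z, z')"
    using surj_pair[of p] surj_pair[of q] surj_pair[of r] by blast
  have a: "adj s x y" "adj s y z" using pq qr eq by (auto simp: joint_adj_def)
  then have xz: "adj s x z" using adj_trans s by blast
  show "joint_adj J f f' s p r"
  proof (cases "s \<in> J")
    case True
    then have b: "adj s x' y'" "adj s y' z'"
      "par s (f s x) (f s y) (f' s x') (f' s y')" "par s (f s y) (f s z) (f' s y') (f' s z')"
      using pq qr eq by (auto simp: joint_adj_def)
    have "par s (f s x) (f s z) (f' s x') (f' s z')"
      by (rule par_comp[OF _ _ _ _ _ _ b(3,4)]; rule colouring_in)
        (use f f' s adjD a b in blast)+
    then show ?thesis using True xz adj_trans[OF s b(1,2)] eq by (simp add: joint_adj_def)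
  next
    case False
    then show ?thesis using pq qr eq xz by (auto simp: joint_adj_def)
  qed
qed

lemma joint_adj_sym:
  assumes s: "s \<in> I" and pq: "joint_adj J f f' s p q"
  shows "joint_adj J f f' s q p"
proof -
  obtain x x' y y' where eq: "p = (x, x')" "q = (y, y')"
    using surj_pair[of p] surj_pair[of q] by blast
  have a: "adj s x y" using pq eq by (auto simp: joint_adj_def)
  show ?thesis
  proof (cases "s \<in> J")
    case True
    then have b: "adj s x' y'" "par s (f s x) (f s y) (f' s x') (f' s y')"
      using pq eq by (auto simp: joint_adj_def)
    have "par s (f s y) (f s x) (f' s y') (f' s x')"
      by (rule par_rev[OF _ _ _ _ b(2)]; rule colouring_in) (use f f' s adjD a b in blast)+
    then show ?thesis using True adj_sym[OF s a] adj_sym[OF s b(1)] eq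
      by (simp add: joint_adj_def)
  next
    case False
    then show ?thesis using pq eq adj_sym[OF s a] by (auto simp: joint_adj_def)
  qed
qed

text \<open>A step of type \<open>t\<close> commuting with \<open>s\<close> leaves the colours of type \<open>s\<close> unchanged, so the quotients of
  two exchanged steps are the same as before.\<close>

lemma joint_adj_swappable: "swappable (joint_adj J f f')"
  unfolding swappable_def
proof (intro ballI allI impI, elim conjE)
  fix s t p q r
  assume I: "s \<in> I" "t \<in> I" and st: "s \<noteq> t" "s \<otimes> t = t \<otimes> s"
    and pq: "joint_adj J f f' s p q" and qr: "joint_adj J f f' t q r"
  have perp: "t \<in> perp s" "s \<in> perp t" using I st by (auto simp: perp_def)
  obtain x x' y y' z z' where eq: "p = (x, x')" "q = (y, y')" "r = (z, z')"
    using surj_pair[of p] surj_pair[of q] surj_pair[of r] by blast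
  have a: "adj s x y" "adj t y z" using pq qr eq by (auto simp: joint_adj_def)
  then obtain u where u: "adj t x u" "adj s u z" using adj_swap I st by blast
  have col: "f s u = f s x" "f s z = f s y" "f t u = f t z" "f t x = f t y"
    using colouring_perp[OF f] I perp u a by metis+
  obtain u' where u': "(if t \<in> J then adj t x' u' else x' = u')"
    "(if s \<in> J then adj s u' z' else u' = z')" "u' \<in> Ch" "x' \<in> Ch" "z' \<in> Ch"
  proof -
    consider (both) "s \<in> J" "t \<in> J" | (fst) "s \<in> J" "t \<notin> J" | (snd) "s \<notin> J" by blast
    then show ?thesis
    proof cases
      case both
      then have "adj s x' y'" "adj t y' z'" using pq qr eq by (auto simp: joint_adj_def)
      then obtain u' where "adj t x' u'" "adj s u' z'" using adj_swap I st by blast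
      then show ?thesis using that both adjD by metis
    next
      case fst
      then have "adj s x' z'" using pq qr eq by (auto simp: joint_adj_def)
      then show ?thesis using that[of x'] fst adjD by simp
    next
      case snd
      then have "if t \<in> J then adj t x' z' else x' = z'" "x' \<in> Ch" "z' \<in> Ch"
        using pq qr eq by (auto simp: joint_adj_def split: if_splits)
      then show ?thesis using that[of z'] snd by simp
    qed
  qed
  have "joint_adj J f f' t p (u, u')"
  proof (cases "t \<in> J")
    case True
    then have b: "par t (f t y) (f t z) (f' t y') (f' t z')" using qr eq by (auto simp: joint_adj_def)
    have "f' t x' = f' t y'" using pq eq colouring_perp[OF f' I(2) perp(2)]
      by (auto simp: joint_adj_def split: if_splits)
    moreover have "f' t u' = f' t z'" using u'(2) colouring_perp[OF f' I(2) perp(2)]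
      by (auto split: if_splits)
    ultimately show ?thesis using True b col u u'(1) eq by (simp add: joint_adj_def)
  next
    case False
    then show ?thesis using u u' eq by (simp add: joint_adj_def)
  qed
  moreover have "joint_adj J f f' s (u, u') r"
  proof (cases "s \<in> J")
    case True
    then have b: "par s (f s x) (f s y) (f' s x') (f' s y')" using pq eq by (auto simp: joint_adj_def)
    have "f' s u' = f' s x'" using u'(1) colouring_perp[OF f' I(1) perp(1)]
      by (auto split: if_splits)
    moreover have "f' s z' = f' s y'" using qr eq colouring_perp[OF f' I(1) perp(1)]
      by (auto simp: joint_adj_def split: if_splits)
    ultimately show ?thesis using True b col u u'(2) eq by (simp add: joint_adj_def)
  next
    case False
    then show ?thesis using u u' eq by (simp add: joint_adj_def)
  qed
  ultimately show "\<exists>y. joint_adj J f f' t p y \<and> joint_adj J f f' s y r" by blast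
qed

text \<open>Colour quotients are trivial exactly for constant steps, so the copy cannot move while the original
  rests. This makes a tracking map single-valued.\<close>

lemma joint_adj_strict:
  assumes s: "s \<in> I" and pq: "joint_adj J f f' s p q" "p \<noteq> q"
  shows "fst p \<noteq> fst q"
proof
  assume same: "fst p = fst q"
  obtain x x' y' where eq: "p = (x, x')" "q = (x, y')"
    using that[of "fst p" "snd p" "snd q"] same by (simp add: prod_eq_iff)
  have x: "x \<in> Ch" using pq eq by (auto simp: joint_adj_def)
  show False
  proof (cases "s \<in> J")
    case True
    then have b: "adj s x' y'" "par s (f s x) (f s x) (f' s x') (f' s y')"
      using pq eq by (auto simp: joint_adj_def)
    have Ys: "f s x \<in> Y s" "f' s x' \<in> Y s" "f' s y' \<in> Y s"
      using colouring_in f f' s x b(1) by blast+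
    then have "f' s x' = f' s y'" using par_ex1 par_const b(2) by metis
    then have "x' = y'" using colouring_inj[OF f' s, of x' x' y'] b(1) adjD[of s x' y'] by simp
    then show False using pq eq by simp
  next
    case False
    then show False using pq eq by (auto simp: joint_adj_def)
  qed
qed

text \<open>Copies of galleries from \<open>c\<close> reach every chamber. They define a map because a joint path from
  \<open>(x, x')\<close> to \<open>(x, x'')\<close> can be shortened to one of reduced type, whose first component is a closed
  gallery of reduced type, hence has no steps.\<close>

theorem tracking_map_exists:
  assumes c: "c \<in> Ch" "c' \<in> Ch"
  shows "\<exists>g. tracks J f f' g \<and> g c = c'"
proof -
  let ?E = "joint_adj J f f'"
  define T where "T p \<longleftrightarrow> (\<exists>u \<in> lists I. path ?E u (c, c') p)" for p
  have T0: "T (c, c')" unfolding T_def by (intro bexI[of _ "[]"]) auto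
  have T_step: "T q" if h: "T p" "s \<in> I" "?E s p q" for p q s
  proof -
    obtain u where "u \<in> lists I" "path ?E u (c, c') p"
      using h(1) unfolding T_def by blast
    then have "path ?E (u @ [s]) (c, c') q" "u @ [s] \<in> lists I"
      using h(2,3) by (auto simp: path_append_iff path_Cons_iff simp del: split_paired_Ex)
    then show ?thesis unfolding T_def by (rule bexI)
  qed
  have T_Ch: "x \<in> Ch \<and> x' \<in> Ch" if h: "T (x, x')" for x x'
  proof -
    obtain u where "path ?E u (c, c') (x, x')"
      using h unfolding T_def by blast
    then show ?thesis
    proof (cases u rule: rev_cases)
      case Nil
      then show ?thesis using \<open>path ?E u (c, c') (x, x')\<close> c by simp
    next
      case (snoc v s)
      then show ?thesis using \<open>path ?E u (c, c') (x, x')\<close>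
        by (auto simp: path_append_iff path_Cons_iff joint_adj_def split: if_splits)
    qed
  qed
  have extend: "\<exists>y'. ?E s (x, x') (y, y')" if h: "T (x, x')" "s \<in> I" "adj s x y" for x x' y s
  proof (cases "s \<in> J")
    case True
    have C: "x \<in> Ch" "x' \<in> Ch" "y \<in> Ch" using T_Ch[OF that(1)] that by auto
    then have Ys: "f s x \<in> Y s" "f s y \<in> Y s" "f' s x' \<in> Y s"
      using colouring_in f f' that(2) by blast+
    then obtain b where "b \<in> Y s" "par s (f s x) (f s y) (f' s x') b" using par_ex1 by blast
    moreover from this obtain y' where "adj s x' y'" "f' s y' = b"
      using colouring_surj[OF f' h(2) C(2)] by blast
    ultimately show ?thesis using True that by (auto simp: joint_adj_def)
  next
    case False
    then show ?thesis using that T_Ch[OF that(1)] by (auto simp: joint_adj_def)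
  qed
  have total: "\<exists>x'. T (x, x')" if x: "x \<in> Ch" for x
    using reach_all[OF c(1) x]
  proof (induction rule: reach.induct)
    case reach_refl
    then show ?case using T0 by blast
  next
    case (reach_step y s z)
    then show ?case using extend T_step by blast
  qed
  have uniq: "x' = x''" if T: "T (x, x')" "T (x, x'')" for x x' x''
  proof -
    obtain u v where u: "u \<in> lists I" "path ?E u (c, c') (x, x')"
      and v: "v \<in> lists I" "path ?E v (c, c') (x, x'')"
      using T unfolding T_def by blast
    have "path ?E (rev u) (x, x') (c, c')"
      using path_rev[OF u(2)] u(1) joint_adj_sym by (auto simp: in_lists_conv_set)
    then have "path ?E (rev u @ v) (x, x') (x, x'')"
      using v by (auto simp: path_append_iff)
    moreover have "rev u @ v \<in> lists I" using u v by simp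
    ultimately obtain w where w: "w \<in> lists I" "reduced w"
      "path (\<lambda>s p q. ?E s p q \<and> p \<noteq> q) w (x, x') (x, x'')"
      using shortest_path[OF joint_adj_swappable joint_adj_trans subset_refl] by blast
    \<comment> \<open>the first components form a gallery because a strict joint step moves them\<close>
    have "gallery w (fst p) (fst q)"
      if "path (\<lambda>s p q. ?E s p q \<and> p \<noteq> q) w p q" "w \<in> lists I" for w p q
      using that
    proof (induction rule: path.induct)
      case (path_Cons s p q w r)
      then have "adj s (fst p) (fst q) \<and> fst p \<noteq> fst q"
        using joint_adj_strict[of s p q] by (auto simp: joint_adj_def)
      then show ?case using path_Cons by (auto simp: path_Cons_iff)
    qed simp
    then have "gallery w x x" using w by fastforce
    then have "val w = \<one>" using gallery_dist[of w x x] w T_Ch[OF T(1)] by simp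
    then have "w = []" using reduced_val_one w by blast
    then show ?thesis using w by simp
  qed
  define g where "g x = (SOME x'. T (x, x'))" for x
  have g: "T (x, g x)" if "x \<in> Ch" for x
    unfolding g_def using total[OF that] by (rule someI_ex)
  have "joint_adj J f f' s (x, g x) (y, g y)" if h: "s \<in> I" "adj s x y" for s x y
  proof -
    have C: "x \<in> Ch" "y \<in> Ch" using that by auto
    obtain y' where y': "?E s (x, g x) (y, y')" using extend[OF g[OF C(1)] h] by blast
    then have "T (y, y')" using T_step g C that by blast
    then have "y' = g y" using uniq g C by blast
    then show ?thesis using y' by simp
  qed
  moreover have "g \<in> Ch \<rightarrow> Ch" using g T_Ch by blast
  ultimately have "tracks J f f' g"
    unfolding tracks_def by (fastforce simp: joint_adj_def split: if_splits)
  moreover have "g c = c'" using uniq g T0 c by blast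
  ultimately show ?thesis by blast
qed

end

text \<open>The quotient determines the next colour along the path, and the colour determines the chamber in
  its panel. The map \<open>h\<close> is compared with \<open>g\<close> on a set \<open>B\<close> only, because \<open>g\<close> is usually known to be
  trivial on one part of the building and prescribed on another.\<close>

lemma tracks_unique:
  assumes f: "colouring f" "colouring f'" and J: "J \<subseteq> I" and g: "tracks K f f' g"
    and JK: "J \<subseteq> K" and h: "\<And>s x y. \<lbrakk>s \<in> J; adj s x y; x \<in> B; y \<in> B\<rbrakk> \<Longrightarrow>
      adj s (h x) (h y) \<and> par s (f s x) (f s y) (f' s (h x)) (f' s (h y))"
    and p: "path_within B u c x" "u \<in> lists J" and c: "g c = h c"
  shows "g x = h x"
  using p c
proof (induction rule: path.induct)
  case (path_Cons s x y u z)
  then have s: "s \<in> J" "s \<in> I" "adj s x y" "x \<in> B" "y \<in> B" using J by auto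
  have 1: "adj s (g x) (g y)" "par s (f s x) (f s y) (f' s (g x)) (f' s (g y))"
    using g s JK unfolding tracks_def by (auto split: if_splits)
  have 2: "adj s (g x) (h y)" "par s (f s x) (f s y) (f' s (g x)) (f' s (h y))"
    using h[OF s(1,3-5)] path_Cons.prems by auto
  have "f s x \<in> Y s" "f s y \<in> Y s" "f' s (g x) \<in> Y s" "f' s (g y) \<in> Y s" "f' s (h y) \<in> Y s"
    using colouring_in f s 1(1) 2(1) by blast+
  then have "f' s (g y) = f' s (h y)" using par_ex1 1(2) 2(2) by metis
  then have "g y = h y" using colouring_inj[OF f(2) s(2) 1(1) 2(1)] by blast
  then show ?case using path_Cons by simp
qed simp

text \<open>The quotient of two colours determines the second from the first, in both directions.\<close>

lemma tracks_panel:
  assumes f: "colouring f" "colouring f'" and g: "tracks J f f' g"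
    and s: "s \<in> I" "s \<in> J" and x: "x \<in> Ch"
  shows "bij_betw g (pan s x) (pan s (g x))"
proof -
  have gC: "g x \<in> Ch" if "x \<in> Ch" for x using g that unfolding tracks_def by blast
  have ga: "adj s (g x) (g y)" "par s (f s x) (f s y) (f' s (g x)) (f' s (g y))"
    if "adj s x y" for x y
    using g that s unfolding tracks_def by auto
  have "inj_on g (pan s x)"
  proof (rule inj_onI)
    fix y z assume yz: "y \<in> pan s x" "z \<in> pan s x" and eq: "g y = g z"
    then have a: "adj s y z" using adj_sym[OF s(1), of x y] adj_trans[OF s(1), of y x z] by simp
    then have Ys: "f s y \<in> Y s" "f s z \<in> Y s" "f' s (g y) \<in> Y s"
      using colouring_in f s gC by blast+
    have "par s (f s y) (f s z) (f' s (g y)) (f' s (g y))" using ga(2)[OF a] eq by simp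
    then have "par s (f' s (g y)) (f' s (g y)) (f s y) (f s z)" using par_sym Ys by blast
    moreover have "par s (f' s (g y)) (f' s (g y)) (f s y) (f s y)" using par_const Ys by blast
    ultimately have "f s y = f s z" using par_ex1 Ys by metis
    then show "y = z" using colouring_inj[OF f(1) s(1), of x y z] yz by simp
  qed
  moreover have "g ` pan s x = pan s (g x)"
  proof
    show "g ` pan s x \<subseteq> pan s (g x)" using ga(1) by auto
    show "pan s (g x) \<subseteq> g ` pan s x"
    proof
      fix z assume "z \<in> pan s (g x)"
      then have z: "adj s (g x) z" by simp
      then have Ys: "f s x \<in> Y s" "f' s (g x) \<in> Y s" "f' s z \<in> Y s"
        using colouring_in f s x by blast+
      then obtain b where b: "b \<in> Y s" "par s (f' s (g x)) (f' s z) (f s x) b" using par_ex1 by blast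
      obtain y where y: "adj s x y" "f s y = b"
        using colouring_surj[OF f(1) s(1) x b(1)] by blast
      have "par s (f s x) b (f' s (g x)) (f' s z)" using par_sym b Ys by blast
      moreover have "par s (f s x) b (f' s (g x)) (f' s (g y))"
        using ga(2)[OF y(1)] y by simp
      moreover have "f' s (g y) \<in> Y s" using colouring_in f s y gC by blast
      ultimately have "f' s z = f' s (g y)" using par_ex1 Ys b(1) by metis
      moreover have "adj s (g x) (g y)" using ga(1)[OF y(1)] .
      ultimately have "z = g y" using colouring_inj[OF f(2) s(1) z] by blast
      then show "z \<in> g ` pan s x" using y by simp
    qed
  qed
  ultimately show ?thesis by (simp add: bij_betw_def)
qed

text \<open>Minimal galleries are mapped to galleries of the same reduced type, and the image is closed under
  adjacency.\<close>

lemma tracks_isometry: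
  assumes f: "colouring f" "colouring f'" and g: "tracks I f f' g"
  shows "isometry g"
proof -
  have gC: "g x \<in> Ch" if "x \<in> Ch" for x using g that unfolding tracks_def by blast
  have ga: "adj s (g x) (g y)" "par s (f s x) (f s y) (f' s (g x)) (f' s (g y))"
    if "s \<in> I" "adj s x y" for s x y
    using g that unfolding tracks_def by auto
  have panel: "bij_betw g (pan s x) (pan s (g x))" if "s \<in> I" "x \<in> Ch" for s x
    using tracks_panel[OF f g] that by blast
  have strict: "g x \<noteq> g y" if "s \<in> I" "adj s x y" "x \<noteq> y" for s x y
    using bij_betw_imp_inj_on[OF panel[of s x]] that adjD(1)[of s x y] inj_onD[of g "pan s x" x y]
    by auto
  have gal: "gallery u (g x) (g y)" if "gallery u x y" "u \<in> lists I" for u x y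
    using that
  proof (induction rule: path.induct)
    case (path_Cons s x y u z)
    then show ?case using ga(1)[of s x y] strict[of s x y] by (auto simp: path_Cons_iff)
  qed simp
  have dist: "\<delta> (g x) (g y) = \<delta> x y" if C: "x \<in> Ch" "y \<in> Ch" for x y
  proof -
    obtain u where u: "reduced u" "gallery u x y" "val u = \<delta> x y"
      using gallery_reduced_exists C by blast
    then have "gallery u (g x) (g y)" using gal reducedD by blast
    then show ?thesis using gallery_dist u gC C by simp
  qed
  have "inj_on g Ch"
  proof (rule inj_onI)
    fix x y assume C: "x \<in> Ch" "y \<in> Ch" "g x = g y"
    then have "\<delta> x y = \<one>" using dist[OF C(1,2)] gC by simp
    then show "x = y" using WD1 C by blast
  qed
  moreover have "g ` Ch = Ch"
  proof
    show "g ` Ch \<subseteq> Ch" using gC by blast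
    show "Ch \<subseteq> g ` Ch"
    proof
      fix y assume y: "y \<in> Ch"
      obtain c where c: "c \<in> Ch" using chambers_nonempty by blast
      show "y \<in> g ` Ch"
        using reach_all[OF gC[OF c] y]
      proof (induction rule: reach.induct)
        case (reach_step y s z)
        then obtain x where x: "x \<in> Ch" "y = g x" by blast
        have "z \<in> g ` pan s x"
          using panel[OF reach_step(2) x(1)] reach_step(3) x(2) by (simp add: bij_betw_def)
        then show ?case by auto
      qed (use c in blast)
    qed
  qed
  ultimately show ?thesis using dist by (simp add: isometry_def bij_betw_def)
qed

end

section \<open>Automorphisms extending a given map on a residue\<close>

context coloured_building
begin

context
  fixes f :: "'a \<Rightarrow> 'c \<Rightarrow> 'd" and J c
  assumes f: "colouring f" and J: "J \<subseteq> I" and c: "c \<in> Ch"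
begin

text \<open>The tracking map from a colouring to itself that ignores types outside \<open>J\<close>. In a graph
  product of groups it is the projection that kills the factors outside \<open>J\<close>.\<close>

lemma retraction_exists:
  obtains \<rho> where "tracks J f f \<rho>" "\<And>x. x \<in> Ch \<Longrightarrow> reach J c (\<rho> x)"
    "\<And>x. reach J c x \<Longrightarrow> \<rho> x = x" "\<And>K x. \<lbrakk>K \<subseteq> I; reach K c x\<rbrakk> \<Longrightarrow> reach (J \<inter> K) c (\<rho> x)"
proof -
  obtain \<rho> where \<rho>: "tracks J f f \<rho>" "\<rho> c = c"
    using tracking_map_exists[OF J f f c c] by blast
  have inK: "reach (J \<inter> K) c (\<rho> x)" if "K \<subseteq> I" "reach K c x" for K x
    using that(2)
  proof (induction rule: reach.induct)
    case reach_refl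
    then show ?case using \<rho> by (simp add: reach.reach_refl)
  next
    case (reach_step y s z)
    then have s: "s \<in> I" using that(1) by blast
    show ?case
    proof (cases "s \<in> J")
      case True
      then have "adj s (\<rho> y) (\<rho> z)" using \<rho>(1) s reach_step unfolding tracks_def by auto
      then show ?thesis using reach.reach_step[OF reach_step.IH, of s] True reach_step(2) by blast
    next
      case False
      then have "\<rho> y = \<rho> z" using \<rho>(1) s reach_step unfolding tracks_def by auto
      then show ?thesis using reach_step by simp
    qed
  qed
  have all: "reach J c (\<rho> x)" if "x \<in> Ch" for x
    using inK[of I x] reach_all[OF c that] J by (simp add: Int_absorb2)
  have idJ: "\<rho> x = x" if x: "reach J c x" for x
  proof -
    obtain u where "u \<in> lists J" "path adj u c x" using reach_path[OF x] by blast
    then show ?thesis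
      using tracks_unique[OF f f J \<rho>(1) subset_refl, of UNIV "\<lambda>x. x" u c x] \<rho>(2) par_refl by simp
  qed
  show ?thesis using that[OF \<rho>(1) all idJ inK] .
qed

text \<open>Colours may be read off after folding the building onto the residue of type \<open>J\<close>. This extends
  a recolouring of the residue canonically to the whole building.\<close>

lemma colouring_retract:
  assumes \<rho>: "tracks J f f \<rho>" and s: "s \<in> I" "s \<in> J"
  shows "x \<in> Ch \<Longrightarrow> bij_betw (\<lambda>y. f s (\<rho> y)) (pan s x) (Y s)"
    and "\<lbrakk>t \<in> perp s; adj t x y\<rbrakk> \<Longrightarrow> f s (\<rho> x) = f s (\<rho> y)"
proof -
  assume x: "x \<in> Ch"
  then have "\<rho> x \<in> Ch" using \<rho> unfolding tracks_def by blast
  then have "bij_betw (f s) (pan s (\<rho> x)) (Y s)" using f s unfolding colouring_def by blast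
  with tracks_panel[OF f f \<rho> s x] show "bij_betw (\<lambda>y. f s (\<rho> y)) (pan s x) (Y s)"
    using bij_betw_trans unfolding comp_def by blast
next
  assume t: "t \<in> perp s" "adj t x y"
  then have tI: "t \<in> I" using perp_sub by blast
  then have "adj t (\<rho> x) (\<rho> y) \<or> \<rho> x = \<rho> y"
    using \<rho> t unfolding tracks_def by (metis (full_types))
  then show "f s (\<rho> x) = f s (\<rho> y)" using colouring_perp[OF f s(1) t(1)] by auto
qed

text \<open>Let \<open>\<rho>\<close> be the retraction to the residue of type \<open>J\<close>. For types in \<open>J\<close>, chambers outside \<open>H\<close> are coloured through \<open>\<rho>\<close> and
  those in \<open>H\<close> through \<open>\<gamma> \<circ> \<rho>\<close>. The two agree at the boundary of \<open>H\<close>, since \<open>\<rho>\<close> sends it to chambers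
  fixed by \<open>\<gamma>\<close>. So the result is a colouring, and tracking the colouring by \<open>\<rho>\<close> alone
  gives the isometry.\<close>

theorem partial_extension:
  assumes K: "K \<subseteq> I"
    and bdry: "\<And>x y t. \<lbrakk>t \<in> I; x \<in> Ch - H; y \<in> H; adj t x y\<rbrakk> \<Longrightarrow> reach K c x"
    and \<gamma>: "\<And>s x. \<lbrakk>s \<in> J; reach J c x\<rbrakk> \<Longrightarrow> bij_betw \<gamma> (pan s x) (pan s (\<gamma> x))"
    and fixed: "\<And>x. reach (J \<inter> K) c x \<Longrightarrow> \<gamma> x = x"
    and conn_out: "\<And>x. x \<in> Ch - H \<Longrightarrow>
      \<exists>u \<in> lists I. path_within (insert c (Ch - H) \<inter> Collect (reach I c)) u c x"
    and conn_in: "\<And>x. \<lbrakk>x \<in> H; reach J c x\<rbrakk> \<Longrightarrow>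
      \<exists>u \<in> lists J. path_within (insert c H \<inter> Collect (reach J c)) u c x"
  shows "\<exists>n. isometry n \<and> (\<forall>x\<in>Ch - H. n x = x) \<and> (\<forall>x\<in>H. reach J c x \<longrightarrow> n x = \<gamma> x)"
proof -
  obtain \<rho> where \<rho>: "tracks J f f \<rho>" and \<rho>J: "\<And>x. x \<in> Ch \<Longrightarrow> reach J c (\<rho> x)"
    and \<rho>id: "\<And>x. reach J c x \<Longrightarrow> \<rho> x = x"
    and \<rho>K: "\<And>K x. \<lbrakk>K \<subseteq> I; reach K c x\<rbrakk> \<Longrightarrow> reach (J \<inter> K) c (\<rho> x)"
    using retraction_exists by blast
  have \<gamma>adj: "adj s (\<gamma> x) (\<gamma> y)" if "s \<in> J" "reach J c x" "adj s x y" for s x y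
    using bij_betwE[OF \<gamma>[OF that(1,2)]] that(3) by auto
  have \<gamma>c: "\<gamma> c = c" using fixed reach_refl[OF c] by blast
  have \<gamma>J: "reach J c (\<gamma> x)" if "reach J c x" for x
    using that
  proof (induction rule: reach.induct)
    case reach_refl
    then show ?case using \<gamma>c c by (simp add: reach.reach_refl)
  next
    case (reach_step y s z)
    then show ?case using \<gamma>adj[of s y z] reach.reach_step[OF reach_step.IH] by blast
  qed
  \<comment> \<open>for types in \<open>J\<close>, \<open>f1\<close> factors through the retraction \<open>\<rho>\<close>; \<open>f2\<close> is \<open>f1\<close> twisted by \<open>\<gamma>\<close> on \<open>H\<close>\<close>
  define f1 where "f1 s x = (if s \<in> J then f s (\<rho> x) else f s x)" for s x
  define f2 where "f2 s x = (if s \<in> J \<and> x \<in> H then f s (\<gamma> (\<rho> x)) else f1 s x)" for s x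
  \<comment> \<open>on an \<open>s\<close>-panel that meets \<open>H\<close>, even the chambers outside \<open>H\<close> obey the formula for \<open>H\<close>\<close>
  have edge: "f2 s x = f s (\<gamma> (\<rho> x))" if "s \<in> J" "t \<in> I" "adj t x y" "y \<in> H" for s t x y
  proof (cases "x \<in> H")
    case False
    then have "reach K c x" using bdry[of t x y] that by auto
    then have "\<gamma> (\<rho> x) = \<rho> x" using \<rho>K[OF K] fixed by blast
    then show ?thesis using that False by (simp add: f2_def f1_def)
  qed (use that in \<open>simp add: f2_def\<close>)
  have f1: "colouring f1"
    unfolding colouring_def
  proof (intro ballI conjI allI impI)
    fix s x assume s: "s \<in> I" "x \<in> Ch"
    show "bij_betw (f1 s) (pan s x) (Y s)"
    proof (cases "s \<in> J")
      case True
      then have "f1 s = (\<lambda>y. f s (\<rho> y))" by (simp add: f1_def fun_eq_iff)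
      then show ?thesis using colouring_retract(1)[OF \<rho> s(1) True s(2)] by simp
    next
      case False
      then have "f1 s = f s" by (simp add: f1_def fun_eq_iff)
      then show ?thesis using f s unfolding colouring_def by simp
    qed
  next
    fix s t x y assume s: "s \<in> I" "t \<in> perp s" "adj t x y"
    then show "f1 s x = f1 s y"
      using colouring_retract(2)[OF \<rho> s(1) _ s(2,3)] colouring_perp[OF f s] by (simp add: f1_def)
  qed
  have f2: "colouring f2"
    unfolding colouring_def
  proof (intro ballI conjI allI impI)
    fix s x assume s: "s \<in> I" "x \<in> Ch"
    show "bij_betw (f2 s) (pan s x) (Y s)"
    proof (cases "s \<in> J \<and> (\<exists>y. adj s x y \<and> y \<in> H)")
      case True
      then obtain y0 where sJ: "s \<in> J" and y0: "adj s x y0" "y0 \<in> H" by blast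
      have eq: "f2 s y = f s (\<gamma> (\<rho> y))" if "y \<in> pan s x" for y
      proof (rule edge[OF sJ s(1) _ y0(2)])
        show "adj s y y0" using adj_trans[OF s(1) adj_sym[OF s(1), of x y] y0(1)] that by simp
      qed
      have Rx: "reach J c (\<rho> x)" using \<rho>J s by blast
      then have "\<gamma> (\<rho> x) \<in> Ch" using \<gamma>J reachD by blast
      then have "bij_betw (f s) (pan s (\<gamma> (\<rho> x))) (Y s)" using f s unfolding colouring_def by blast
      then have "bij_betw (f s \<circ> (\<gamma> \<circ> \<rho>)) (pan s x) (Y s)"
        using bij_betw_trans[OF tracks_panel[OF f f \<rho> s(1) sJ s(2)] \<gamma>[OF sJ Rx]]
        by (rule bij_betw_trans[rotated])
      then show ?thesis using eq by (subst bij_betw_cong[where g = "f s \<circ> (\<gamma> \<circ> \<rho>)"]) auto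
    next
      case False
      then have "f2 s y = f1 s y" if "y \<in> pan s x" for y using that by (auto simp: f2_def)
      moreover have "bij_betw (f1 s) (pan s x) (Y s)" using f1 s unfolding colouring_def by blast
      ultimately show ?thesis by (subst bij_betw_cong[where g = "f1 s"]) auto
    qed
  next
    fix s t x y assume s: "s \<in> I" "t \<in> perp s" "adj t x y"
    have tI: "t \<in> I" using s perp_sub by blast
    have C: "x \<in> Ch" "y \<in> Ch" using s by auto
    show "f2 s x = f2 s y"
    proof (cases "s \<in> J \<and> (x \<in> H \<or> y \<in> H)")
      case True
      have "f2 s x = f s (\<gamma> (\<rho> x))" "f2 s y = f s (\<gamma> (\<rho> y))"
        using True edge[of s t x y] edge[of s t y x] edge[of s t x x] edge[of s t y y]
          adj_sym[OF tI s(3)] s(3) C tI by auto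
      moreover have "f s (\<gamma> (\<rho> x)) = f s (\<gamma> (\<rho> y))"
      proof (cases "t \<in> J")
        case True
        then have "adj t (\<rho> x) (\<rho> y)" using \<rho> tI s(3) unfolding tracks_def by auto
        then have "adj t (\<gamma> (\<rho> x)) (\<gamma> (\<rho> y))" using \<gamma>adj True \<rho>J C by blast
        then show ?thesis using colouring_perp[OF f s(1,2)] by blast
      next
        case False
        then show ?thesis using \<rho> tI s(3) unfolding tracks_def by auto
      qed
      ultimately show ?thesis by simp
    next
      case False
      then have "f2 s x = f1 s x" "f2 s y = f1 s y" by (auto simp: f2_def)
      then show ?thesis using colouring_perp[OF f1 s] by simp
    qed
  qed
  have cJ: "reach J c c" using reach_refl c by blast
  have f2c: "f2 s c = f s c" "f1 s c = f s c" for s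
    using \<rho>id[OF cJ] \<gamma>c by (simp_all add: f2_def f1_def)
  obtain n where n: "tracks I f2 f1 n" "n c = c"
    using tracking_map_exists[OF subset_refl f2 f1 c c] by blast
  have "n x = x" if x: "x \<in> Ch - H" for x
  proof -
    obtain u where u: "u \<in> lists I"
      "path_within (insert c (Ch - H) \<inter> Collect (reach I c)) u c x"
      using conn_out[OF x] by blast
    have eq: "f2 s y = f1 s y" if "y \<in> insert c (Ch - H) \<inter> Collect (reach I c)" for s y
    proof (cases "y = c")
      case False
      then show ?thesis using that by (simp add: f2_def)
    qed (simp add: f2c)
    show ?thesis
      by (rule tracks_unique[OF f2 f1 subset_refl n(1) subset_refl _ u(2,1),
            where h = "\<lambda>x. x"]) (use eq par_refl n(2) in auto)
  qed
  moreover have "n x = \<gamma> x" if x: "x \<in> H" "reach J c x" for x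
  proof -
    let ?B = "insert c H \<inter> Collect (reach J c)"
    obtain u where u: "u \<in> lists J" "path_within ?B u c x"
      using conn_in[OF x] by blast
    have eq: "f2 s y = f1 s (\<gamma> y)" if "y \<in> ?B" "s \<in> J" for s y
    proof (cases "y = c")
      case False
      then show ?thesis using that \<rho>id[of y] \<rho>id[OF \<gamma>J, of y] by (simp add: f2_def f1_def)
    qed (simp add: f2c \<gamma>c)
    have "n c = \<gamma> c" using n \<gamma>c by simp
    show ?thesis
    proof (rule tracks_unique[OF f2 f1 J n(1) J _ u(2,1), where h = \<gamma>])
      fix s x y assume "s \<in> J" "adj s x y" "x \<in> ?B" "y \<in> ?B"
      then show "adj s (\<gamma> x) (\<gamma> y) \<and> par s (f2 s x) (f2 s y) (f1 s (\<gamma> x)) (f1 s (\<gamma> y))"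
        using eq \<gamma>adj par_refl by auto
    qed (rule \<open>n c = \<gamma> c\<close>)
  qed
  moreover have "isometry n" using tracks_isometry[OF f2 f1 n(1)] .
  ultimately show ?thesis by blast
qed

end

lemma reach_empty: "reach {} c x \<Longrightarrow> x = c"
  by (induction rule: reach.induct) auto

lemma outside_wing_extension:
  assumes f: "colouring f" and J: "J \<subseteq> I" and c: "c \<in> Ch" and r: "r \<in> J"
    and \<gamma>: "\<And>s x. \<lbrakk>s \<in> J; reach J c x\<rbrakk> \<Longrightarrow> bij_betw \<gamma> (pan s x) (pan s (\<gamma> x))"
    and fixed: "\<And>x. reach (J \<inter> perp r) c x \<Longrightarrow> \<gamma> x = x"
  shows "\<exists>n. isometry n \<and> (\<forall>x\<in>wing r c. n x = x) \<and>
    (\<forall>x\<in>Ch - wing r c. reach J c x \<longrightarrow> n x = \<gamma> x)"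
proof -
  have rI: "r \<in> I" using r J by blast
  have cw: "c \<in> wing r c" using center_in_wing rI c by blast
  have dd: "Ch - (Ch - wing r c) = wing r c" using wing_sub by blast
  have "\<exists>n. isometry n \<and> (\<forall>x\<in>Ch - (Ch - wing r c). n x = x) \<and>
    (\<forall>x\<in>Ch - wing r c. reach J c x \<longrightarrow> n x = \<gamma> x)"
  proof (rule partial_extension[OF f J c perp_sub[of r] _ \<gamma> fixed])
    fix x y t assume "t \<in> I" "x \<in> Ch - (Ch - wing r c)" "y \<in> Ch - wing r c" "adj t x y"
    then show "reach (perp r) c x" using wing_boundary[OF rI _ c, of t x y] by blast
  next
    fix x assume "x \<in> Ch - (Ch - wing r c)"
    then have x: "x \<in> wing r c" "reach I c x" using reach_all c by auto
    show "\<exists>u\<in>lists I. path_within (insert c (Ch - (Ch - wing r c)) \<inter> Collect (reach I c)) u c x"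
      using wing_connected[OF rI subset_refl x(2,1)] unfolding dd insert_absorb[OF cw] .
  next
    fix x assume x: "x \<in> Ch - wing r c" "reach J c x"
    then show "\<exists>u\<in>lists J. path_within (insert c (Ch - wing r c) \<inter> Collect (reach J c)) u c x"
      using wing_complement_connected[OF rI J x(2)] by blast
  qed
  then show ?thesis unfolding dd .
qed

lemma inside_wing_extension:
  assumes f: "colouring f" and J: "J \<subseteq> I" and c: "c \<in> Ch" and r: "r \<in> J"
    and \<gamma>: "\<And>s x. \<lbrakk>s \<in> J; reach J c x\<rbrakk> \<Longrightarrow> bij_betw \<gamma> (pan s x) (pan s (\<gamma> x))"
    and fixed: "\<And>x. reach (J \<inter> insert r (perp r)) c x \<Longrightarrow> \<gamma> x = x"
  shows "\<exists>n. isometry n \<and> (\<forall>x\<in>Ch - wing r c. n x = x) \<and>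
    (\<forall>x\<in>wing r c. reach J c x \<longrightarrow> n x = \<gamma> x)"
proof -
  have rI: "r \<in> I" using r J by blast
  then have KI: "insert r (perp r) \<subseteq> I" using perp_sub by blast
  have cw: "c \<in> wing r c" using center_in_wing rI c by blast
  show ?thesis
  proof (rule partial_extension[OF f J c KI _ \<gamma> fixed])
    fix x y t assume a: "t \<in> I" "x \<in> Ch - wing r c" "y \<in> wing r c" "adj t x y"
    then have "adj t y x" using adj_sym by blast
    then have t: "t = r" "reach (perp r) c y" using wing_boundary[OF rI a(1) c, of y x] a by blast+
    have "reach (insert r (perp r)) c y" using t(2) by (rule reach_mono) blast
    then show "reach (insert r (perp r)) c x"
      using reach_step[of "insert r (perp r)" c y r x] t(1) \<open>adj t y x\<close> by simp
  next
    fix x assume x: "x \<in> Ch - wing r c"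
    then show "\<exists>u\<in>lists I. path_within (insert c (Ch - wing r c) \<inter> Collect (reach I c)) u c x"
      using wing_complement_connected[OF rI subset_refl reach_all[OF c]] by blast
  next
    fix x assume x: "x \<in> wing r c" "reach J c x"
    show "\<exists>u\<in>lists J. path_within (insert c (wing r c) \<inter> Collect (reach J c)) u c x"
      using wing_connected[OF rI J x(2,1)] unfolding insert_absorb[OF cw] .
  qed
qed

text \<open>The case \<open>J = {r}\<close> of the extension outside a wing: inside a panel there is nothing to preserve, so
  every permutation fixing \<open>c\<close> extends.\<close>

lemma wing_fixator_on_panel:
  assumes f: "colouring f" and c: "c \<in> Ch" and r: "r \<in> I"
    and \<pi>: "bij_betw \<pi> (pan r c) (pan r c)" "\<pi> c = c"
  shows "\<exists>n. isometry n \<and> (\<forall>x\<in>wing r c. n x = x) \<and> (\<forall>x\<in>pan r c. n x = \<pi> x)"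
proof -
  have R: "adj r c x" if "reach {r} c x" for x
    using that
  proof (induction rule: reach.induct)
    case (reach_step y s z)
    then show ?case using adj_trans[OF r] by blast
  qed (use c in simp)
  have \<pi>R: "bij_betw \<pi> (pan s x) (pan s (\<pi> x))" if "s \<in> {r}" "reach {r} c x" for s x
  proof -
    have x: "adj r c x" using R that by blast
    then have "adj r c (\<pi> x)" using bij_betwE[OF \<pi>(1)] by auto
    then show ?thesis using \<pi>(1) pan_eq[OF r x] pan_eq[OF r, of c "\<pi> x"] that by simp
  qed
  have "{r} \<inter> perp r = {}" by (auto simp: perp_def)
  then have "\<exists>n. isometry n \<and> (\<forall>x\<in>wing r c. n x = x) \<and>
      (\<forall>x\<in>Ch - wing r c. reach {r} c x \<longrightarrow> n x = \<pi> x)"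
    using r reach_empty \<pi>(2) \<pi>R by (intro outside_wing_extension[OF f _ c]) auto
  then obtain n where n: "isometry n" "\<forall>x\<in>wing r c. n x = x"
    "\<forall>x\<in>Ch - wing r c. reach {r} c x \<longrightarrow> n x = \<pi> x" by blast
  have "n x = \<pi> x" if x: "x \<in> pan r c" for x
  proof (cases "x = c")
    case True
    then show ?thesis using n center_in_wing[OF r c] \<pi> by simp
  next
    case False
    then have "\<delta> c x = r" "x \<in> Ch" using x by (auto simp: adj_def)
    then have "x \<in> Ch - wing r c" using descent_mult_self[OF r, of \<one>] r by (simp add: wing_def)
    moreover have "reach {r} c x" using reach_adj[of r "{r}" c x] x by simp
    ultimately show ?thesis using n by blast
  qed
  then show ?thesis using n by blast
qed

end

section \<open>Charts of apartments\<close>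

lemma bij_two_points:
  assumes "a \<in> Y" "b \<in> Y" "a \<noteq> b" "a' \<in> Y" "b' \<in> Y" "a' \<noteq> b'"
  shows "\<exists>\<pi>. bij_betw \<pi> Y Y \<and> \<pi> a = a' \<and> \<pi> b = b'"
proof -
  let ?\<tau> = "transpose a a'"
  let ?\<pi> = "transpose (?\<tau> b) b' \<circ> ?\<tau>"
  have \<tau>: "bij_betw (transpose x y) Y Y" if "x \<in> Y" "y \<in> Y" for x y
    using that by (intro bij_betwI[where g = "transpose x y"]) (auto simp: transpose_def)
  have "?\<tau> b \<in> Y" using assms by (auto simp: transpose_def)
  then have "bij_betw ?\<pi> Y Y" using assms by (intro bij_betw_trans[OF \<tau> \<tau>]) auto
  moreover have "?\<pi> a = a'" "?\<pi> b = b'" using assms by (auto simp: transpose_def)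
  ultimately show ?thesis by blast
qed

context right_angled_building
begin

text \<open>In a residue of this type all \<open>s\<close>-panels are parallel, and it is the product of any of them with
  a residue of type \<open>perp s\<close>. Colours of type \<open>s\<close> are determined on it by those on one panel.\<close>

abbreviation wall_type :: "'a \<Rightarrow> 'a set" where
  "wall_type s \<equiv> insert s (perp s)"

lemma wall_type_sub: "s \<in> I \<Longrightarrow> wall_type s \<subseteq> I"
  using perp_sub by blast

lemma wall_type_word:
  "\<lbrakk>s \<in> I; u \<in> lists (wall_type s)\<rbrakk> \<Longrightarrow>
    \<exists>p \<in> lists (perp s). val u = val p \<or> val u = s \<otimes> val p"
proof (induction u)
  case Nil
  show ?case by (intro bexI[of _ "[]"]) auto
next
  case (Cons t u)
  then obtain p where p: "p \<in> lists (perp s)" "val u = val p \<or> val u = s \<otimes> val p" by auto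
  have pI: "p \<in> lists I" using p perp_sub lists_mono by blast
  show ?case
  proof (cases "t = s")
    case True
    have "val (t # u) = s \<otimes> val p \<or> val (t # u) = val p"
      using p(2) by (rule disjE) (simp_all add: True pI Cons.prems(1))
    then show ?thesis using p by blast
  next
    case False
    then have t: "t \<in> perp s" "t \<in> I" "t \<otimes> s = s \<otimes> t"
      using Cons.prems by (auto simp: perp_def)
    have "t \<otimes> (s \<otimes> val p) = s \<otimes> (t \<otimes> val p)"
      using t(2,3) pI Cons.prems(1) by (simp add: m_assoc[symmetric])
    then have "val (t # u) = val (t # p) \<or> val (t # u) = s \<otimes> val (t # p)"
      using p(2) by auto
    then show ?thesis using p(1) t(1) by (intro bexI[of _ "t # p"]) auto
  qed
qed

text \<open>The map \<open>\<alpha>\<close> in the definition of an apartment, kept because the base chamber and the labelling by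
  \<open>W\<close> matter.\<close>

definition chart :: "('a \<Rightarrow> 'c) \<Rightarrow> bool" where
  "chart \<beta> \<longleftrightarrow> \<beta> \<in> carrier W \<rightarrow> Ch \<and>
     (\<forall>v\<in>carrier W. \<forall>w\<in>carrier W. \<delta> (\<beta> v) (\<beta> w) = inv v \<otimes> w)"

lemma chart_closed: "\<lbrakk>chart \<beta>; w \<in> carrier W\<rbrakk> \<Longrightarrow> \<beta> w \<in> Ch"
  unfolding chart_def by blast

lemma chart_dist: "\<lbrakk>chart \<beta>; v \<in> carrier W; w \<in> carrier W\<rbrakk> \<Longrightarrow> \<delta> (\<beta> v) (\<beta> w) = inv v \<otimes> w"
  unfolding chart_def by blast

lemma chart_inj: "chart \<beta> \<Longrightarrow> inj_on \<beta> (carrier W)"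
proof (rule inj_onI)
  fix v w assume \<beta>: "chart \<beta>" and C: "v \<in> carrier W" "w \<in> carrier W" "\<beta> v = \<beta> w"
  then have "inv v \<otimes> w = \<one>" using chart_dist[OF \<beta> C(1,2)] dist_self chart_closed by metis
  then have "v \<otimes> (inv v \<otimes> w) = v" using C by simp
  then show "v = w" using C by simp
qed

lemma chart_adj:
  assumes "chart \<beta>" "v \<in> carrier W" "w \<in> carrier W" "s \<in> I"
  shows "adj s (\<beta> v) (\<beta> w) \<longleftrightarrow> v = w \<or> w = v \<otimes> s"
proof -
  have "inv v \<otimes> w = s \<longleftrightarrow> w = v \<otimes> s"
  proof
    assume "inv v \<otimes> w = s"
    then have "v \<otimes> (inv v \<otimes> w) = v \<otimes> s" by simp
    then show "w = v \<otimes> s" using assms by simp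
  qed (use assms in simp)
  moreover have "\<beta> v = \<beta> w \<longleftrightarrow> v = w" using chart_inj[OF assms(1)] assms by (auto dest: inj_onD)
  ultimately show ?thesis
    using assms chart_closed chart_dist[OF assms(1-3)] by (simp add: adj_def)
qed

lemma chart_path:
  "\<lbrakk>chart \<beta>; u \<in> lists I; x \<in> carrier W\<rbrakk> \<Longrightarrow>
    path_within (\<beta> ` carrier W) u (\<beta> x) (\<beta> (x \<otimes> val u))"
proof (induction u arbitrary: x)
  case (Cons s u)
  then have s: "s \<in> I" "u \<in> lists I" by auto
  have "adj s (\<beta> x) (\<beta> (x \<otimes> s))" using chart_adj[of \<beta> x "x \<otimes> s" s] Cons.prems s by simp
  moreover have "x \<otimes> val (s # u) = (x \<otimes> s) \<otimes> val u" using s Cons.prems by (simp add: m_assoc)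
  ultimately show ?case using Cons.IH[of "x \<otimes> s"] Cons.prems s by (auto simp: path_Cons_iff)
qed simp

end

context coloured_building
begin

lemma chart_colour_perp:
  assumes f: "colouring f" and \<beta>: "chart \<beta>" and s: "s \<in> I"
  shows "\<lbrakk>p \<in> lists (perp s); x \<in> carrier W\<rbrakk> \<Longrightarrow> f s (\<beta> (x \<otimes> val p)) = f s (\<beta> x)"
proof (induction p arbitrary: x)
  case (Cons t p)
  then have t: "t \<in> I" "t \<in> perp s" "p \<in> lists I"
    using perp_sub[of s] lists_mono[of "perp s" I] by auto
  have "adj t (\<beta> x) (\<beta> (x \<otimes> t))" using chart_adj[OF \<beta>, of x "x \<otimes> t" t] Cons.prems t by simp
  then have "f s (\<beta> x) = f s (\<beta> (x \<otimes> t))" using colouring_perp[OF f s t(2)] by blast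
  moreover have "x \<otimes> val (t # p) = (x \<otimes> t) \<otimes> val p" using t Cons.prems by (simp add: m_assoc)
  ultimately show ?case using Cons.IH[of "x \<otimes> t"] Cons.prems t by simp
qed simp

text \<open>Two charts whose galleries have the same colours differ by a tracking map. So change the
  colouring near the second chart, separately on each residue of type \<open>wall_type s\<close>: the chart meets
  an \<open>s\<close>-panel in two chambers, and a permutation of the colours gives them the colours that the first
  chart has there. One permutation works for the whole residue because both charts meet it in the same
  coset of \<open>W\<close>, along which their colours are constant up to the last step of type \<open>s\<close>.\<close>

theorem chart_extension:
  assumes f: "colouring f" and \<beta>: "chart \<beta>" and \<beta>': "chart \<beta>'"
  shows "\<exists>g. isometry g \<and> (\<forall>w\<in>carrier W. g (\<beta> w) = \<beta>' w)"
proof -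
  define lies where "lies s x w \<longleftrightarrow> w \<in> carrier W \<and> reach (wall_type s) x (\<beta>' w)" for s x w
  define matching where "matching s w \<pi> \<longleftrightarrow> bij_betw \<pi> (Y s) (Y s) \<and>
    \<pi> (f s (\<beta>' w)) = f s (\<beta> w) \<and> \<pi> (f s (\<beta>' (w \<otimes> s))) = f s (\<beta> (w \<otimes> s))" for s w \<pi>
  define perm where "perm s w = (SOME \<pi>. matching s w \<pi>)" for s w
  define f' where "f' s x =
    (if \<exists>w. lies s x w then perm s (SOME w. lies s x w) (f s x) else f s x)" for s x
  have perm: "matching s w (perm s w)" if s: "s \<in> I" and w: "w \<in> carrier W" for s w
  proof -
    have ne: "f s (\<beta> w) \<noteq> f s (\<beta> (w \<otimes> s))" if \<beta>: "chart \<beta>" for \<beta>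
    proof
      assume eq: "f s (\<beta> w) = f s (\<beta> (w \<otimes> s))"
      have a: "adj s (\<beta> w) (\<beta> (w \<otimes> s))" "adj s (\<beta> w) (\<beta> w)"
        using chart_adj[OF \<beta> w _ s, of "w \<otimes> s"] chart_closed[OF \<beta> w] s w by auto
      then have "\<beta> w = \<beta> (w \<otimes> s)" using colouring_inj[OF f s a(2,1) eq] by simp
      then have "w = w \<otimes> s" using inj_onD[OF chart_inj[OF \<beta>]] w s by simp
      then have "inv w \<otimes> w = inv w \<otimes> (w \<otimes> s)" by simp
      then show False using w s gen_neq_one[OF s] by simp
    qed
    have "f s (\<beta> v) \<in> Y s" if "chart \<beta>" "v \<in> carrier W" for \<beta> v
      using colouring_in[OF f s] chart_closed that by blast
    then have "\<exists>\<pi>. matching s w \<pi>"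
      unfolding matching_def using ne \<beta> \<beta>' w s by (intro bij_two_points) auto
    then show ?thesis unfolding perm_def by (rule someI_ex)
  qed
  have lies_cong: "lies s x = lies s y" if "s \<in> I" "t \<in> wall_type s" "adj t x y" for s t x y
  proof -
    have "reach (wall_type s) x y" using that reach_adj by blast
    then show ?thesis
      using reach_trans reach_sym[OF _ wall_type_sub[OF that(1)]]
      unfolding lies_def fun_eq_iff by blast
  qed
  have f': "colouring f'"
    unfolding colouring_def
  proof (intro ballI conjI allI impI)
    fix s x assume s: "s \<in> I" "x \<in> Ch"
    have fs: "bij_betw (f s) (pan s x) (Y s)" using f s unfolding colouring_def by blast
    have cong: "lies s y = lies s x" if "y \<in> pan s x" for y using lies_cong[of s s x y] s that by simp
    show "bij_betw (f' s) (pan s x) (Y s)"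
    proof (cases "\<exists>w. lies s x w")
      case True
      let ?\<pi> = "perm s (SOME w. lies s x w)"
      have "lies s x (SOME w. lies s x w)" using True by (rule someI_ex)
      then have "bij_betw ?\<pi> (Y s) (Y s)" using perm[OF s(1)] unfolding lies_def matching_def by blast
      then have "bij_betw (?\<pi> \<circ> f s) (pan s x) (Y s)" by (rule bij_betw_trans[OF fs])
      moreover have "f' s y = (?\<pi> \<circ> f s) y" if "y \<in> pan s x" for y
        using cong[OF that] True by (simp add: f'_def)
      ultimately show ?thesis by (subst bij_betw_cong) auto
    next
      case False
      then have "f' s y = f s y" if "y \<in> pan s x" for y
        using cong[OF that] by (simp add: f'_def)
      then show ?thesis using fs by (subst bij_betw_cong) auto
    qed
  next
    fix s t x y assume s: "s \<in> I" "t \<in> perp s" "adj t x y"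
    then show "f' s x = f' s y"
      using lies_cong[of s t x y] colouring_perp[OF f s] by (simp add: f'_def)
  qed
  \<comment> \<open>the chosen \<open>w\<close> represents the coset of \<open>v\<close>: up to letters commuting with \<open>s\<close>, \<open>v\<close> is \<open>w\<close> or \<open>w s\<close>\<close>
  have key: "f' s (\<beta>' v) = f s (\<beta> v)" if s: "s \<in> I" and v: "v \<in> carrier W" for s v
  proof -
    have "lies s (\<beta>' v) v" using reach_refl chart_closed[OF \<beta>' v] v by (simp add: lies_def)
    then have ex: "\<exists>w. lies s (\<beta>' v) w" by blast
    define w where "w = (SOME w. lies s (\<beta>' v) w)"
    have "lies s (\<beta>' v) w" unfolding w_def using ex by (rule someI_ex)
    then have w: "w \<in> carrier W" "reach (wall_type s) (\<beta>' w) (\<beta>' v)"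
      using reach_sym wall_type_sub[OF s] unfolding lies_def by blast+
    obtain u where u: "u \<in> lists (wall_type s)" "\<delta> (\<beta>' w) (\<beta>' v) = val u"
      using reach_gallery[OF w(2) wall_type_sub[OF s]] by blast
    obtain p where p: "p \<in> lists (perp s)" "val u = val p \<or> val u = s \<otimes> val p"
      using wall_type_word[OF s u(1)] by blast
    have pI: "p \<in> lists I" using p perp_sub lists_mono by blast
    have "inv w \<otimes> v = val u" using u(2) chart_dist[OF \<beta>' w(1) v] by simp
    then have "w \<otimes> (inv w \<otimes> v) = w \<otimes> val u" by simp
    then have "v = w \<otimes> val u" using w v by simp
    then consider "v = w \<otimes> val p" | "v = (w \<otimes> s) \<otimes> val p"
      using p(2) w s pI by (auto simp: m_assoc)
    then have "perm s w (f s (\<beta>' v)) = f s (\<beta> v)"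
    proof cases
      case 1
      then show ?thesis
        using chart_colour_perp[OF f _ s p(1) w(1)] \<beta> \<beta>' perm[OF s w(1)] by (simp add: matching_def)
    next
      case 2
      then show ?thesis
        using chart_colour_perp[OF f _ s p(1), of _ "w \<otimes> s"] w s \<beta> \<beta>' perm[OF s w(1)]
        by (simp add: matching_def)
    qed
    then show ?thesis using ex by (simp add: f'_def w_def)
  qed
  have b1: "\<beta> \<one> \<in> Ch" "\<beta>' \<one> \<in> Ch" using chart_closed \<beta> \<beta>' by auto
  obtain g where g: "tracks I f f' g" "g (\<beta> \<one>) = \<beta>' \<one>"
    using tracking_map_exists[OF subset_refl f f' b1] by blast
  let ?B = "\<beta> ` carrier W"
  define h where "h x = \<beta>' (inv_into (carrier W) \<beta> x)" for x
  have h: "h (\<beta> w) = \<beta>' w" if "w \<in> carrier W" for w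
    using inv_into_f_f[OF chart_inj[OF \<beta>] that] by (simp add: h_def)
  have "g (\<beta> w) = \<beta>' w" if w: "w \<in> carrier W" for w
  proof -
    obtain u where u: "u \<in> lists I" "val u = w" using word_exists w by blast
    have p: "path_within ?B u (\<beta> \<one>) (\<beta> w)"
      using chart_path[OF \<beta> u(1), of \<one>] u w by simp
    have "g (\<beta> w) = h (\<beta> w)"
    proof (rule tracks_unique[OF f f' subset_refl g(1) subset_refl _ p u(1)])
      fix s x y assume s: "s \<in> I" "adj s x y" "x \<in> ?B" "y \<in> ?B"
      then obtain v w where vw: "v \<in> carrier W" "w \<in> carrier W" "x = \<beta> v" "y = \<beta> w" by blast
      have "adj s (\<beta>' v) (\<beta>' w)"
        using chart_adj[OF \<beta> vw(1,2) s(1)] chart_adj[OF \<beta>' vw(1,2) s(1)] s vw by simp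
      then show "adj s (h x) (h y) \<and> par s (f s x) (f s y) (f' s (h x)) (f' s (h y))"
        using vw h key[OF s(1)] par_refl by simp
    qed (use g h in simp)
    then show ?thesis using h w by simp
  qed
  moreover have "isometry g" using tracks_isometry[OF f f' g(1)] .
  ultimately show ?thesis by blast
qed

end

section \<open>Existence of colourings\<close>

text \<open>By homogeneity all panels of a type have the same size, so the \<open>s\<close>-panel of one base chamber can
  serve as the set of colours of type \<open>s\<close>.\<close>

locale homogeneous_right_angled_building = right_angled_building +
  assumes homogeneous: "\<lbrakk>x \<in> Ch; y \<in> Ch\<rbrakk> \<Longrightarrow> \<exists>g. isometry g \<and> g x = y"
begin

definition base_chamber :: 'c where "base_chamber = (SOME c. c \<in> Ch)"

lemma base_chamber [simp]: "base_chamber \<in> Ch"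
  unfolding base_chamber_def using chambers_nonempty by (simp add: some_in_eq)

definition colours :: "'a \<Rightarrow> 'c set" where
  "colours s = pan s base_chamber"

definition colour_par :: "'a \<Rightarrow> 'c \<Rightarrow> 'c \<Rightarrow> 'c \<Rightarrow> 'c \<Rightarrow> bool" where
  "colour_par s = (SOME par. parallelism (colours s) par)"

sublocale coloured_building W I Ch \<delta> colours colour_par
  by unfold_locales (simp add: colour_par_def someI_ex[OF parallelism_exists])

lemma slide_along_perp:
  "\<lbrakk>s \<in> I; reach (perp s) z y; adj s y y'\<rbrakk> \<Longrightarrow> \<exists>z'. adj s z z' \<and> reach (perp s) z' y'"
proof -
  assume s: "s \<in> I" and r: "reach (perp s) z y" and a: "adj s y y'"
  from r a show ?thesis
  proof (induction arbitrary: y' rule: reach.induct)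
    case reach_refl
    then show ?case using reach.reach_refl by blast
  next
    case (reach_step y t x)
    then have t: "t \<in> I" "t \<noteq> s" "t \<otimes> s = s \<otimes> t" by (auto simp: perp_def)
    then obtain x' where x': "adj s y x'" "adj t x' y'"
      using adj_swap[OF t(1) s] reach_step by blast
    then obtain z' where "adj s z z'" "reach (perp s) z' x'" using reach_step.IH by blast
    then show ?case using reach.reach_step reach_step(2) x'(2) by blast
  qed
qed

text \<open>Steps of type \<open>s\<close> commute with the others, so they can all be done first.\<close>

lemma wall_projection:
  assumes s: "s \<in> I" and r: "reach (wall_type s) x y"
  shows "\<exists>z. adj s x z \<and> reach (perp s) z y"
  using r
proof (induction rule: reach.induct)
  case reach_refl
  then show ?case using reach.reach_refl[of x "perp s"] by (intro exI[of _ x]) simp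
next
  case (reach_step y t y')
  then obtain z where z: "adj s x z" "reach (perp s) z y" by blast
  show ?case
  proof (cases "t = s")
    case True
    then obtain z' where "adj s z z'" "reach (perp s) z' y'"
      using slide_along_perp[OF s z(2)] reach_step by blast
    then show ?thesis using adj_trans[OF s z(1)] by blast
  next
    case False
    then show ?thesis using z reach.reach_step[OF z(2)] reach_step by blast
  qed
qed

lemma panel_perp_unique:
  "\<lbrakk>s \<in> I; adj s p q; reach (perp s) p q\<rbrakk> \<Longrightarrow> p = q"
  using adj_reach_eq[OF _ _ perp_sub, of s p q s] by (auto simp: perp_def)

text \<open>The residues of type \<open>wall_type s\<close> can be coloured one by one. An automorphism moves each of them to
  the residue of the base chamber, whose chambers are coloured by their projections to the \<open>s\<close>-panel
  of the base chamber.\<close>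

theorem colouring_exists: "\<exists>f. colouring f"
proof -
  \<comment> \<open>one chamber in each residue of type \<open>wall_type s\<close>, and an automorphism taking it to the base chamber\<close>
  define base where "base s x = (SOME b. b \<in> Ch \<and> reach (wall_type s) b x)" for s x
  define mov where "mov b = (SOME g. isometry g \<and> g b = base_chamber)" for b
  define f where "f s x =
    (THE p. adj s base_chamber p \<and> reach (perp s) p (mov (base s x) x))" for s x
  have base: "base s x \<in> Ch \<and> reach (wall_type s) (base s x) x" if "x \<in> Ch" for s x
    unfolding base_def by (rule someI[of _ x]) (use that reach_refl in blast)
  have base_cong: "base s x = base s y" if "s \<in> I" "t \<in> wall_type s" "adj t x y" for s t x y
  proof -
    have "reach (wall_type s) x y" using that reach_adj by blast
    then have "reach (wall_type s) b x \<longleftrightarrow> reach (wall_type s) b y" for b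
      using reach_trans reach_sym[OF _ wall_type_sub[OF that(1)]] by blast
    then show ?thesis unfolding base_def by simp
  qed
  have mov: "isometry (mov b) \<and> mov b b = base_chamber" if "b \<in> Ch" for b
    unfolding mov_def using homogeneous[OF that base_chamber] by (rule someI_ex)
  have gate: "\<exists>!p. adj s base_chamber p \<and> reach (perp s) p y"
    if s: "s \<in> I" and r: "reach (wall_type s) base_chamber y" for s y
  proof -
    obtain p where p: "adj s base_chamber p" "reach (perp s) p y"
      using wall_projection[OF s r] by blast
    show ?thesis
    proof (rule ex1I[of _ p])
      fix q assume q: "adj s base_chamber q \<and> reach (perp s) q y"
      then have "adj s q p" using adj_trans[OF s adj_sym[OF s] p(1)] by blast
      moreover have "reach (perp s) q p" using q p reach_trans reach_sym[OF _ perp_sub] by blast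
      ultimately show "q = p" using panel_perp_unique s by blast
    qed (use p in blast)
  qed
  have fx: "adj s base_chamber (f s x) \<and> reach (perp s) (f s x) (mov (base s x) x)"
    if s: "s \<in> I" and x: "x \<in> Ch" for s x
  proof -
    have "reach (wall_type s) base_chamber (mov (base s x) x)"
      using isometry_reach[of "mov (base s x)" "wall_type s" "base s x" x] mov base[OF x] by metis
    from theI'[OF gate[OF s this]] show ?thesis unfolding f_def .
  qed
  have f_eq: "f s x = p"
    if "s \<in> I" "x \<in> Ch" "adj s base_chamber p" "reach (perp s) p (mov (base s x) x)" for s x p
  proof -
    have "reach (wall_type s) base_chamber (mov (base s x) x)"
      using isometry_reach[of "mov (base s x)" "wall_type s" "base s x" x] mov base[OF that(2)] by metis
    from gate[OF that(1) this] show ?thesis using fx[OF that(1,2)] that(3,4) by blast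
  qed
  have "colouring f"
    unfolding colouring_def
  proof (intro ballI conjI allI impI)
    fix s x assume s: "s \<in> I" and x: "x \<in> Ch"
    let ?m = "mov (base s x)"
    have m: "isometry ?m" using mov base x by blast
    have cong: "base s y = base s x" if "y \<in> pan s x" for y
      using base_cong[of s s x y] s that by simp
    show "bij_betw (f s) (pan s x) (colours s)"
      unfolding bij_betw_def
    proof
      show "inj_on (f s) (pan s x)"
      proof (rule inj_onI)
        fix y z assume y: "y \<in> pan s x" and z: "z \<in> pan s x" and eq: "f s y = f s z"
        have C: "y \<in> Ch" "z \<in> Ch" using y z by auto
        have "reach (perp s) (f s y) (?m y)" "reach (perp s) (f s z) (?m z)"
          using fx[OF s C(1)] fx[OF s C(2)] cong y z by auto
        then have r: "reach (perp s) (?m y) (?m z)"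
          using eq reach_trans reach_sym[OF _ perp_sub] by metis
        have "adj s y z" using y z adj_trans[OF s adj_sym[OF s], of x y z] by simp
        then have "adj s (?m y) (?m z)" using isometry_adj[OF m C] by blast
        then have "?m y = ?m z" using panel_perp_unique s r by blast
        then show "y = z" using m C unfolding isometry_def bij_betw_def by (auto dest: inj_onD)
      qed
      show "f s ` pan s x = colours s"
      proof
        show "f s ` pan s x \<subseteq> colours s" using fx[OF s] by (auto simp: colours_def)
        show "colours s \<subseteq> f s ` pan s x"
        proof
          fix p assume "p \<in> colours s"
          then have p: "adj s base_chamber p" by (simp add: colours_def)
          have "reach (wall_type s) base_chamber (?m x)"
            using isometry_reach[of ?m "wall_type s" "base s x" x] mov base[OF x] by metis
          moreover have "reach (wall_type s) base_chamber p" using p reach_adj by blast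
          ultimately have "reach (wall_type s) (?m x) p"
            using reach_trans reach_sym[OF _ wall_type_sub[OF s]] by blast
          then obtain z where z: "adj s (?m x) z" "reach (perp s) z p"
            using wall_projection[OF s] by blast
          then have "z \<in> ?m ` pan s x"
            using isometry_panel[OF m x, of s] by (simp add: bij_betw_def)
          then obtain y where y: "adj s x y" "z = ?m y" by auto
          have "f s y = p"
            using f_eq[OF s adjD(2)[OF y(1)] p] y z(2) cong[of y] reach_sym[OF _ perp_sub] by simp
          then show "p \<in> f s ` pan s x" using y by auto
        qed
      qed
    qed
  next
    fix s t x y assume s: "s \<in> I" and t: "t \<in> perp s" and a: "adj t x y"
    let ?m = "mov (base s x)"
    have C: "x \<in> Ch" "y \<in> Ch" using a by auto
    have m: "isometry ?m" using mov base C by blast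
    have "base s y = base s x" using base_cong[of s t x y] s t a by simp
    moreover have "reach (perp s) (?m x) (?m y)"
      using isometry_reach[OF m reach_adj[OF t a]] .
    ultimately have "reach (perp s) (f s x) (mov (base s y) y)"
      using fx[OF s C(1)] reach_trans by metis
    then show "f s x = f s y" using f_eq[OF s C(2)] fx[OF s C(1)] by metis
  qed
  then show ?thesis by blast
qed

end

section \<open>The group of type-preserving automorphisms\<close>

context right_angled_building
begin

abbreviation G :: "('c \<Rightarrow> 'c) monoid" where "G \<equiv> Aut_plus Ch \<delta>"

lemma carrier_G: "g \<in> carrier G \<longleftrightarrow> g \<in> extensional Ch \<and> isometry g"
  by (auto simp: Aut_plus_def isometry_def Bij_def)

lemma carrier_G_Bij:
  "g \<in> carrier G \<longleftrightarrow> g \<in> Bij Ch \<and> (\<forall>x\<in>Ch. \<forall>y\<in>Ch. \<delta> (g x) (g y) = \<delta> x y)"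
  by (simp add: Aut_plus_def)

lemma carrier_isometry: "g \<in> carrier G \<Longrightarrow> isometry g"
  by (simp add: carrier_G)

lemma carrier_G_closed: "\<lbrakk>g \<in> carrier G; x \<in> Ch\<rbrakk> \<Longrightarrow> g x \<in> Ch"
  using carrier_isometry isometry_closed by blast

lemma carrier_G_dist: "\<lbrakk>g \<in> carrier G; x \<in> Ch; y \<in> Ch\<rbrakk> \<Longrightarrow> \<delta> (g x) (g y) = \<delta> x y"
  using carrier_isometry unfolding isometry_def by blast

lemma isometry_lift: "isometry n \<Longrightarrow> \<exists>g \<in> carrier G. \<forall>x\<in>Ch. g x = n x"
proof (intro bexI[of _ "restrict n Ch"] ballI)
  assume "isometry n"
  then have "isometry (restrict n Ch)"
    unfolding isometry_def by (auto simp: bij_betw_def inj_on_def)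
  then show "restrict n Ch \<in> carrier G" by (simp add: carrier_G)
qed simp

lemma G_eqI: "\<lbrakk>g \<in> carrier G; h \<in> carrier G; \<And>x. x \<in> Ch \<Longrightarrow> g x = h x\<rbrakk> \<Longrightarrow> g = h"
  using extensionalityI[of g Ch h] by (auto simp: carrier_G)

lemma G_subgroup: "subgroup (carrier G) (BijGroup Ch)"
proof -
  interpret B: group "BijGroup Ch" by (rule group_BijGroup)
  have inv_dist: "\<delta> (h x) (h y) = \<delta> x y"
    if g: "g \<in> carrier G" and h: "h = inv\<^bsub>BijGroup Ch\<^esub> g" and C: "x \<in> Ch" "y \<in> Ch" for g h x y
  proof -
    have gB: "g \<in> Bij Ch" using g by (simp add: Aut_plus_def)
    have hx: "h z = inv_into Ch g z" if "z \<in> Ch" for z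
      using inv_BijGroup[OF gB] h that by simp
    have "g ` Ch = Ch" using gB by (simp add: Bij_def bij_betw_def)
    then have "g (h z) = z" "h z \<in> Ch" if "z \<in> Ch" for z
      using that hx by (auto intro: f_inv_into_f inv_into_into)
    then show ?thesis using carrier_G_dist[OF g, of "h x" "h y"] C by simp
  qed
  show ?thesis
  proof (rule B.subgroupI)
    show "carrier G \<subseteq> carrier (BijGroup Ch)" by (auto simp: Aut_plus_def BijGroup_def)
    have "(\<lambda>x\<in>Ch. x) \<in> carrier G"
      using id_Bij[of Ch] by (auto simp: Aut_plus_def)
    then show "carrier G \<noteq> {}" by blast
  next
    fix g assume g: "g \<in> carrier G"
    then have "g \<in> carrier (BijGroup Ch)" by (simp add: carrier_G_Bij BijGroup_def)
    then have "inv\<^bsub>BijGroup Ch\<^esub> g \<in> carrier (BijGroup Ch)" by (rule B.inv_closed)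
    moreover have "carrier (BijGroup Ch) = Bij Ch" by (simp add: BijGroup_def)
    ultimately show "inv\<^bsub>BijGroup Ch\<^esub> g \<in> carrier G"
      unfolding carrier_G_Bij using inv_dist[OF g refl] by blast
  next
    fix g h assume g: "g \<in> carrier G" "h \<in> carrier G"
    then have B: "g \<in> Bij Ch" "h \<in> Bij Ch" unfolding carrier_G_Bij by blast+
    have "\<delta> (compose Ch g h x) (compose Ch g h y) = \<delta> x y" if "x \<in> Ch" "y \<in> Ch" for x y
      using that carrier_G_dist carrier_G_closed g by (simp add: compose_def)
    then show "g \<otimes>\<^bsub>BijGroup Ch\<^esub> h \<in> carrier G"
      using compose_Bij[OF B] B by (simp add: carrier_G_Bij BijGroup_def)
  qed
qed

lemma group_G: "group G"
  using subgroup.subgroup_is_group[OF G_subgroup group_BijGroup] by (simp add: Aut_plus_def)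

lemma G_mult: "\<lbrakk>g \<in> carrier G; h \<in> carrier G; x \<in> Ch\<rbrakk> \<Longrightarrow> (g \<otimes>\<^bsub>G\<^esub> h) x = g (h x)"
  by (simp add: Aut_plus_def BijGroup_def compose_def)

lemma G_one: "x \<in> Ch \<Longrightarrow> \<one>\<^bsub>G\<^esub> x = x"
  by (simp add: Aut_plus_def BijGroup_def)

interpretation G: group G by (rule group_G)

lemma G_inv: "\<lbrakk>g \<in> carrier G; x \<in> Ch\<rbrakk> \<Longrightarrow> (inv\<^bsub>G\<^esub> g) (g x) = x"
  using G_mult[of "inv\<^bsub>G\<^esub> g" g x] G_one by simp

lemma G_inv': "\<lbrakk>g \<in> carrier G; x \<in> Ch\<rbrakk> \<Longrightarrow> g ((inv\<^bsub>G\<^esub> g) x) = x"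
  using G_mult[of g "inv\<^bsub>G\<^esub> g" x] G_one by simp

lemma G_inj: "\<lbrakk>g \<in> carrier G; x \<in> Ch; y \<in> Ch; g x = g y\<rbrakk> \<Longrightarrow> x = y"
  using G_inv by metis

lemma apartments_eq: "apartments W Ch \<delta> = {\<alpha> ` carrier W | \<alpha>. chart \<alpha>}"
  by (simp add: apartments_def chart_def)

lemma chart_image: "\<lbrakk>chart \<alpha>; g \<in> carrier G\<rbrakk> \<Longrightarrow> chart (g \<circ> \<alpha>)"
  unfolding chart_def using carrier_G_dist carrier_G_closed by (auto simp: Pi_iff)

lemma chart_translate:
  assumes \<alpha>: "chart \<alpha>" and v: "v \<in> carrier W"
  shows "chart (\<lambda>w. \<alpha> (v \<otimes> w))" "(\<lambda>w. \<alpha> (v \<otimes> w)) ` carrier W = \<alpha> ` carrier W"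
proof -
  show "chart (\<lambda>w. \<alpha> (v \<otimes> w))"
    unfolding chart_def
  proof (intro conjI ballI)
    show "(\<lambda>w. \<alpha> (v \<otimes> w)) \<in> carrier W \<rightarrow> Ch" using chart_closed[OF \<alpha>] v by simp
    fix x y assume "x \<in> carrier W" "y \<in> carrier W"
    then show "\<delta> (\<alpha> (v \<otimes> x)) (\<alpha> (v \<otimes> y)) = inv x \<otimes> y"
      using chart_dist[OF \<alpha>, of "v \<otimes> x" "v \<otimes> y"] v by (simp add: inv_mult_group m_assoc)
  qed
  show "(\<lambda>w. \<alpha> (v \<otimes> w)) ` carrier W = \<alpha> ` carrier W"
  proof
    show "\<alpha> ` carrier W \<subseteq> (\<lambda>w. \<alpha> (v \<otimes> w)) ` carrier W"
    proof
      fix x assume "x \<in> \<alpha> ` carrier W"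
      then obtain w where "w \<in> carrier W" "x = \<alpha> w" by blast
      then show "x \<in> (\<lambda>w. \<alpha> (v \<otimes> w)) ` carrier W"
        using v by (intro image_eqI[of _ _ "inv v \<otimes> w"]) auto
    qed
  qed (use v in auto)
qed

text \<open>If \<open>x \<in> D i\<close> and \<open>y \<in> D j\<close> with \<open>i \<noteq> j\<close>, the supports are disjoint, so the glued map agrees with the
  isometry \<open>U j \<circ> U i\<close> at both points.\<close>

lemma glue_isometries:
  fixes U :: "'k \<Rightarrow> 'c \<Rightarrow> 'c"
  assumes U: "\<And>k. U k \<in> carrier G" and D: "\<And>k. D k \<subseteq> Ch"
    and fixed: "\<And>k x. x \<in> Ch - D k \<Longrightarrow> U k x = x"
    and disj: "\<And>i j. i \<noteq> j \<Longrightarrow> D i \<inter> D j = {}"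
  shows "\<exists>v \<in> carrier G. (\<forall>k. \<forall>x\<in>D k. v x = U k x) \<and> (\<forall>x\<in>Ch. (\<forall>k. x \<notin> D k) \<longrightarrow> v x = x)"
proof -
  define v where "v x = (if \<exists>k. x \<in> D k then U (SOME k. x \<in> D k) x else x)" for x
  have vD: "v x = U k x" if "x \<in> D k" for k x
  proof -
    have "x \<in> D (SOME k. x \<in> D k)" using that by (rule someI)
    then have "(SOME k. x \<in> D k) = k" using disj that by blast
    then show ?thesis using that by (auto simp: v_def)
  qed
  have v0: "v x = x" if "\<forall>k. x \<notin> D k" for x using that by (simp add: v_def)
  have UD: "U k x \<in> D k" if x: "x \<in> D k" for k x
  proof (rule ccontr)
    assume n: "U k x \<notin> D k"
    have C: "x \<in> Ch" "U k x \<in> Ch" using x D carrier_G_closed U by blast+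
    then have "U k (U k x) = U k x" using fixed n by blast
    then have "U k x = x" using G_inj U C by blast
    then show False using n x by simp
  qed
  have dist: "\<delta> (v x) (v y) = \<delta> x y" if C: "x \<in> Ch" "y \<in> Ch" for x y
  proof -
    consider (both) i j where "x \<in> D i" "y \<in> D j" | (left) i where "x \<in> D i" "\<forall>k. y \<notin> D k"
      | (right) j where "\<forall>k. x \<notin> D k" "y \<in> D j" | (none) "\<forall>k. x \<notin> D k" "\<forall>k. y \<notin> D k" by blast
    then show ?thesis
    proof cases
      case both
      show ?thesis
      proof (cases "i = j")
        case True
        then show ?thesis using vD both carrier_G_dist[OF U C] by simp
      next
        case False
        have Ci: "U i x \<in> Ch" using carrier_G_closed U C by blast
        have "U i x \<notin> D j" "y \<notin> D i" using UD both disj False by blast+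
        then have "U j (U i x) = U i x" "U i y = y" using fixed C Ci by blast+
        then have "\<delta> (v x) (v y) = \<delta> (U j (U i x)) (U j (U i y))" using vD both by simp
        also have "\<dots> = \<delta> x y" using carrier_G_dist U C Ci carrier_G_closed by simp
        finally show ?thesis .
      qed
    next
      case left
      then have "U i y = y" using fixed C by blast
      then show ?thesis using vD[OF left(1)] v0[OF left(2)] carrier_G_dist[OF U C, of i] by simp
    next
      case right
      then have "U j x = x" using fixed C by blast
      then show ?thesis using vD[OF right(2)] v0[OF right(1)] carrier_G_dist[OF U C, of j] by simp
    next
      case none
      then show ?thesis using v0 by simp
    qed
  qed
  have vC: "v x \<in> Ch" if "x \<in> Ch" for x
    using that vD v0 carrier_G_closed U by (metis)
  have "isometry v"
    unfolding isometry_def bij_betw_def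
  proof (intro conjI ballI dist)
    show "inj_on v Ch"
    proof (rule inj_onI)
      fix x y assume C: "x \<in> Ch" "y \<in> Ch" "v x = v y"
      then have "\<delta> x y = \<one>" using dist[OF C(1,2)] vC by simp
      then show "x = y" using WD1 C by blast
    qed
    show "v ` Ch = Ch"
    proof
      show "v ` Ch \<subseteq> Ch" using vC by blast
      show "Ch \<subseteq> v ` Ch"
      proof
        fix y assume y: "y \<in> Ch"
        show "y \<in> v ` Ch"
        proof (cases "\<exists>k. y \<in> D k")
          case True
          then obtain k where k: "y \<in> D k" by blast
          define x where "x = (inv\<^bsub>G\<^esub> U k) y"
          have x: "x \<in> Ch" "U k x = y"
            using carrier_G_closed[of "inv\<^bsub>G\<^esub> U k"] G_inv'[OF U y] U y by (auto simp: x_def)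
          have "x \<in> D k"
          proof (rule ccontr)
            assume "x \<notin> D k"
            then have "U k x = x" using fixed x(1) by blast
            then show False using \<open>x \<notin> D k\<close> k x(2) by simp
          qed
          then show ?thesis using vD x by (metis imageI)
        next
          case False
          then show ?thesis using v0[of y] y by (metis imageI)
        qed
      qed
    qed
  qed
  then obtain v' where v': "v' \<in> carrier G" "\<forall>x\<in>Ch. v' x = v x" using isometry_lift by blast
  show ?thesis
  proof (intro bexI[OF _ v'(1)] conjI allI ballI impI)
    show "v' x = U k x" if "x \<in> D k" for k x using that v' vD D by (metis subsetD)
    show "v' x = x" if "x \<in> Ch" "\<forall>k. x \<notin> D k" for x using that v' v0 by simp
  qed
qed

text \<open>The translates \<open>h\<^sup>k D\<close> are disjoint, because \<open>h\<^sup>k D \<subseteq> h H\<close> for \<open>k > 0\<close> misses \<open>D\<close>. So the product \<open>v\<close> of all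
  \<open>h\<^sup>k u h\<^sup>-\<^sup>k\<close> with \<open>k \<ge> 0\<close> exists although it is infinite. Conjugation by \<open>h\<close> removes its first factor,
  so \<open>v = u (h v h\<^sup>-\<^sup>1)\<close> and \<open>u\<close> is a commutator of \<open>v\<close> and \<open>h\<close>.\<close>

theorem translated_support_in_normal:
  assumes N: "N \<lhd> G" and h: "h \<in> N" and u: "u \<in> carrier G"
    and D: "D \<subseteq> H" and H: "H \<subseteq> Ch" and fixed: "\<And>x. x \<in> Ch - D \<Longrightarrow> u x = x"
    and hH: "\<And>x. x \<in> H \<Longrightarrow> h x \<in> H - D"
  shows "u \<in> N"
proof -
  interpret N: normal N G by (rule N)
  have hG: "h \<in> carrier G" using h by (rule N.mem_carrier)
  define p where "p k = h [^]\<^bsub>G\<^esub> k" for k :: nat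
  have pG: "p k \<in> carrier G" for k using hG by (simp add: p_def)
  have p0: "p 0 x = x" if "x \<in> Ch" for x using G_one that by (simp add: p_def)
  have pS: "p (Suc k) x = h (p k x)" if "x \<in> Ch" for k x
    using G.nat_pow_Suc2[OF hG, of k] G_mult[OF hG pG that] unfolding p_def by metis
  have padd: "p (i + j) x = p i (p j x)" if "x \<in> Ch" for i j x
    using G_mult[OF pG pG that, of i j] G.nat_pow_mult[OF hG] unfolding p_def by metis
  have pH: "p k x \<in> H" if "x \<in> H" for k x
    using that
  proof (induction k)
    case 0
    then show ?case using p0[of x] H by auto
  next
    case (Suc k)
    then show ?case using pS[of x k] hH[of "p k x"] H by auto
  qed
  have pD: "p (Suc k) x \<notin> D" if x: "x \<in> D" for k x
  proof -
    have "x \<in> H" "x \<in> Ch" using x D H by blast+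
    then show ?thesis using pS[of x k] hH[OF pH, of x k] by simp
  qed
  define DD where "DD k = p k ` D" for k
  define U where "U k = p k \<otimes>\<^bsub>G\<^esub> (u \<otimes>\<^bsub>G\<^esub> inv\<^bsub>G\<^esub> p k)" for k
  have UG: "U k \<in> carrier G" for k unfolding U_def using pG u by simp
  have DC: "D \<subseteq> Ch" using D H by blast
  have DDC: "DD k \<subseteq> Ch" for k using carrier_G_closed[OF pG] DC by (auto simp: DD_def)
  have Up: "U k (p k x) = p k (u x)" if x: "x \<in> Ch" for k x
  proof -
    have C: "p k x \<in> Ch" using carrier_G_closed pG x by blast
    have "U k (p k x) = p k ((u \<otimes>\<^bsub>G\<^esub> inv\<^bsub>G\<^esub> p k) (p k x))"
      unfolding U_def using G_mult[OF pG _ C] u pG by simp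
    also have "\<dots> = p k (u x)" using G_mult[OF u _ C] pG G_inv[OF pG x] by simp
    finally show ?thesis .
  qed
  have surj: "\<exists>y\<in>Ch. x = p k y" if "x \<in> Ch" for k x
    using G_inv'[OF pG that] carrier_G_closed[of "inv\<^bsub>G\<^esub> p k" x] pG that
    by (metis G.inv_closed)
  have Ufix: "U k x = x" if x: "x \<in> Ch - DD k" for k x
  proof -
    obtain y where y: "y \<in> Ch" "x = p k y" using surj[of x k] x by blast
    then have "y \<notin> D" using x by (auto simp: DD_def)
    then show ?thesis using Up[OF y(1)] fixed y by simp
  qed
  have less: "DD i \<inter> DD j = {}" if "i < j" for i j
  proof -
    obtain k where j: "j = i + Suc k" using \<open>i < j\<close> less_iff_Suc_add by auto
    have "p i x \<noteq> p j y" if xy: "x \<in> D" "y \<in> D" for x y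
    proof
      assume "p i x = p j y"
      then have "p i x = p i (p (Suc k) y)" using padd[of y i "Suc k"] xy DC j by auto
      moreover have "p (Suc k) y \<in> Ch" using carrier_G_closed[OF pG] xy DC by blast
      ultimately have "x = p (Suc k) y" using G_inj[OF pG] xy DC by blast
      then show False using pD xy by blast
    qed
    then show ?thesis by (auto simp: DD_def)
  qed
  then have disj: "DD i \<inter> DD j = {}" if "i \<noteq> j" for i j
    using that by (metis inf_commute linorder_neqE_nat)
  obtain v where v: "v \<in> carrier G" "\<And>k x. x \<in> DD k \<Longrightarrow> v x = U k x"
    "\<And>x. \<lbrakk>x \<in> Ch; \<forall>k. x \<notin> DD k\<rbrakk> \<Longrightarrow> v x = x"
    using glue_isometries[of U DD, OF UG DDC Ufix disj] by blast
  \<comment> \<open>\<open>u\<close> is injective and fixes the complement of \<open>D\<close>, so it preserves \<open>D\<close>\<close>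
  have uD: "u x \<in> D" if x: "x \<in> D" for x
  proof (rule ccontr)
    assume n: "u x \<notin> D"
    have C: "x \<in> Ch" "u x \<in> Ch" using x DC carrier_G_closed u by blast+
    then have "u (u x) = u x" using fixed n by blast
    then have "u x = x" using G_inj[OF u] C by blast
    then show False using n x by simp
  qed
  have "(v \<otimes>\<^bsub>G\<^esub> h) x = (u \<otimes>\<^bsub>G\<^esub> (h \<otimes>\<^bsub>G\<^esub> v)) x" if x: "x \<in> Ch" for x
  proof -
    have C: "h x \<in> Ch" "v x \<in> Ch" using carrier_G_closed hG v(1) x by auto
    have "v (h x) = u (h (v x))"
    proof (cases "\<exists>k. x \<in> DD k")
      case True
      then obtain k y where y: "y \<in> D" "x = p k y" by (auto simp: DD_def)
      have yC: "y \<in> Ch" "u y \<in> Ch" using y DC uD by auto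
      have "h x = p (Suc k) y" using pS yC y by simp
      then have "v (h x) = p (Suc k) (u y)"
        using v(2)[of "h x" "Suc k"] Up[OF yC(1), of "Suc k"] y by (auto simp: DD_def)
      moreover have "v x = p k (u y)" using v(2)[of x k] Up[OF yC(1), of k] y by (auto simp: DD_def)
      moreover have "u (p (Suc k) (u y)) = p (Suc k) (u y)"
        using fixed pD[OF uD[OF y(1)]] carrier_G_closed[OF pG yC(2)] by blast
      ultimately show ?thesis using pS[OF yC(2), of k] by simp
    next
      case False
      then have vx: "v x = x" using v(3) x by blast
      have notin: "h x \<notin> DD (Suc k)" for k
      proof
        assume "h x \<in> DD (Suc k)"
        then obtain y where y: "y \<in> D" "h x = p (Suc k) y" by (auto simp: DD_def)
        then have "h x = h (p k y)" using pS[of y k] DC by auto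
        then have "x = p k y" using G_inj[OF hG x] carrier_G_closed[OF pG] y DC by blast
        then show False using False y by (auto simp: DD_def)
      qed
      show ?thesis
      proof (cases "h x \<in> D")
        case True
        have "p 0 (h x) = h x" using p0 C by blast
        then have "h x \<in> DD 0" using True unfolding DD_def by (metis imageI)
        then have "v (h x) = U 0 (h x)" using v(2) by blast
        also have "\<dots> = u (h x)"
          using Up[OF C(1), of 0] p0[OF C(1)] p0[of "u (h x)"] carrier_G_closed[OF u C(1)] by simp
        finally show ?thesis using vx by simp
      next
        case False
        have "DD 0 = D" using p0 DC by (force simp: DD_def)
        then have "\<forall>k. h x \<notin> DD k" using notin False by (metis not0_implies_Suc)
        then show ?thesis using v(3) fixed C False vx by simp
      qed
    qed
    then show ?thesis using G_mult hG v(1) u x C by simp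
  qed
  then have "v \<otimes>\<^bsub>G\<^esub> h = u \<otimes>\<^bsub>G\<^esub> (h \<otimes>\<^bsub>G\<^esub> v)" using G_eqI hG v(1) u by simp
  then have "u = (v \<otimes>\<^bsub>G\<^esub> h \<otimes>\<^bsub>G\<^esub> inv\<^bsub>G\<^esub> v) \<otimes>\<^bsub>G\<^esub> inv\<^bsub>G\<^esub> h"
    using hG v(1) u by (simp add: G.m_assoc)
  moreover have "v \<otimes>\<^bsub>G\<^esub> h \<otimes>\<^bsub>G\<^esub> inv\<^bsub>G\<^esub> v \<in> N" using N.inv_op_closed2 v(1) h by blast
  ultimately show ?thesis using h by simp
qed

end

section \<open>Residues, wings and thickness\<close>

context right_angled_building
begin

interpretation G: group G by (rule group_G)

lemma wall_residue_in_wing: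
  assumes r: "r \<in> I" and J: "J \<subseteq> I" and x: "reach (J \<inter> wall_type r) c x" "x \<in> wing r c"
  shows "reach (J \<inter> perp r) c x"
proof -
  have sub: "J \<inter> wall_type r \<subseteq> I" using J by blast
  obtain u where u: "u \<in> lists (J \<inter> wall_type r)" "reduced u" "gallery u c x" "\<delta> c x = val u"
    using reach_gallery[OF x(1) sub] by blast
  have key: "r \<notin> set u" if "u \<in> lists (wall_type r)" "reduced u" "\<not> descent r (val u)" for u
    using that
  proof (induction u rule: list.induct)
    case (Cons b u)
    have b: "b \<in> I" "reduced u" "u \<in> lists I"
      using Cons.prems(2) reducedD[of u] by (auto simp: reduced_Cons)
    have bw: "b \<in> wall_type r" "u \<in> lists (wall_type r)" using Cons.prems(1) by auto
    have "b \<noteq> r"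
    proof
      assume "b = r"
      then show False
        using Cons.prems(2,3) descent_mult_self[OF r val_closed[OF b(3)]] by (simp add: reduced_Cons)
    qed
    then have "b \<otimes> r = r \<otimes> b" using bw(1) by (simp add: perp_def)
    then have "\<not> descent r (val u)"
      using Cons.prems(3) descent_mult_commuting[OF val_closed[OF b(3)] b(1) r \<open>b \<noteq> r\<close>] by simp
    then show ?case using Cons.IH[OF bw(2) b(2)] \<open>b \<noteq> r\<close> by simp
  qed simp
  have "\<not> descent r (val u)" using x(2) u(4) by (simp add: wing_def)
  moreover have "u \<in> lists (wall_type r)" using u(1) lists_mono[of "J \<inter> wall_type r" "wall_type r"] by blast
  ultimately have "r \<notin> set u" using key u(2) by blast
  then have "u \<in> lists (J \<inter> perp r)" using u(1) by (auto simp: in_lists_conv_set)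
  then show ?thesis using gallery_reach[OF u(3)] reachD[OF x(1)] by blast
qed

lemma panel_third:
  assumes "thick W I Ch \<delta>" "s \<in> I" "c \<in> Ch"
  shows "\<exists>x. adj s c x \<and> x \<noteq> c \<and> x \<noteq> a"
proof -
  obtain T where T: "T \<subseteq> panel W Ch \<delta> s c" "card T = 3"
    using assms unfolding thick_def by blast
  have "\<not> T \<subseteq> {c, a}"
  proof
    assume "T \<subseteq> {c, a}"
    then have "card T \<le> card {c, a}" by (intro card_mono) auto
    then show False using T card_insert_le_m1[of 2 "{a}" c] by simp
  qed
  then obtain x where x: "x \<in> panel W Ch \<delta> s c" "x \<noteq> c" "x \<noteq> a" using T by blast
  then have "\<delta> c x = s" using WD1[of c x] assms by (auto simp: panel_def)
  then show ?thesis using x assms by (auto simp: adj_def panel_def)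
qed

lemma adj_dist: "\<lbrakk>adj s x y; x \<noteq> y\<rbrakk> \<Longrightarrow> \<delta> x y = s"
  unfolding adj_def by blast

end

section \<open>Transitivity properties\<close>

context homogeneous_right_angled_building
begin

interpretation G: group G by (rule group_G)

lemma wing_fixator_transitive:
  assumes "r \<in> I" "c \<in> Ch" "adj r c x" "adj r c y" "x \<noteq> c" "y \<noteq> c"
  shows "\<exists>n. isometry n \<and> (\<forall>z\<in>wing r c. n z = z) \<and> n x = y"
proof -
  obtain f where f: "colouring f" using colouring_exists by blast
  have "bij_betw (transpose x y) (pan r c) (pan r c)"
    using assms(3,4) by (intro bij_betwI[where g = "transpose x y"]) (auto simp: transpose_def)
  moreover have "transpose x y c = c" using assms(5,6) by (simp add: transpose_def)
  ultimately obtain n where n: "isometry n" "\<forall>z\<in>wing r c. n z = z"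
    "\<forall>z\<in>pan r c. n z = transpose x y z"
    using wing_fixator_on_panel[OF f assms(2,1)] by blast
  then have "n x = y" using assms(3) by simp
  then show ?thesis using n by blast
qed

text \<open>By induction on the length of galleries: once the galleries agree up to the last step, the
  fixator of the wing that contains \<open>c\<close> adjusts the last chamber.\<close>

theorem sphere_transitive:
  assumes "c \<in> Ch" "x \<in> Ch" "y \<in> Ch" "\<delta> c x = \<delta> c y"
  shows "\<exists>g \<in> carrier G. g c = c \<and> g x = y"
proof -
  obtain u where u: "reduced u" "gallery u c x" "val u = \<delta> c x"
    using gallery_reduced_exists assms by blast
  have "gallery u c y" using gallery_exists u assms reducedD by simp
  with u(1,2) show ?thesis
  proof (induction u arbitrary: x y rule: rev_induct)
    case Nil
    then show ?case using assms(1) G_one by (intro bexI[of _ "\<one>\<^bsub>G\<^esub>"]) auto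
  next
    case (snoc b u)
    obtain x' y' where x': "gallery u c x'" "adj b x' x" "x' \<noteq> x"
      and y': "gallery u c y'" "adj b y' y" "y' \<noteq> y"
      using snoc.prems(2,3) by (auto simp: path_append_iff path_Cons_iff)
    have red: "reduced u" using snoc.prems(1) by (rule reduced_append_left)
    obtain g where g: "g \<in> carrier G" "g c = c" "g x' = y'" using snoc.IH[OF red x'(1) y'(1)] by blast
    have b: "b \<in> I" "u \<in> lists I" using reducedD[OF snoc.prems(1)] by auto
    have C: "x' \<in> Ch" "x \<in> Ch" "y' \<in> Ch" "y \<in> Ch" using x' y' by auto
    have "adj b y' (g x)" using isometry_adj[OF carrier_isometry[OF g(1)] C(1,2)] x'(2) g(3) by simp
    moreover have "g x \<noteq> y'" using G_inj[OF g(1) C(1,2)] g(3) x'(3) by auto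
    ultimately obtain n where n: "isometry n" "\<forall>z\<in>wing b y'. n z = z" "n (g x) = y"
      using wing_fixator_transitive[OF b(1) C(3), of "g x" y] y' by blast
    obtain n' where n': "n' \<in> carrier G" "\<forall>z\<in>Ch. n' z = n z" using isometry_lift[OF n(1)] by blast
    have "c \<in> wing b y'"
    proof -
      have "\<delta> c y' = val u" using gallery_dist[OF y'(1) red assms(1)] by blast
      then have "\<delta> y' c = val (rev u)" using dist_inv[OF assms(1) C(3)] b by simp
      moreover have "reduced (b # rev u)" using reduced_rev[OF snoc.prems(1)] by simp
      ultimately show ?thesis using assms(1) by (simp add: wing_def reduced_Cons)
    qed
    then have "n c = c" using n by blast
    then show ?case
      using n' n(3) g G_mult[OF n'(1) g(1)] assms(1) C carrier_G_closed[OF g(1)]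
      by (intro bexI[of _ "n' \<otimes>\<^bsub>G\<^esub> g"]) auto
  qed
qed

theorem strongly_transitive_G: "strongly_transitive W Ch \<delta> G (\<lambda>g. g)"
proof -
  let ?E = "pointed_apartments W Ch \<delta>"
  define \<phi> where "\<phi> g = (\<lambda>(c, A) \<in> ?E. (g c, g ` A))" for g :: "'c \<Rightarrow> 'c"
  have E: "p \<in> ?E \<longleftrightarrow> (\<exists>\<alpha>. chart \<alpha> \<and> fst p \<in> \<alpha> ` carrier W \<and> snd p = \<alpha> ` carrier W)" for p
    by (cases p) (auto simp: pointed_apartments_def apartments_eq)
  have app: "\<phi> g p = (g (fst p), g ` snd p)" if "p \<in> ?E" for g p
    using that by (simp add: \<phi>_def case_prod_unfold)
  have ext: "\<phi> g \<in> extensional ?E" for g by (simp add: \<phi>_def)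
  have ECh: "fst p \<in> Ch" "snd p \<subseteq> Ch" if "p \<in> ?E" for p
    using that chart_closed unfolding E by auto
  have closed: "\<phi> g p \<in> ?E" if "g \<in> carrier G" "p \<in> ?E" for g p
  proof -
    obtain \<alpha> where \<alpha>: "chart \<alpha>" "fst p \<in> \<alpha> ` carrier W" "snd p = \<alpha> ` carrier W"
      using \<open>p \<in> ?E\<close> unfolding E by blast
    then have "chart (g \<circ> \<alpha>)" "g (fst p) \<in> (g \<circ> \<alpha>) ` carrier W" "g ` snd p = (g \<circ> \<alpha>) ` carrier W"
      using chart_image that by auto
    then have "(g (fst p), g ` snd p) \<in> ?E" unfolding E by auto
    then show ?thesis unfolding app[OF that(2)] .
  qed
  have mult: "\<phi> (g \<otimes>\<^bsub>G\<^esub> h) p = \<phi> g (\<phi> h p)"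
    if "g \<in> carrier G" "h \<in> carrier G" "p \<in> ?E" for g h p
  proof -
    have "(g \<otimes>\<^bsub>G\<^esub> h) ` snd p = g ` h ` snd p"
      using G_mult[OF that(1,2)] ECh(2)[OF that(3)] by (auto simp: image_image intro!: image_cong)
    then show ?thesis
      using app[OF that(3)] app[OF closed[OF that(2,3)], of g] G_mult[OF that(1,2) ECh(1)[OF that(3)]]
      by simp
  qed
  have one: "\<phi> \<one>\<^bsub>G\<^esub> p = p" if "p \<in> ?E" for p
  proof -
    have "\<one>\<^bsub>G\<^esub> ` snd p = snd p" using G_one ECh(2)[OF that] by force
    then show ?thesis using app[OF that] G_one ECh(1)[OF that] by simp
  qed
  have Bij: "\<phi> g \<in> Bij ?E" if g: "g \<in> carrier G" for g
  proof -
    have "bij_betw (\<phi> g) ?E ?E"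
    proof (rule bij_betwI[where g = "\<phi> (inv\<^bsub>G\<^esub> g)"])
      show "\<phi> g \<in> ?E \<rightarrow> ?E" "\<phi> (inv\<^bsub>G\<^esub> g) \<in> ?E \<rightarrow> ?E" using closed g by blast+
      show "\<phi> (inv\<^bsub>G\<^esub> g) (\<phi> g p) = p" if "p \<in> ?E" for p
        using mult[of "inv\<^bsub>G\<^esub> g" g p] one[OF that] g that by simp
      show "\<phi> g (\<phi> (inv\<^bsub>G\<^esub> g) p) = p" if "p \<in> ?E" for p
        using mult[of g "inv\<^bsub>G\<^esub> g" p] one[OF that] g that by simp
    qed
    then show ?thesis using ext by (simp add: Bij_def)
  qed
  have "group_hom G (BijGroup ?E) \<phi>"
  proof (rule group_hom.intro[OF group_G group_BijGroup], unfold_locales, rule homI)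
    fix g h assume g: "g \<in> carrier G" and h: "h \<in> carrier G"
    show "\<phi> g \<in> carrier (BijGroup ?E)" using Bij[OF g] by (simp add: BijGroup_def)
    have "\<phi> (g \<otimes>\<^bsub>G\<^esub> h) = compose ?E (\<phi> g) (\<phi> h)"
    proof (rule extensionalityI)
      show "\<phi> (g \<otimes>\<^bsub>G\<^esub> h) p = compose ?E (\<phi> g) (\<phi> h) p" if "p \<in> ?E" for p
        using mult[OF g h that] that by (simp add: compose_def)
    qed (simp_all add: ext)
    then show "\<phi> (g \<otimes>\<^bsub>G\<^esub> h) = \<phi> g \<otimes>\<^bsub>BijGroup ?E\<^esub> \<phi> h"
      using Bij[OF g] Bij[OF h] by (simp add: BijGroup_def)
  qed
  moreover have "\<exists>g \<in> carrier G. \<phi> g p = q" if p: "p \<in> ?E" and q: "q \<in> ?E" for p q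
  proof -
    obtain \<alpha> v where \<alpha>: "chart \<alpha>" "snd p = \<alpha> ` carrier W" and v: "v \<in> carrier W" "fst p = \<alpha> v"
      using p unfolding E by blast
    obtain \<beta> w where \<beta>: "chart \<beta>" "snd q = \<beta> ` carrier W" and w: "w \<in> carrier W" "fst q = \<beta> w"
      using q unfolding E by blast
    obtain f where f: "colouring f" using colouring_exists by blast
    obtain n where n: "isometry n" "\<forall>x\<in>carrier W. n (\<alpha> (v \<otimes> x)) = \<beta> (w \<otimes> x)"
      using chart_extension[OF f chart_translate(1)[OF \<alpha>(1) v(1)] chart_translate(1)[OF \<beta>(1) w(1)]]
      by blast
    obtain g where g: "g \<in> carrier G" "\<forall>x\<in>Ch. g x = n x" using isometry_lift[OF n(1)] by blast
    have gn: "g (\<alpha> (v \<otimes> x)) = \<beta> (w \<otimes> x)" if "x \<in> carrier W" for x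
      using that n g chart_closed[OF \<alpha>(1)] v by simp
    have "g (fst p) = fst q" using gn[of \<one>] v w by simp
    moreover have "g ` snd p = snd q"
    proof -
      have "g ` snd p = (\<lambda>x. g (\<alpha> (v \<otimes> x))) ` carrier W"
        unfolding \<alpha>(2) chart_translate(2)[OF \<alpha>(1) v(1), symmetric] by (simp add: image_image)
      also have "\<dots> = (\<lambda>x. \<beta> (w \<otimes> x)) ` carrier W" using gn by simp
      also have "\<dots> = snd q" using chart_translate(2)[OF \<beta>(1) w(1)] \<beta>(2) by simp
      finally show ?thesis .
    qed
    ultimately have "\<phi> g p = q" using app[OF p] by simp
    then show ?thesis using g by blast
  qed
  ultimately have "transitive_action G ?E \<phi>"
    by (intro transitive_action.intro group_action.intro transitive_action_axioms.intro)
  moreover have "\<phi> = (\<lambda>g. \<lambda>(c, A) \<in> ?E. (g c, g ` A))" by (simp add: fun_eq_iff \<phi>_def)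
  ultimately show ?thesis unfolding strongly_transitive_def by simp
qed

section \<open>Normal subgroups\<close>

context
  fixes N
  assumes N: "N \<lhd> G"
begin

interpretation N: normal N G by (rule N)

text \<open>Since \<open>N\<close> is normal and chamber stabilizers are transitive on spheres, the orbits of \<open>N\<close>
  depend on Weyl distances only.\<close>

lemma normal_orbit:
  assumes n: "n \<in> N" and c: "c \<in> Ch" and xy: "x \<in> Ch" "y \<in> Ch" "\<delta> x y = \<delta> c (n c)"
  shows "\<exists>m \<in> N. m x = y"
proof -
  have nG: "n \<in> carrier G" using n by (rule N.mem_carrier)
  obtain g0 where "isometry g0" "g0 c = x" using homogeneous[OF c xy(1)] by blast
  then obtain g where g: "g \<in> carrier G" "g c = x" using isometry_lift c by metis
  have nc: "n c \<in> Ch" using carrier_G_closed nG c by blast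
  have gC: "g (n c) \<in> Ch" using carrier_G_closed g(1) nc by blast
  have "\<delta> x (g (n c)) = \<delta> x y" using carrier_G_dist[OF g(1) c nc] g(2) xy(3) by simp
  then obtain h where h: "h \<in> carrier G" "h x = x" "h (g (n c)) = y"
    using sphere_transitive[OF xy(1) gC xy(2)] by blast
  let ?k = "h \<otimes>\<^bsub>G\<^esub> g"
  have k: "?k \<in> carrier G" "?k c = x" "?k (n c) = y"
    using g h G_mult[OF h(1) g(1)] c nc by auto
  have kx: "(inv\<^bsub>G\<^esub> ?k) x = c" using G_inv[OF k(1) c] k(2) by simp
  have "(?k \<otimes>\<^bsub>G\<^esub> n \<otimes>\<^bsub>G\<^esub> inv\<^bsub>G\<^esub> ?k) x = y"
    using G_mult[of "?k \<otimes>\<^bsub>G\<^esub> n" "inv\<^bsub>G\<^esub> ?k" x] G_mult[OF k(1) nG c] k nG xy(1) kx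
    by (simp del: G.inv_mult_group)
  moreover have "?k \<otimes>\<^bsub>G\<^esub> n \<otimes>\<^bsub>G\<^esub> inv\<^bsub>G\<^esub> ?k \<in> N" using N.inv_op_closed2[OF k(1) n] .
  ultimately show ?thesis by blast
qed

text \<open>By thickness the \<open>s\<close>-panel of \<open>c\<close> contains two chambers at the same distance from \<open>n c\<close>. The orbit of
  \<open>n c\<close> contains both, hence contains an \<open>s\<close>-adjacent pair.\<close>

lemma normal_moves_descent:
  assumes th: "thick W I Ch \<delta>" and n: "n \<in> N" and c: "c \<in> Ch"
    and s: "s \<in> I" "descent s (\<delta> c (n c))" and xy: "x \<in> Ch" "adj s x y"
  shows "\<exists>m \<in> N. m x = y"
proof (cases "x = y")
  case True
  then show ?thesis using G_one xy by (intro bexI[of _ "\<one>\<^bsub>G\<^esub>"]) auto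
next
  case False
  have nG: "n \<in> carrier G" using n by (rule N.mem_carrier)
  let ?w = "\<delta> c (n c)"
  have nc: "n c \<in> Ch" using carrier_G_closed nG c by blast
  have w: "?w \<in> carrier W" using dist_closed c nc by blast
  obtain u where u: "reduced u" "val u = s \<otimes> ?w" using reduced_exists[of "s \<otimes> ?w"] s w by auto
  have uI: "u \<in> lists I" using u reducedD by blast
  have su: "reduced (s # u)" "val (s # u) = ?w"
    using u s w descent_mult_self[OF s(1) w] by (auto simp: reduced_Cons)
  have "gallery (s # u) c (n c)" using gallery_exists[OF reducedD[OF su(1)] c nc su(2)[symmetric]] .
  then obtain a where a: "adj s c a" "c \<noteq> a" "gallery u a (n c)" by (auto simp: path_Cons_iff)
  \<comment> \<open>\<open>a\<close> is the projection of \<open>n c\<close> to the panel, so \<open>a'\<close> is as far from \<open>n c\<close> as \<open>c\<close> is\<close>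
  obtain a' where a': "adj s c a'" "a' \<noteq> c" "a' \<noteq> a" using panel_third[OF th s(1) c] by blast
  have "adj s a' a" using adj_trans[OF s(1) adj_sym[OF s(1) a'(1)] a(1)] .
  then have "gallery (s # u) a' (n c)" using a a' by (auto simp: path_Cons_iff)
  then have "\<delta> a' (n c) = ?w" using gallery_dist[OF _ su(1)] su(2) a' by auto
  then obtain m where m: "m \<in> N" "m a' = n c" using normal_orbit[OF n c _ nc] a' by blast
  have mG: "m \<in> carrier G" using m(1) by (rule N.mem_carrier)
  let ?k = "inv\<^bsub>G\<^esub> m \<otimes>\<^bsub>G\<^esub> n"
  have k: "?k \<in> N" using m n by simp
  have "?k c = a'" using G_mult[of "inv\<^bsub>G\<^esub> m" n c] mG nG c m(2) G_inv[OF mG, of a'] a' by auto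
  then have "\<delta> c (?k c) = \<delta> x y" using adj_dist a' xy False by metis
  then show ?thesis using normal_orbit[OF k c xy(1) _] xy(2) by auto
qed

text \<open>Let \<open>M\<close> be the set of descents of the distances by which \<open>N\<close> moves chambers; \<open>N\<close> is
  transitive on panels with type in \<open>M\<close>. If \<open>s \<in> M\<close> and \<open>t\<close> does not commute with
  \<open>s\<close>, then some element of \<open>N\<close> moves a chamber by \<open>t s t\<close>, so \<open>t \<in> M\<close>. Irreducibility gives \<open>M = I\<close>.\<close>

lemma normal_chamber_transitive:
  assumes th: "thick W I Ch \<delta>" and irr: "irreducible_type W I" and N1: "N \<noteq> {\<one>\<^bsub>G\<^esub>}"
    and xy: "x \<in> Ch" "y \<in> Ch"
  shows "\<exists>m \<in> N. m x = y"
proof -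
  obtain n where n: "n \<in> N" "n \<noteq> \<one>\<^bsub>G\<^esub>" using N1 N.one_closed by blast
  have nG: "n \<in> carrier G" using n(1) by (rule N.mem_carrier)
  obtain c where c: "c \<in> Ch" "n c \<noteq> c" using G_eqI[OF nG G.one_closed] n(2) G_one by metis
  define M where "M = {s \<in> I. \<exists>n\<in>N. \<exists>c\<in>Ch. descent s (\<delta> c (n c))}"
  have M: "\<exists>m \<in> N. m x = y" if "s \<in> M" "adj s x y" for s x y
    using normal_moves_descent[OF th] that unfolding M_def by blast
  have nc: "n c \<in> Ch" using carrier_G_closed nG c by blast
  have "\<delta> c (n c) \<noteq> \<one>" using WD1[OF c(1) nc] c by simp
  moreover obtain u where u: "reduced u" "val u = \<delta> c (n c)"
    using reduced_exists[OF dist_closed[OF c(1) nc]] by blast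
  ultimately obtain s u' where "u = s # u'" by (cases u) auto
  then have s: "s \<in> I" "descent s (\<delta> c (n c))"
    using u descent_mult_self[of s "val u'"] reducedD[of u'] by (auto simp: reduced_Cons)
  have "M \<noteq> {}" using s n(1) c(1) unfolding M_def by blast
  have spread: "t \<in> M" if s: "s \<in> M" and t: "t \<in> I" "s \<otimes> t \<noteq> t \<otimes> s" for s t
  proof -
    have sI: "s \<in> I" using s by (simp add: M_def)
    obtain e where e: "adj s c e" "e \<noteq> c" using panel_third[OF th sI c(1)] by blast
    obtain m where m: "m \<in> N" "m c = e" using M[OF s e(1)] by blast
    have mG: "m \<in> carrier G" using m(1) by (rule N.mem_carrier)
    obtain d where d: "adj t c d" "d \<noteq> c" using panel_third[OF th t(1) c(1)] by blast
    have C: "d \<in> Ch" "e \<in> Ch" using d e by auto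
    have "adj t e (m d)" using isometry_adj[OF carrier_isometry[OF mG] c(1) C(1)] d m by simp
    moreover have "e \<noteq> m d" using G_inj[OF mG c(1) C(1)] m d by auto
    ultimately have "gallery [t, s, t] d (m d)"
      using adj_sym[OF t(1) d(1)] d e by (auto simp: path_Cons_iff)
    then have "\<delta> d (m d) = val [t, s, t]"
      using gallery_dist reduced_triple[OF sI t] C by blast
    moreover have "descent t (val [t, s, t])"
      using reduced_triple[OF sI t] descent_prefix[of "[t]" "[s, t]" t] descent_mult_self[of t \<one>] t(1)
      by simp
    ultimately have "descent t (\<delta> d (m d))" by (simp only:)
    then show ?thesis using t(1) m(1) C(1) unfolding M_def by blast
  qed
  have "I - M = {}"
  proof (rule ccontr)
    assume ne: "I - M \<noteq> {}"
    have "M \<inter> (I - M) = {}" "M \<union> (I - M) = I" by (auto simp: M_def)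
    moreover have "\<forall>s\<in>M. \<forall>t\<in>I - M. s \<otimes> t = t \<otimes> s" using spread by blast
    ultimately have "\<exists>J K. J \<noteq> {} \<and> K \<noteq> {} \<and> J \<inter> K = {} \<and> J \<union> K = I \<and>
        (\<forall>s\<in>J. \<forall>t\<in>K. s \<otimes> t = t \<otimes> s)"
      using ne \<open>M \<noteq> {}\<close> by (intro exI[of _ M] exI[of _ "I - M"] conjI)
    then show False using irr unfolding irreducible_type_def by (elim conjE notE)
  qed
  then have IM: "I \<subseteq> M" by blast
  show ?thesis
    using reach_all[OF xy]
  proof (induction rule: reach.induct)
    case reach_refl
    then show ?case using G_one xy by (intro bexI[of _ "\<one>\<^bsub>G\<^esub>"]) auto
  next
    case (reach_step y s z)
    then obtain m where m: "m \<in> N" "m x = y" by blast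
    obtain m' where m': "m' \<in> N" "m' y = z" using M[of s y z] reach_step IM by blast
    have "(m' \<otimes>\<^bsub>G\<^esub> m) x = z"
      using G_mult[OF N.mem_carrier[OF m'(1)] N.mem_carrier[OF m(1)] xy(1)] m m' by simp
    then show ?case using m m' by (intro bexI[of _ "m' \<otimes>\<^bsub>G\<^esub> m"]) auto
  qed
qed

text \<open>Take chambers \<open>c\<close>, \<open>d\<close>, \<open>d'\<close> in one \<open>t\<close>-panel and an \<open>s\<close>-neighbour \<open>e\<close> of \<open>d'\<close>. The wing of \<open>c\<close>
  contains the disjoint complements of the wings of \<open>d\<close> and \<open>d'\<close>, and the second of them contains the wing
  of \<open>e\<close>. An element of \<open>N\<close> taking \<open>c\<close> to \<open>e\<close> thus maps the wing of \<open>c\<close> into itself and off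
  the complement of the wing of \<open>d\<close>, where \<open>u\<close> is supported.\<close>

lemma wing_fixators_in_normal:
  assumes th: "thick W I Ch \<delta>"
    and tr: "\<And>x y. \<lbrakk>x \<in> Ch; y \<in> Ch\<rbrakk> \<Longrightarrow> \<exists>m \<in> N. m x = y"
    and st: "s \<in> I" "t \<in> I" "s \<otimes> t \<noteq> t \<otimes> s"
    and d: "d \<in> Ch" and u: "u \<in> carrier G" "\<And>x. x \<in> wing s d \<Longrightarrow> u x = x"
  shows "u \<in> N"
proof -
  obtain c where c: "adj t d c" "c \<noteq> d" using panel_third[OF th st(2) d] by blast
  obtain d' where d': "adj t d d'" "d' \<noteq> d" "d' \<noteq> c" using panel_third[OF th st(2) d] by blast
  obtain e where e: "adj s d' e" "e \<noteq> d'" using panel_third[OF th st(1), of d'] d' by blast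
  have C: "c \<in> Ch" "d' \<in> Ch" "e \<in> Ch" using c d' e by auto
  have cd: "\<delta> c d = t" using adj_dist adj_sym[OF st(2) c(1)] c(2) by blast
  have cd': "\<delta> c d' = t"
    using adj_dist adj_trans[OF st(2) adj_sym[OF st(2) c(1)] d'(1)] d'(3) by blast
  have dd': "\<delta> d d' = t" using adj_dist d' by blast
  have de: "\<delta> d' e = s" using adj_dist e by blast
  obtain h where h: "h \<in> N" "h c = e" using tr C by blast
  have hG: "h \<in> carrier G" using h(1) by (rule N.mem_carrier)
  show ?thesis
  proof (rule translated_support_in_normal[OF N h(1) u(1), where D = "Ch - wing s d" and H = "wing s c"])
    show "Ch - wing s d \<subseteq> wing s c" using wing_complement_nested[OF st C(1) d cd] .
    show "wing s c \<subseteq> Ch" by (rule wing_sub)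
    show "u x = x" if "x \<in> Ch - (Ch - wing s d)" for x using u(2) that by blast
    show "h x \<in> wing s c - (Ch - wing s d)" if x: "x \<in> wing s c" for x
    proof -
      have "h x \<in> wing s e"
        using isometry_wing[OF carrier_isometry[OF hG], of x c s] x C wing_sub h by blast
      then have "h x \<in> Ch - wing s d'" using wings_of_panel_disjoint[OF st(1) C(2,3) de] by blast
      then show ?thesis
        using wing_complement_nested[OF st C(1,2) cd'] wing_complement_nested[OF st d C(2) dd'] by blast
    qed
  qed
qed

text \<open>Pick \<open>r \<in> J\<close>. By induction \<open>g\<close> may be assumed trivial on the residue of type \<open>J \<inter> perp r\<close>, which is
  the boundary of the wing of \<open>c\<close> inside the residue of type \<open>J\<close>. Then the action of \<open>g\<close> on the part of
  that residue outside the wing extends to an isometry fixing the wing, and once this is divided out, the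
  action inside the wing extends to an isometry fixing the complement, which contains another
  wing. Fixators of wings are the only ingredients, so the product lies in \<open>N\<close>.\<close>

lemma stabilizer_on_residue:
  assumes th: "thick W I Ch \<delta>"
    and UN: "\<And>s d u. \<lbrakk>s \<in> I; d \<in> Ch; u \<in> carrier G; \<And>x. x \<in> wing s d \<Longrightarrow> u x = x\<rbrakk> \<Longrightarrow> u \<in> N"
    and c: "c \<in> Ch" and g: "g \<in> carrier G" "g c = c"
  shows "\<lbrakk>finite J; J \<subseteq> I\<rbrakk> \<Longrightarrow> \<exists>n \<in> N. \<forall>x. reach J c x \<longrightarrow> n x = g x"
proof (induction J rule: finite_psubset_induct)
  case (psubset J)
  show ?case
  proof (cases "J = {}")
    case True
    have "\<one>\<^bsub>G\<^esub> x = g x" if x: "reach J c x" for x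
    proof -
      have "x = c" using x unfolding True by (rule reach_empty)
      then show ?thesis using G_one[OF c] g(2) by simp
    qed
    then show ?thesis using N.one_closed by blast
  next
    case False
    then obtain r where r: "r \<in> J" by blast
    then have rI: "r \<in> I" using psubset by blast
    obtain f where f: "colouring f" using colouring_exists by blast
    have "J \<inter> perp r \<subset> J" using r by (auto simp: perp_def)
    then obtain n0 where n0: "n0 \<in> N" "\<And>x. reach (J \<inter> perp r) c x \<Longrightarrow> n0 x = g x"
      using psubset.IH psubset.prems by blast
    have n0G: "n0 \<in> carrier G" using n0(1) by (rule N.mem_carrier)
    let ?g1 = "inv\<^bsub>G\<^esub> n0 \<otimes>\<^bsub>G\<^esub> g"
    have g1: "?g1 \<in> carrier G" using n0G g by simp
    have g1_fix: "?g1 x = x" if "reach (J \<inter> perp r) c x" for x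
      using n0(2)[OF that] G_mult[of "inv\<^bsub>G\<^esub> n0" g x] G_inv[OF n0G, of x] reachD[OF that] n0G g by simp
    have bij: "bij_betw k (pan s x) (pan s (k x))" if "k \<in> carrier G" "reach J c x" for k s x
      using isometry_panel[OF carrier_isometry] reachD that by blast
    obtain m1 where m1: "isometry m1" "\<forall>x\<in>wing r c. m1 x = x"
      "\<forall>x\<in>Ch - wing r c. reach J c x \<longrightarrow> m1 x = ?g1 x"
      using outside_wing_extension[OF f psubset.prems c r bij[OF g1] g1_fix] by blast
    obtain n1 where n1: "n1 \<in> carrier G" "\<forall>x\<in>Ch. n1 x = m1 x" using isometry_lift[OF m1(1)] by blast
    have n1_fix: "n1 x = x" if x: "x \<in> wing r c" for x
    proof -
      have "x \<in> Ch" using x wing_sub by blast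
      then show ?thesis using n1(2) m1(2) x by simp
    qed
    have n1_eq: "n1 x = ?g1 x" if "x \<notin> wing r c" "reach J c x" for x
      using that n1 m1 reachD[OF that(2)] by auto
    \<comment> \<open>what is left, \<open>g2\<close>, is trivial on the part of the residue outside the wing\<close>
    have n1N: "n1 \<in> N" using UN[OF rI c n1(1) n1_fix] .
    let ?g2 = "inv\<^bsub>G\<^esub> n1 \<otimes>\<^bsub>G\<^esub> ?g1"
    have g2: "?g2 \<in> carrier G" using n1 g1 by simp
    have g2_fix: "?g2 x = x" if "n1 x = ?g1 x" "x \<in> Ch" for x
      using that G_mult[of "inv\<^bsub>G\<^esub> n1" ?g1 x] G_inv[OF n1(1), of x] n1 g1 by simp
    have g2_wall: "?g2 x = x" if x: "reach (J \<inter> wall_type r) c x" for x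
    proof (cases "x \<in> wing r c")
      case True
      then have "reach (J \<inter> perp r) c x" using wall_residue_in_wing[OF rI psubset.prems x] by blast
      then show ?thesis using g2_fix g1_fix n1_fix[OF True] reachD[OF x] by simp
    next
      case False
      have "reach J c x" using x by (rule reach_mono) blast
      then show ?thesis using g2_fix n1_eq[OF False] reachD[OF x] by blast
    qed
    obtain m2 where m2: "isometry m2" "\<forall>x\<in>Ch - wing r c. m2 x = x"
      "\<forall>x\<in>wing r c. reach J c x \<longrightarrow> m2 x = ?g2 x"
      using inside_wing_extension[OF f psubset.prems c r bij[OF g2] g2_wall] by blast
    obtain n2 where n2: "n2 \<in> carrier G" "\<forall>x\<in>Ch. n2 x = m2 x" using isometry_lift[OF m2(1)] by blast
    obtain e where e: "adj r c e" "e \<noteq> c" using panel_third[OF th rI c] by blast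
    have eC: "e \<in> Ch" using e by blast
    have "\<delta> c e = r" using adj_dist e by blast
    then have sub: "wing r e \<subseteq> Ch - wing r c" by (rule wings_of_panel_disjoint[OF rI c eC])
    have n2_fix: "n2 x = x" if "x \<in> wing r e" for x
    proof -
      have "x \<in> Ch - wing r c" using that sub by blast
      then show ?thesis using n2(2) m2(2) by simp
    qed
    have n2N: "n2 \<in> N" using UN[OF rI eC n2(1) n2_fix] .
    have n2_eq: "n2 x = ?g2 x" if x: "reach J c x" for x
    proof (cases "x \<in> wing r c")
      case True
      then show ?thesis using n2 m2 x reachD[OF x] by simp
    next
      case False
      then show ?thesis using n2 m2 g2_fix n1_eq[OF False x] reachD[OF x] by simp
    qed
    have "(n0 \<otimes>\<^bsub>G\<^esub> (n1 \<otimes>\<^bsub>G\<^esub> n2)) x = g x" if x: "reach J c x" for x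
    proof -
      have xC: "x \<in> Ch" using reachD[OF x] by blast
      have g2x: "n2 x = (inv\<^bsub>G\<^esub> n1) (?g1 x)"
        using n2_eq[OF x] G_mult[of "inv\<^bsub>G\<^esub> n1" ?g1 x] n1 g1 xC by simp
      have g1x: "?g1 x = (inv\<^bsub>G\<^esub> n0) (g x)"
        using G_mult[of "inv\<^bsub>G\<^esub> n0" g x] n0G g xC by simp
      have "(n0 \<otimes>\<^bsub>G\<^esub> (n1 \<otimes>\<^bsub>G\<^esub> n2)) x = n0 (n1 (n2 x))"
        using G_mult[OF n0G, of "n1 \<otimes>\<^bsub>G\<^esub> n2" x] G_mult[OF n1(1) n2(1) xC] n1 n2 xC by simp
      also have "\<dots> = n0 (?g1 x)"
        unfolding g2x using G_inv'[OF n1(1) carrier_G_closed[OF g1 xC]] by simp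
      also have "\<dots> = g x"
        unfolding g1x using G_inv'[OF n0G carrier_G_closed[OF g(1) xC]] .
      finally show ?thesis .
    qed
    then show ?thesis using n0(1) n1N n2N by (intro bexI[of _ "n0 \<otimes>\<^bsub>G\<^esub> (n1 \<otimes>\<^bsub>G\<^esub> n2)"]) auto
  qed
qed

end

text \<open>Otherwise irreducibility forces \<open>I = {s}\<close>, and then \<open>W\<close> has two elements.\<close>

lemma noncommuting_exists:
  assumes irr: "irreducible_type W I" and ns: "\<not> spherical_type W" and s: "s \<in> I"
  shows "\<exists>t \<in> I. s \<otimes> t \<noteq> t \<otimes> s"
proof (rule ccontr)
  assume "\<not> (\<exists>t \<in> I. s \<otimes> t \<noteq> t \<otimes> s)"
  then have c: "\<forall>s'\<in>{s}. \<forall>t\<in>I - {s}. s' \<otimes> t = t \<otimes> s'" by blast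
  have "I - {s} = {}"
  proof (rule ccontr)
    assume "I - {s} \<noteq> {}"
    moreover have "{s} \<inter> (I - {s}) = {}" "{s} \<union> (I - {s}) = I" using s by auto
    ultimately have "\<exists>J K. J \<noteq> {} \<and> K \<noteq> {} \<and> J \<inter> K = {} \<and> J \<union> K = I \<and>
        (\<forall>s\<in>J. \<forall>t\<in>K. s \<otimes> t = t \<otimes> s)"
      using c by (intro exI[of _ "{s}"] exI[of _ "I - {s}"] conjI) simp_all
    then show False using irr unfolding irreducible_type_def by (elim conjE notE)
  qed
  then have I: "I = {s}" using s by blast
  have "carrier W \<subseteq> {\<one>, s}"
  proof
    fix w assume "w \<in> carrier W"
    then obtain u where u: "u \<in> lists I" "val u = w" using word_exists by blast
    have "val u \<in> {\<one>, s}" using u(1) unfolding I by (induction u) (use s in auto)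
    then show "w \<in> {\<one>, s}" using u by simp
  qed
  then show False using ns finite_subset unfolding spherical_type_def by blast
qed

theorem abstractly_simple_G:
  assumes fin: "finite I" and irr: "irreducible_type W I" and ns: "\<not> spherical_type W"
    and th: "thick W I Ch \<delta>"
  shows "abstractly_simple G"
  unfolding abstractly_simple_def
proof (intro conjI allI impI)
  show "group G" by (rule group_G)
  obtain s where s: "s \<in> I" using irr unfolding irreducible_type_def by blast
  obtain x where x: "adj s base_chamber x" "x \<noteq> base_chamber"
    using panel_third[OF th s base_chamber] by blast
  have xC: "x \<in> Ch" using x by blast
  obtain g0 where "isometry g0" "g0 base_chamber = x" using homogeneous[OF base_chamber xC] by blast
  then obtain g where g: "g \<in> carrier G" "g base_chamber = x"
    using isometry_lift base_chamber by metis
  then have "g \<noteq> \<one>\<^bsub>G\<^esub>" using x G_one[OF base_chamber] by auto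
  then show "carrier G \<noteq> {\<one>\<^bsub>G\<^esub>}" using g by blast
next
  fix N assume N: "N \<lhd> G"
  interpret N: normal N G by (rule N)
  show "N = {\<one>\<^bsub>G\<^esub>} \<or> N = carrier G"
  proof (cases "N = {\<one>\<^bsub>G\<^esub>}")
    case False
    have tr: "\<exists>m \<in> N. m x = y" if "x \<in> Ch" "y \<in> Ch" for x y
      using normal_chamber_transitive[OF N th irr False that] .
    have UN: "u \<in> N" if h: "s \<in> I" "d \<in> Ch" "u \<in> carrier G" "\<And>x. x \<in> wing s d \<Longrightarrow> u x = x" for s d u
    proof -
      obtain t where "t \<in> I" "s \<otimes> t \<noteq> t \<otimes> s" using noncommuting_exists[OF irr ns h(1)] by blast
      then show ?thesis using wing_fixators_in_normal[OF N th tr h(1) _ _ h(2-4)] by blast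
    qed
    have "g \<in> N" if g: "g \<in> carrier G" for g
    proof -
      let ?c = base_chamber
      obtain m where m: "m \<in> N" "m ?c = g ?c"
        using tr[OF base_chamber carrier_G_closed[OF g base_chamber]] by blast
      have mG: "m \<in> carrier G" using m(1) by (rule N.mem_carrier)
      let ?h = "inv\<^bsub>G\<^esub> m \<otimes>\<^bsub>G\<^esub> g"
      have h: "?h \<in> carrier G" "?h ?c = ?c"
        using G_mult[of "inv\<^bsub>G\<^esub> m" g ?c] G_inv[OF mG base_chamber] m(2) mG g by auto
      have "\<exists>n \<in> N. \<forall>x. reach I ?c x \<longrightarrow> n x = ?h x"
      proof (rule stabilizer_on_residue[OF N th _ base_chamber h fin subset_refl])
        show "u \<in> N" if "s \<in> I" "d \<in> Ch" "u \<in> carrier G" "\<And>x. x \<in> wing s d \<Longrightarrow> u x = x" for s d u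
          using that by (rule UN)
      qed
      then obtain n where n: "n \<in> N" "\<forall>x. reach I ?c x \<longrightarrow> n x = ?h x" by blast
      have "n = ?h"
      proof (rule G_eqI[OF N.mem_carrier[OF n(1)] h(1)])
        show "n x = ?h x" if "x \<in> Ch" for x
          using n(2) reach_all[OF base_chamber that] by blast
      qed
      then have "?h \<in> N" using n by simp
      then have "m \<otimes>\<^bsub>G\<^esub> ?h \<in> N" using m by simp
      then show ?thesis using mG g by (simp add: G.m_assoc[symmetric])
    qed
    then show ?thesis using N.mem_carrier by blast
  qed simp
qed

end

section \<open>Strong transitivity and simplicity\<close>

theorem corollary1p2:
  fixes W :: "('w, 'b) monoid_scheme" and I :: "'w set"
    and Ch :: "'c set" and \<delta> :: "'c \<Rightarrow> 'c \<Rightarrow> 'w"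
  assumes "building W I Ch \<delta>"
    and "finite I"
    and "irreducible_type W I"
    and "right_angled W I"
    and "\<not> spherical_type W"
    and "thick W I Ch \<delta>"
    and "transitive_action (Aut_plus Ch \<delta>) Ch (\<lambda>g. g)"
  shows "strongly_transitive W Ch \<delta> (Aut_plus Ch \<delta>) (\<lambda>g. g) \<and>
    abstractly_simple (Aut_plus Ch \<delta>)"
proof -
  interpret building W I Ch \<delta> by fact
  interpret right_angled_building W I Ch \<delta> by unfold_locales fact
  interpret homogeneous_right_angled_building W I Ch \<delta>
  proof unfold_locales
    fix x y assume "x \<in> Ch" "y \<in> Ch"
    then obtain g where "g \<in> carrier (Aut_plus Ch \<delta>)" "g x = y"
      using transitive_action.unique_orbit[OF assms(7)] by blast
    then show "\<exists>g. isometry g \<and> g x = y" using carrier_isometry by blast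
  qed
  show ?thesis using strongly_transitive_G abstractly_simple_G assms by blast
qed

end
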